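(* Let $n\ge2$ and $\mathfrak g=\mathfrak{sl}(n,\mathbb C)$. For $\sigma\in\mathrm{Irr}(\mathfrak{sl}(n-1,\mathbb C))_{\mathrm{fin}}$ and $s,r\in\mathbb C$ we have $$\operatorname{Hom}_{\mathfrak g}(M_{\mathfrak p}(\sigma,r),M_{\mathfrak p}(\mathrm{triv},s))=\begin{cases}\mathbb C\,\mathrm{id}&\text{if }(\sigma,r)=(\mathrm{triv},s),\\ \mathbb C\,\varphi_k&\text{if }(\sigma;s,r)\in\Lambda^n_{\mathfrak g},\\ \{0\}&\text{otherwise,}\end{cases}$$ where $\Lambda^n_{\mathfrak g}=\{(\mathrm{sym}^k_{n-1};k-1,-(1+\frac{k}{n-1})):k\in\mathbb Z_{\ge0}\}$, and in the second case $k\in\mathbb Z_{\ge0}$ is the integer with $s=k-1$ and $r=-(1+\frac{k}{n-1})$.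
   Context: Let $n\ge2$, $\mathfrak g=\mathfrak{sl}(n,\mathbb C)$, $E_{i,j}$ the matrix units, $N_j^+=E_{1,j+1}$, $N_j^-=E_{j+1,1}$ ($1\le j\le n-1$), $\widetilde H_0=\frac1{n-1}\mathrm{diag}(n-1,-1,\dots,-1)$. Put $\mathfrak n_\pm=\mathrm{span}_{\mathbb C}\{N_j^\pm\}$, $\mathfrak a=\mathbb C\widetilde H_0$, $\mathfrak m=\{\mathrm{diag}(0,X):X\in\mathfrak{sl}(n-1,\mathbb C)\}\cong\mathfrak{sl}(n-1,\mathbb C)$ (with $\mathfrak{sl}(1,\mathbb C)=\{0\}$), and $\mathfrak p=\mathfrak m\oplus\mathfrak a\oplus\mathfrak n_+$, the maximal parabolic subalgebra for the partition $n=1+(n-1)$. $\mathrm{Irr}(\mathfrak{sl}(n-1,\mathbb C))_{\mathrm{fin}}$ is the set of equivalence classes of finite-dimensional irreducible representations of $\mathfrak{sl}(n-1,\mathbb C)$. For $\sigma$ in this set with space $W$ and $s\in\mathbb C$, $M_{\mathfrak p}(\sigma,s)=\mathcal U(\mathfrak g)\otimes_{\mathcal U(\mathfrak p)}W$, where $\mathfrak m$ acts on $W$ by $\sigma$, $\widetilde H_0$ acts by the scalar $s$, and $\mathfrak n_+$ acts by $0$. $\mathrm{sym}^k_{n-1}$ is the irreducible representation on $S^k(\mathbb C^{n-1})$; $\mathrm{sym}_1^k=\mathrm{triv}$ for all $k$. The map $\varphi_k$. Let $e_1,\dots,e_{n-1}$ be the standard basis of $\mathbb C^{n-1}$, $\Xi_k=\{\mathbf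 k=(k_1,\dots,k_{n-1})\in(\mathbb Z_{\ge0})^{n-1}:\sum_jk_j=k\}$, $e_{\mathbf k}=e_1^{k_1}\cdots e_{n-1}^{k_{n-1}}\in S^k(\mathbb C^{n-1})$, $N^-_{\mathbf k}=(N_1^-)^{k_1}\cdots(N_{n-1}^-)^{k_{n-1}}\in S^k(\mathfrak n_-)$. As linear spaces $M_{\mathfrak p}(\mathrm{triv},s)\cong S(\mathfrak n_-)$ via $u\mapsto u\otimes1$ ($\mathfrak n_-$ is abelian). $\varphi_k$ is the linear map $S^k(\mathbb C^{n-1})\to S^k(\mathfrak n_-)\subset M_{\mathfrak p}(\mathrm{triv},k-1)$ with $\varphi_k(e_{\mathbf k})=N^-_{\mathbf k}$ for all $\mathbf k\in\Xi_k$, and the same symbol denotes the map $M_{\mathfrak p}(\mathrm{sym}^k_{n-1},-(1+\frac{k}{n-1}))\to M_{\mathfrak p}(\mathrm{triv},k-1)$, $\varphi_k(u\otimes w)=u\,\varphi_k(w)$ for $u\in\mathcal U(\mathfrak g)$, $w\in S^k(\mathbb C^{n-1})$. *)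

theory Defs
  imports
    "HOL-Library.Poly_Mapping"
    "HOL-Algebra.QuotRing"
    "HOL-Algebra.Generated_Groups"
    "HOL-Algebra.Free_Abelian_Groups"
    "Jordan_Normal_Form.VS_Connect"
begin

section \<open>Representations of Lie algebras of complex matrices\<close>

text \<open>
  A Lie algebra is a set \<open>L\<close> of square complex matrices closed under the vector space operations
  and \<open>A * B - B * A\<close>.  A module for it is a complex vector space in the sense of
  \<^locale>\<open>vectorspace\<close> over \<^const>\<open>class_ring\<close>, extended by an action; the ring fields \<open>mult\<close> and
  \<open>one\<close> of the underlying record are never used.
\<close>

record 'w lie_module = "(complex, 'w) module" +
  act :: "complex mat \<Rightarrow> 'w \<Rightarrow> 'w"

abbreviation C_ring :: "complex ring" where
  "C_ring \<equiv> class_ring"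

definition lie_rep :: "complex mat set \<Rightarrow> 'w lie_module \<Rightarrow> bool" where
  "lie_rep L V \<longleftrightarrow>
     vectorspace C_ring V
   \<and> (\<forall>A\<in>L. act V A \<in> LinearCombinations.module_hom C_ring V V)
   \<and> (\<forall>A\<in>L. \<forall>B\<in>L. \<forall>v\<in>carrier V. act V (A + B) v = act V A v \<oplus>\<^bsub>V\<^esub> act V B v)
   \<and> (\<forall>c. \<forall>A\<in>L. \<forall>v\<in>carrier V. act V (c \<cdot>\<^sub>m A) v = c \<odot>\<^bsub>V\<^esub> act V A v)
   \<and> (\<forall>A\<in>L. \<forall>B\<in>L. \<forall>v\<in>carrier V.
        act V (A * B - B * A) v = act V A (act V B v) \<ominus>\<^bsub>V\<^esub> act V B (act V A v))"

definition fin_dim_irrep :: "complex mat set \<Rightarrow> 'w lie_module \<Rightarrow> bool" where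
  "fin_dim_irrep L V \<longleftrightarrow>
     lie_rep L V \<and> vectorspace.fin_dim C_ring V \<and> carrier V \<noteq> {\<zero>\<^bsub>V\<^esub>}
   \<and> (\<forall>S. subspace C_ring S V \<and> (\<forall>A\<in>L. \<forall>v\<in>S. act V A v \<in> S)
          \<longrightarrow> S = {\<zero>\<^bsub>V\<^esub>} \<or> S = carrier V)"

text \<open>
  Homomorphisms are taken to be undefined outside the carrier, so that two of them are equal
  as functions iff they agree on the carrier.
\<close>

definition lie_hom :: "complex mat set \<Rightarrow> 'v lie_module \<Rightarrow> 'w lie_module \<Rightarrow> ('v \<Rightarrow> 'w) set" where
  "lie_hom L V W =
     {f \<in> LinearCombinations.module_hom C_ring V W \<inter> extensional (carrier V).
        \<forall>A\<in>L. \<forall>v\<in>carrier V. f (act V A v) = act W A (f v)}"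

definition lie_equiv :: "complex mat set \<Rightarrow> 'v lie_module \<Rightarrow> 'w lie_module \<Rightarrow> ('v \<Rightarrow> 'w) set" where
  "lie_equiv L V W = {f \<in> lie_hom L V W. bij_betw f (carrier V) (carrier W)}"

section \<open>The universal enveloping algebra\<close>

text \<open>
  With words as exponents, \<open>'x free_word \<Rightarrow>\<^sub>0 complex\<close> with the convolution product of
  \<^theory>\<open>HOL-Library.Poly_Mapping\<close> is the free associative unital algebra on \<open>'x\<close>.
\<close>

datatype 'x free_word = Word (letters: "'x list")

instantiation free_word :: (type) monoid_add
begin

definition zero_free_word :: "'x free_word" where
  "zero_free_word = Word []"

definition plus_free_word :: "'x free_word \<Rightarrow> 'x free_word \<Rightarrow> 'x free_word" where
  "plus_free_word v w = Word (letters v @ letters w)"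

instance
  by standard (simp_all add: zero_free_word_def plus_free_word_def)

end

type_synonym 'x free_poly = "'x free_word \<Rightarrow>\<^sub>0 complex"

definition free_alg :: "'x set \<Rightarrow> 'x free_poly ring" where
  "free_alg X =
     \<lparr>carrier = {f. \<forall>w\<in>Poly_Mapping.keys f. set (letters w) \<subseteq> X},
      monoid.mult = (*), one = 1, ring.zero = 0, add = (+)\<rparr>"

definition letter :: "'x \<Rightarrow> 'x free_poly" where
  "letter A = Poly_Mapping.single (Word [A]) 1"

definition const_poly :: "complex \<Rightarrow> 'x free_poly" where
  "const_poly c = Poly_Mapping.single 0 c"

definition uea_ideal :: "complex mat set \<Rightarrow> complex mat free_poly set" where
  "uea_ideal L = Idl\<^bsub>free_alg L\<^esub>
     ({letter (A + B) - letter A - letter B | A B. A \<in> L \<and> B \<in> L}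
    \<union> {letter (c \<cdot>\<^sub>m A) - const_poly c * letter A | c A. A \<in> L}
    \<union> {letter A * letter B - letter B * letter A - letter (A * B - B * A) | A B. A \<in> L \<and> B \<in> L})"

definition uea :: "complex mat set \<Rightarrow> complex mat free_poly set ring" where
  "uea L = free_alg L Quot uea_ideal L"

definition uea_class :: "complex mat set \<Rightarrow> complex mat free_poly \<Rightarrow> complex mat free_poly set" where
  "uea_class L f = uea_ideal L +>\<^bsub>free_alg L\<^esub> f"

text \<open>For \<open>K \<subseteq> L\<close>, the canonical homomorphism from \<open>uea K\<close> to \<open>uea L\<close>.\<close>

definition uea_incl ::
  "complex mat set \<Rightarrow> complex mat free_poly set \<Rightarrow> complex mat free_poly set" where
  "uea_incl L b = (\<Union>f\<in>b. uea_class L f)"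

text \<open>
  The action of the enveloping algebra on a module: a word acts as the composite of the actions of
  its letters.  For a representation the value does not depend on the polynomial \<open>f\<close> in the
  residue class \<open>u\<close>, so the image below is a singleton.
\<close>

definition free_act :: "'w lie_module \<Rightarrow> complex mat free_poly \<Rightarrow> 'w \<Rightarrow> 'w" where
  "free_act V f v =
     (\<Oplus>\<^bsub>V\<^esub>w\<in>Poly_Mapping.keys f. Poly_Mapping.lookup f w \<odot>\<^bsub>V\<^esub> foldr (act V) (letters w) v)"

definition uea_act :: "'w lie_module \<Rightarrow> complex mat free_poly set \<Rightarrow> 'w \<Rightarrow> 'w" where
  "uea_act V u v = the_elem ((\<lambda>f. free_act V f v) ` u)"

section \<open>Induced modules\<close>

text \<open>
  For \<open>K \<subseteq> L\<close> and a \<open>K\<close>-module \<open>V\<close>, the tensor product \<open>uea L \<otimes> V\<close> over \<open>uea K\<close>: the free abelian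
  group on the pairs, modulo biadditivity and balancedness over \<open>uea K\<close>.  The latter includes the
  scalars; the complex structure and the action of \<open>L\<close> come from left multiplication in \<open>uea L\<close>.
\<close>

type_synonym 'w pair_sum = "(complex mat free_poly set \<times> 'w) \<Rightarrow>\<^sub>0 int"

definition pair_group ::
  "complex mat set \<Rightarrow> 'w lie_module \<Rightarrow> 'w pair_sum monoid" where
  "pair_group L V = free_Abelian_group (carrier (uea L) \<times> carrier V)"

definition tensor_rels ::
  "complex mat set \<Rightarrow> complex mat set \<Rightarrow> 'w lie_module \<Rightarrow> 'w pair_sum set" where
  "tensor_rels L K V = generate (pair_group L V)
     ({frag_of (u \<oplus>\<^bsub>uea L\<^esub> u', v) - frag_of (u, v) - frag_of (u', v) | u u' v.
         u \<in> carrier (uea L) \<and> u' \<in> carrier (uea L) \<and> v \<in> carrier V}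
    \<union> {frag_of (u, v \<oplus>\<^bsub>V\<^esub> v') - frag_of (u, v) - frag_of (u, v') | u v v'.
         u \<in> carrier (uea L) \<and> v \<in> carrier V \<and> v' \<in> carrier V}
    \<union> {frag_of (u \<otimes>\<^bsub>uea L\<^esub> uea_incl L b, v) - frag_of (u, uea_act V b v) | u b v.
         u \<in> carrier (uea L) \<and> b \<in> carrier (uea K) \<and> v \<in> carrier V})"

definition tensor ::
  "complex mat set \<Rightarrow> complex mat set \<Rightarrow> 'w lie_module
     \<Rightarrow> complex mat free_poly set \<Rightarrow> 'w \<Rightarrow> 'w pair_sum set" where
  "tensor L K V u v = tensor_rels L K V #>\<^bsub>pair_group L V\<^esub> frag_of (u, v)"

text \<open>Left multiplication \<open>u' \<otimes> v \<mapsto> u u' \<otimes> v\<close>, extended additively and passed to cosets.\<close>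

definition left_mult ::
  "complex mat set \<Rightarrow> complex mat set \<Rightarrow> 'w lie_module
     \<Rightarrow> complex mat free_poly set \<Rightarrow> 'w pair_sum set \<Rightarrow> 'w pair_sum set" where
  "left_mult L K V u T =
     (\<Union>x\<in>T. tensor_rels L K V #>\<^bsub>pair_group L V\<^esub>
        frag_extend (\<lambda>(u', v). frag_of (u \<otimes>\<^bsub>uea L\<^esub> u', v)) x)"

definition induced_module ::
  "complex mat set \<Rightarrow> complex mat set \<Rightarrow> 'w lie_module \<Rightarrow> 'w pair_sum set lie_module" where
  "induced_module L K V =
     (let Q = pair_group L V Mod tensor_rels L K V in
      \<lparr>carrier = carrier Q,
       monoid.mult = undefined,
       one = undefined,
       ring.zero = \<one>\<^bsub>Q\<^esub>,
       add = monoid.mult Q,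
       smult = (\<lambda>c. left_mult L K V (uea_class L (const_poly c))),
       act = (\<lambda>A. left_mult L K V (uea_class L (letter A)))\<rparr>)"

text \<open>The linear map \<open>u \<otimes> v \<mapsto> u h(v)\<close> from an induced module to an \<open>L\<close>-module \<open>N\<close>.\<close>

definition induced_map ::
  "complex mat set \<Rightarrow> complex mat set \<Rightarrow> 'v lie_module \<Rightarrow> 'w lie_module
     \<Rightarrow> ('v \<Rightarrow> 'w) \<Rightarrow> 'v pair_sum set \<Rightarrow> 'w" where
  "induced_map L K V N h = (THE f.
       f \<in> LinearCombinations.module_hom C_ring (induced_module L K V) N
     \<and> f \<in> extensional (carrier (induced_module L K V))
     \<and> (\<forall>u\<in>carrier (uea L). \<forall>v\<in>carrier V. f (tensor L K V u v) = uea_act N u (h v)))"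

section \<open>The maximal parabolic subalgebra for the partition 1 + (n - 1)\<close>

definition sl :: "nat \<Rightarrow> complex mat set" where
  "sl n = {A \<in> carrier_mat n n. (\<Sum>i<n. A $$ (i, i)) = 0}"

text \<open>
  Matrix indices start at 0, and so does \<open>j\<close> in \<open>N_plus n j\<close>, \<open>N_minus n j\<close> and in the variables of
  polynomials below: \<open>j < n - 1\<close> stands for the classical index \<open>j + 1\<close>.
\<close>

definition E_unit :: "nat \<Rightarrow> nat \<Rightarrow> nat \<Rightarrow> complex mat" where
  "E_unit n i j = mat n n (\<lambda>p. if p = (i, j) then 1 else 0)"

definition N_plus :: "nat \<Rightarrow> nat \<Rightarrow> complex mat" where
  "N_plus n j = E_unit n 0 (j + 1)"

definition N_minus :: "nat \<Rightarrow> nat \<Rightarrow> complex mat" where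
  "N_minus n j = E_unit n (j + 1) 0"

definition H0 :: "nat \<Rightarrow> complex mat" where
  "H0 n = (1 / of_nat (n - 1)) \<cdot>\<^sub>m mat_diag n (\<lambda>i. if i = 0 then of_nat (n - 1) else - 1)"

definition n_plus :: "nat \<Rightarrow> complex mat set" where
  "n_plus n = LinearCombinations.module.span C_ring (module_mat TYPE(complex) n n) (N_plus n ` {..<n - 1})"

definition m_embed :: "nat \<Rightarrow> complex mat \<Rightarrow> complex mat" where
  "m_embed n X = four_block_mat (0\<^sub>m 1 1) (0\<^sub>m 1 (n - 1)) (0\<^sub>m (n - 1) 1) X"

definition parabolic :: "nat \<Rightarrow> complex mat set" where
  "parabolic n = {m_embed n X + a \<cdot>\<^sub>m H0 n + Y | X a Y. X \<in> sl (n - 1) \<and> Y \<in> n_plus n}"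

text \<open>
  The module for the parabolic subalgebra on the space of \<open>\<sigma>\<close>: the Levi part acts by \<open>\<sigma>\<close>, \<open>H0 n\<close> by
  the scalar \<open>s\<close>, the nilradical by 0.  The decomposition of \<open>Z\<close> is unique.
\<close>

definition parabolic_module :: "nat \<Rightarrow> 'w lie_module \<Rightarrow> complex \<Rightarrow> 'w lie_module" where
  "parabolic_module n \<sigma> s = \<sigma>\<lparr>act := (\<lambda>Z w. THE v. \<exists>X\<in>sl (n - 1). \<exists>a. \<exists>Y\<in>n_plus n.
       Z = m_embed n X + a \<cdot>\<^sub>m H0 n + Y \<and> v = act \<sigma> X w \<oplus>\<^bsub>\<sigma>\<^esub> (a * s) \<odot>\<^bsub>\<sigma>\<^esub> w)\<rparr>"

definition Verma :: "nat \<Rightarrow> 'w lie_module \<Rightarrow> complex \<Rightarrow> 'w pair_sum set lie_module" where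
  "Verma n \<sigma> s = induced_module (sl n) (parabolic n) (parabolic_module n \<sigma> s)"

definition Verma_tensor ::
  "nat \<Rightarrow> 'w lie_module \<Rightarrow> complex \<Rightarrow> complex mat free_poly set \<Rightarrow> 'w \<Rightarrow> 'w pair_sum set" where
  "Verma_tensor n \<sigma> s u w = tensor (sl n) (parabolic n) (parabolic_module n \<sigma> s) u w"

text \<open>
  The isomorphism \<open>u \<otimes> w \<mapsto> u \<otimes> \<iota>(w)\<close> attached to an equivalence \<open>\<iota>\<close> of representations of
  \<open>sl (n - 1)\<close>; it is what identifies the modules built from two representatives of one class.
\<close>

definition Verma_map ::
  "nat \<Rightarrow> complex \<Rightarrow> 'v lie_module \<Rightarrow> 'w lie_module \<Rightarrow> ('v \<Rightarrow> 'w)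
     \<Rightarrow> 'v pair_sum set \<Rightarrow> 'w pair_sum set" where
  "Verma_map n s \<sigma> \<tau> \<iota> =
     induced_map (sl n) (parabolic n) (parabolic_module n \<sigma> s) (Verma n \<tau> s)
       (\<lambda>w. Verma_tensor n \<tau> s \<one>\<^bsub>uea (sl n)\<^esub> (\<iota> w))"

section \<open>The trivial representation, symmetric powers and the maps \<open>\<phi>\<^sub>k\<close>\<close>

definition triv :: "complex lie_module" where
  "triv = \<lparr>carrier = UNIV, monoid.mult = (*), one = 1, ring.zero = 0, add = (+),
           smult = (*), act = (\<lambda>X w. 0)\<rparr>"

definition Xi :: "nat \<Rightarrow> nat \<Rightarrow> (nat \<Rightarrow>\<^sub>0 nat) set" where
  "Xi d k = {m. Poly_Mapping.keys m \<subseteq> {..<d} \<and> (\<Sum>j<d. Poly_Mapping.lookup m j) = k}"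

text \<open>
  \<open>S\<^sup>k(\<complex>\<^sup>d)\<close> is the space of homogeneous polynomials of degree \<open>k\<close> in the basis vectors
  \<open>e\<^sub>0, \<dots>, e\<^sub>d\<^sub>-\<^sub>1\<close>.  A matrix \<open>X\<close> acts by the derivation that extends \<open>e\<^sub>j \<mapsto> \<Sum>i. X $$ (i, j) e\<^sub>i\<close>;
  the truncated subtraction of exponents only matters where the coefficient \<open>lookup m j\<close> is 0.
\<close>

definition sym_power :: "nat \<Rightarrow> nat \<Rightarrow> ((nat \<Rightarrow>\<^sub>0 nat) \<Rightarrow>\<^sub>0 complex) lie_module" where
  "sym_power d k =
     \<lparr>carrier = {p. Poly_Mapping.keys p \<subseteq> Xi d k},
      monoid.mult = (*), one = 1, ring.zero = 0, add = (+),
      smult = (\<lambda>c p. Poly_Mapping.single 0 c * p),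
      act = (\<lambda>X p. \<Sum>m\<in>Poly_Mapping.keys p. \<Sum>i<d. \<Sum>j<d.
               Poly_Mapping.single
                 (m - Poly_Mapping.single j 1 + Poly_Mapping.single i 1)
                 (Poly_Mapping.lookup p m * of_nat (Poly_Mapping.lookup m j) * X $$ (i, j)))\<rparr>"

definition N_minus_monomial :: "nat \<Rightarrow> (nat \<Rightarrow>\<^sub>0 nat) \<Rightarrow> complex mat free_poly set" where
  "N_minus_monomial n m = uea_class (sl n)
     (Poly_Mapping.single (Word (concat (map (\<lambda>j. replicate (Poly_Mapping.lookup m j) (N_minus n j)) [0..<n - 1]))) 1)"

definition phi_sym ::
  "nat \<Rightarrow> nat \<Rightarrow> ((nat \<Rightarrow>\<^sub>0 nat) \<Rightarrow>\<^sub>0 complex) \<Rightarrow> complex pair_sum set" where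
  "phi_sym n k p = (let M = Verma n triv (of_nat k - 1) in
     \<Oplus>\<^bsub>M\<^esub>m\<in>Poly_Mapping.keys p. Poly_Mapping.lookup p m \<odot>\<^bsub>M\<^esub>
       Verma_tensor n triv (of_nat k - 1) (N_minus_monomial n m) 1)"

definition r_param :: "nat \<Rightarrow> nat \<Rightarrow> complex" where
  "r_param n k = - (1 + of_nat k / of_nat (n - 1))"

definition phi ::
  "nat \<Rightarrow> nat \<Rightarrow> ((nat \<Rightarrow>\<^sub>0 nat) \<Rightarrow>\<^sub>0 complex) pair_sum set \<Rightarrow> complex pair_sum set" where
  "phi n k =
     induced_map (sl n) (parabolic n) (parabolic_module n (sym_power (n - 1) k) (r_param n k))
       (Verma n triv (of_nat k - 1)) (phi_sym n k)"

section \<open>The line spanned by a homomorphism\<close>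

definition line_of :: "'v lie_module \<Rightarrow> 'w lie_module \<Rightarrow> ('v \<Rightarrow> 'w) \<Rightarrow> ('v \<Rightarrow> 'w) set" where
  "line_of M N f = {\<lambda>x\<in>carrier M. c \<odot>\<^bsub>N\<^esub> f x | c. True}"

end

theory Submission
  imports Defs
begin

text \<open>
  Write \<open>d = n - 1\<close>.  By the universal property of induced modules (\<open>induced_map\<close>, \<open>hom_eqI\<close>) a
  homomorphism from the module induced from \<open>\<sigma>\<close> and \<open>r\<close> to the one induced from the trivial
  representation and \<open>s\<close> is the same thing as a map from the space of \<open>\<sigma>\<close> to the target that commutes
  with the parabolic subalgebra.  Its values are killed by the nilradical, so the question is about
  such vectors in the target.

  The target is computed in polynomials in variables \<open>x\<^sub>0, \<dots>\<close>, as many as \<open>d\<close>.  The matrix units act by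
  \<open>E(0, 0) = s - Eu\<close>, \<open>E(i + 1, 0) = x\<^sub>i\<close>, \<open>E(0, j + 1) = (s - Eu) \<partial>\<^sub>j\<close> and \<open>E(i + 1, j + 1) = x\<^sub>i \<partial>\<^sub>j\<close>, where \<open>Eu\<close>
  is the Euler operator (\<open>gl_relation\<close>).  The linear map \<open>psi\<close> that sends a monomial to the
  corresponding product of the \<open>N_minus\<close>, applied to the generator, is an intertwiner (\<open>psi_act\<close>):
  the polynomials on which it commutes with every matrix include 1 and are stable under multiplication
  by the variables, since \<open>psi\<close> turns such a multiplication into the action of a matrix and
  \<open>A N = [A, N] + N A\<close>.  The universal property provides a map back, and the composite is the identity
  because it fixes the generator (\<open>psi_pi\<close>); this takes the place of the
  Poincare-Birkhoff-Witt theorem.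

  On polynomials of degree \<open>k\<close> the matrix \<open>H0 n\<close> acts by \<open>s - k - k / d\<close>, an injective function of \<open>k\<close>,
  and a polynomial killed by all \<open>(s - Eu) \<partial>\<^sub>j\<close> has components only in degrees \<open>0\<close> and \<open>s + 1\<close>.  So a
  nonzero homomorphism lives in one degree \<open>k\<close>, with \<open>r = s - k - k / d\<close> and with \<open>k = 0\<close> or
  \<open>s = k - 1\<close> (\<open>singular_vector_degree\<close>).  There the Levi part acts as on the \<open>k\<close>-th symmetric
  power (\<open>pol_parabolic\<close>), and what is left is Schur's lemma for maps from \<open>\<sigma>\<close> to this symmetric power
  (\<open>sym_schur\<close>, \<open>sym_hom_bij\<close>).  It is proved through the highest weight vector \<open>x\<^sub>0\<^sup>k\<close>: up to scalars it is
  the only vector killed by all \<open>x\<^sub>0 \<partial>\<^sub>j\<close> with \<open>j \<ge> 1\<close>, every nonzero submodule contains it, and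
  it generates.  Degree \<open>0\<close> yields the identity, and \<open>s = k - 1\<close> yields the maps \<open>phi n k\<close>.
\<close>

abbreviation "lookup \<equiv> Poly_Mapping.lookup"
abbreviation "keys \<equiv> Poly_Mapping.keys"

section \<open>Enveloping algebras and their actions\<close>

lemma free_poly_expand: "f = (\<Sum>w\<in>keys f. Poly_Mapping.single w (lookup f w))"
  by (rule poly_mapping_eqI)
     (auto simp: lookup_sum lookup_single when_def sum.delta in_keys_iff)

locale matrix_lie_algebra =
  fixes L :: "complex mat set"
  assumes mat_add_closed: "A \<in> L \<Longrightarrow> B \<in> L \<Longrightarrow> A + B \<in> L"
    and mat_smult_closed: "A \<in> L \<Longrightarrow> c \<cdot>\<^sub>m A \<in> L"
    and mat_bracket_closed: "A \<in> L \<Longrightarrow> B \<in> L \<Longrightarrow> A * B - B * A \<in> L"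

lemma free_alg_simps [simp]:
  "\<zero>\<^bsub>free_alg L\<^esub> = 0" "\<one>\<^bsub>free_alg L\<^esub> = 1"
  "f \<oplus>\<^bsub>free_alg L\<^esub> g = f + g" "f \<otimes>\<^bsub>free_alg L\<^esub> g = f * g"
  by (simp_all add: free_alg_def)

lemma free_alg_carrier: "f \<in> carrier (free_alg L) \<longleftrightarrow> (\<forall>w\<in>keys f. set (letters w) \<subseteq> L)"
  by (simp add: free_alg_def)

lemma letters_plus: "letters (v + w) = letters v @ letters w"
  by (simp add: plus_free_word_def)

lemma letters_zero [simp]: "letters 0 = []"
  by (simp add: zero_free_word_def)

lemma free_alg_add: "f \<in> carrier (free_alg L) \<Longrightarrow> g \<in> carrier (free_alg L) \<Longrightarrow> f + g \<in> carrier (free_alg L)"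
  using Poly_Mapping.keys_add[of f g] by (auto simp: free_alg_carrier)

lemma free_alg_mult: "f \<in> carrier (free_alg L) \<Longrightarrow> g \<in> carrier (free_alg L) \<Longrightarrow> f * g \<in> carrier (free_alg L)"
  using Poly_Mapping.keys_mult[of f g] by (fastforce simp: free_alg_carrier letters_plus)

lemma free_alg_uminus: "f \<in> carrier (free_alg L) \<Longrightarrow> - f \<in> carrier (free_alg L)"
  by (auto simp: free_alg_carrier in_keys_iff)

lemma free_alg_minus: "f \<in> carrier (free_alg L) \<Longrightarrow> g \<in> carrier (free_alg L) \<Longrightarrow> f - g \<in> carrier (free_alg L)"
  using free_alg_add[of f L "- g"] free_alg_uminus[of g L] by simp

lemma free_alg_single: "set (letters w) \<subseteq> L \<Longrightarrow> Poly_Mapping.single w c \<in> carrier (free_alg L)"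
  by (simp add: free_alg_carrier)

lemma free_alg_const: "const_poly c \<in> carrier (free_alg L)"
  by (simp add: free_alg_carrier const_poly_def)

lemma free_alg_letter: "A \<in> L \<Longrightarrow> letter A \<in> carrier (free_alg L)"
  by (simp add: free_alg_carrier letter_def)

lemma free_alg_one: "1 \<in> carrier (free_alg L)"
  by (simp add: free_alg_carrier)

lemma free_alg_zero: "0 \<in> carrier (free_alg L)"
  by (simp add: free_alg_carrier)

lemma free_alg_induct [consumes 1, case_names single add]:
  assumes f: "f \<in> carrier (free_alg L)"
    and single: "\<And>w c. set (letters w) \<subseteq> L \<Longrightarrow> P (Poly_Mapping.single w c)"
    and add: "\<And>f g. f \<in> carrier (free_alg L) \<Longrightarrow> g \<in> carrier (free_alg L) \<Longrightarrow> P f \<Longrightarrow> P g \<Longrightarrow> P (f + g)"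
  shows "P f"
proof -
  have "S \<subseteq> keys f \<Longrightarrow>
      P (\<Sum>w\<in>S. Poly_Mapping.single w (lookup f w))
      \<and> (\<Sum>w\<in>S. Poly_Mapping.single w (lookup f w)) \<in> carrier (free_alg L)"
    if "finite S" for S
    using that
  proof (induction S)
    case empty
    then show ?case using single[of 0 0] by (simp add: free_alg_zero)
  next
    case (insert w S)
    have "set (letters w) \<subseteq> L" using insert.prems f by (auto simp: free_alg_carrier)
    then show ?case using insert single add
      by (simp add: free_alg_single free_alg_add)
  qed
  from this[of "keys f"] show ?thesis
    using free_poly_expand[of f] by simp
qed

lemma free_alg_ring: "ring (free_alg L)"
proof (rule ringI)
  show "abelian_group (free_alg L)"
  proof (rule abelian_groupI)
    fix f assume "f \<in> carrier (free_alg L)"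
    then show "\<exists>g\<in>carrier (free_alg L). g \<oplus>\<^bsub>free_alg L\<^esub> f = \<zero>\<^bsub>free_alg L\<^esub>"
      by (intro bexI[of _ "- f"]) (auto simp: free_alg_uminus)
  qed (auto simp: free_alg_add free_alg_zero algebra_simps)
  show "monoid (free_alg L)"
    by (rule monoidI) (auto simp: free_alg_mult free_alg_one algebra_simps)
qed (auto simp: algebra_simps)

lemma free_alg_a_inv: "f \<in> carrier (free_alg L) \<Longrightarrow> \<ominus>\<^bsub>free_alg L\<^esub> f = - f"
  using abelian_group.minus_equality[OF ring.is_abelian_group[OF free_alg_ring], of L "- f" f]
  by (simp add: free_alg_uminus)

context matrix_lie_algebra
begin

lemma uea_gens_carrier:
  "{letter (A + B) - letter A - letter B | A B. A \<in> L \<and> B \<in> L}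
    \<union> {letter (c \<cdot>\<^sub>m A) - const_poly c * letter A | c A. A \<in> L}
    \<union> {letter A * letter B - letter B * letter A - letter (A * B - B * A) | A B. A \<in> L \<and> B \<in> L}
   \<subseteq> carrier (free_alg L)"
  by (auto intro!: free_alg_minus free_alg_mult free_alg_letter free_alg_const
      mat_add_closed mat_smult_closed mat_bracket_closed)

lemma uea_ideal_ideal: "ideal (uea_ideal L) (free_alg L)"
  unfolding uea_ideal_def
  by (rule ring.genideal_ideal[OF free_alg_ring uea_gens_carrier])

lemma uea_ideal_gens:
  "A \<in> L \<Longrightarrow> B \<in> L \<Longrightarrow> letter (A + B) - letter A - letter B \<in> uea_ideal L"
  "A \<in> L \<Longrightarrow> letter (c \<cdot>\<^sub>m A) - const_poly c * letter A \<in> uea_ideal L"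
  "A \<in> L \<Longrightarrow> B \<in> L \<Longrightarrow> letter A * letter B - letter B * letter A - letter (A * B - B * A) \<in> uea_ideal L"
  unfolding uea_ideal_def
  by (rule subsetD[OF ring.genideal_self[OF free_alg_ring uea_gens_carrier]],
      simp only: Un_iff mem_Collect_eq, metis)+

lemma uea_ideal_least:
  assumes "ideal J (free_alg L)"
    and "\<And>A B. A \<in> L \<Longrightarrow> B \<in> L \<Longrightarrow> letter (A + B) - letter A - letter B \<in> J"
    and "\<And>c A. A \<in> L \<Longrightarrow> letter (c \<cdot>\<^sub>m A) - const_poly c * letter A \<in> J"
    and "\<And>A B. A \<in> L \<Longrightarrow> B \<in> L \<Longrightarrow>
      letter A * letter B - letter B * letter A - letter (A * B - B * A) \<in> J"
  shows "uea_ideal L \<subseteq> J"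
  unfolding uea_ideal_def
  by (rule ring.genideal_minimal[OF free_alg_ring assms(1)]) (use assms(2-) in blast)

lemma uea_ideal_zero: "0 \<in> uea_ideal L"
  using additive_subgroup.zero_closed[OF ideal.axioms(1)[OF uea_ideal_ideal]] by simp

lemma uea_ideal_add: "a \<in> uea_ideal L \<Longrightarrow> b \<in> uea_ideal L \<Longrightarrow> a + b \<in> uea_ideal L"
  using additive_subgroup.a_closed[OF ideal.axioms(1)[OF uea_ideal_ideal], of a b] by simp

lemma uea_ideal_uminus: "a \<in> uea_ideal L \<Longrightarrow> - a \<in> uea_ideal L"
  using additive_subgroup.a_inv_closed[OF ideal.axioms(1)[OF uea_ideal_ideal], of a]
    ideal.Icarr[OF uea_ideal_ideal, of a] by (simp add: free_alg_a_inv)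

lemma uea_ideal_mult:
  "a \<in> uea_ideal L \<Longrightarrow> x \<in> carrier (free_alg L) \<Longrightarrow> x * a \<in> uea_ideal L"
  "a \<in> uea_ideal L \<Longrightarrow> x \<in> carrier (free_alg L) \<Longrightarrow> a * x \<in> uea_ideal L"
  using ideal.I_l_closed[OF uea_ideal_ideal, of a x] ideal.I_r_closed[OF uea_ideal_ideal, of a x] by simp_all

lemma uea_ring: "ring (uea L)"
  unfolding uea_def by (rule ideal.quotient_is_ring[OF uea_ideal_ideal])

lemma uea_class_hom: "uea_class L \<in> Ring.ring_hom (free_alg L) (uea L)"
  using ideal.rcos_ring_hom[OF uea_ideal_ideal] by (simp add: uea_def uea_class_def[abs_def])

lemma uea_class_closed: "f \<in> carrier (free_alg L) \<Longrightarrow> uea_class L f \<in> carrier (uea L)"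
  using ring_hom_closed[OF uea_class_hom] .

lemma uea_class_add: "f \<in> carrier (free_alg L) \<Longrightarrow> g \<in> carrier (free_alg L) \<Longrightarrow>
    uea_class L (f + g) = uea_class L f \<oplus>\<^bsub>uea L\<^esub> uea_class L g"
  using ring_hom_add[OF uea_class_hom] by simp

lemma uea_class_mult: "f \<in> carrier (free_alg L) \<Longrightarrow> g \<in> carrier (free_alg L) \<Longrightarrow>
    uea_class L (f * g) = uea_class L f \<otimes>\<^bsub>uea L\<^esub> uea_class L g"
  using ring_hom_mult[OF uea_class_hom] by simp

lemma uea_class_one: "uea_class L 1 = \<one>\<^bsub>uea L\<^esub>"
  using ring_hom_one[OF uea_class_hom] by simp

lemma uea_carrier_cases:
  assumes "u \<in> carrier (uea L)"
  obtains f where "f \<in> carrier (free_alg L)" "u = uea_class L f"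
  using assms unfolding uea_def FactRing_def uea_class_def by (auto simp: A_RCOSETS_def' )

lemma uea_class_eqI:
  assumes "f \<in> carrier (free_alg L)" "g \<in> carrier (free_alg L)" "f - g \<in> uea_ideal L"
  shows "uea_class L f = uea_class L g"
  using ring.quotient_eq_iff_same_a_r_cos[OF free_alg_ring uea_ideal_ideal assms(1,2)] assms
  by (simp add: uea_class_def a_minus_def free_alg_a_inv)

lemma uea_class_memD:
  assumes "f \<in> carrier (free_alg L)" "g \<in> uea_class L f"
  shows "g \<in> carrier (free_alg L)" "g - f \<in> uea_ideal L"
  using assms ideal.Icarr[OF uea_ideal_ideal]
  by (auto simp: uea_class_def a_r_coset_def' free_alg_add)

lemma uea_class_self: "f \<in> carrier (free_alg L) \<Longrightarrow> f \<in> uea_class L f"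
  using additive_subgroup.zero_closed[OF ideal.axioms(1)[OF uea_ideal_ideal]]
  by (auto simp: uea_class_def a_r_coset_def' intro!: bexI[of _ 0])

lemma uea_class_letter:
  "A \<in> L \<Longrightarrow> B \<in> L \<Longrightarrow> uea_class L (letter (A + B)) = uea_class L (letter A) \<oplus>\<^bsub>uea L\<^esub> uea_class L (letter B)"
  "A \<in> L \<Longrightarrow> uea_class L (letter (c \<cdot>\<^sub>m A)) = uea_class L (const_poly c) \<otimes>\<^bsub>uea L\<^esub> uea_class L (letter A)"
  "A \<in> L \<Longrightarrow> B \<in> L \<Longrightarrow> uea_class L (letter A) \<otimes>\<^bsub>uea L\<^esub> uea_class L (letter B) =
     uea_class L (letter (A * B - B * A)) \<oplus>\<^bsub>uea L\<^esub> uea_class L (letter B) \<otimes>\<^bsub>uea L\<^esub> uea_class L (letter A)"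
proof -
  note [simp] = free_alg_letter free_alg_const free_alg_mult free_alg_add mat_add_closed mat_smult_closed mat_bracket_closed
  show "A \<in> L \<Longrightarrow> B \<in> L \<Longrightarrow> uea_class L (letter (A + B)) = uea_class L (letter A) \<oplus>\<^bsub>uea L\<^esub> uea_class L (letter B)"
    by (subst uea_class_add[symmetric]) (use uea_ideal_gens(1)[of A B] in \<open>simp_all add: uea_class_eqI diff_diff_eq\<close>)
  show "A \<in> L \<Longrightarrow> uea_class L (letter (c \<cdot>\<^sub>m A)) = uea_class L (const_poly c) \<otimes>\<^bsub>uea L\<^esub> uea_class L (letter A)"
    by (subst uea_class_mult[symmetric]) (use uea_ideal_gens(2) in \<open>simp_all add: uea_class_eqI\<close>)
  show "A \<in> L \<Longrightarrow> B \<in> L \<Longrightarrow> uea_class L (letter A) \<otimes>\<^bsub>uea L\<^esub> uea_class L (letter B) =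
     uea_class L (letter (A * B - B * A)) \<oplus>\<^bsub>uea L\<^esub> uea_class L (letter B) \<otimes>\<^bsub>uea L\<^esub> uea_class L (letter A)"
    using uea_ideal_gens(3)[of A B]
    by (subst (1 2) uea_class_mult[symmetric], simp, simp, simp, simp,
        subst uea_class_add[symmetric], simp, simp)
       (simp_all add: uea_class_eqI algebra_simps)
qed

end

subsection \<open>Representations\<close>

locale lie_representation =
  fixes L :: "complex mat set" and V :: "'w lie_module" (structure)
  assumes rep: "lie_rep L V"

sublocale lie_representation \<subseteq> vectorspace C_ring V
  using rep unfolding lie_rep_def by (rule conjunct1)

context lie_representation
begin

lemma scalar [simp]: "v \<in> carrier V \<Longrightarrow> c \<odot>\<^bsub>V\<^esub> v \<in> carrier V"
  using smult_closed[of c v] by simp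

lemma scalar_add_left: "v \<in> carrier V \<Longrightarrow> (c + d) \<odot>\<^bsub>V\<^esub> v = c \<odot>\<^bsub>V\<^esub> v \<oplus>\<^bsub>V\<^esub> d \<odot>\<^bsub>V\<^esub> v"
  using smult_l_distr[of c d v] by simp

lemma scalar_add_right: "v \<in> carrier V \<Longrightarrow> w \<in> carrier V \<Longrightarrow> c \<odot>\<^bsub>V\<^esub> (v \<oplus>\<^bsub>V\<^esub> w) = c \<odot>\<^bsub>V\<^esub> v \<oplus>\<^bsub>V\<^esub> c \<odot>\<^bsub>V\<^esub> w"
  using smult_r_distr[of c v w] by simp

lemma scalar_mult: "v \<in> carrier V \<Longrightarrow> c \<odot>\<^bsub>V\<^esub> (d \<odot>\<^bsub>V\<^esub> v) = (c * d) \<odot>\<^bsub>V\<^esub> v"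
  using smult_assoc1[of c d v] by simp

lemma scalar_one [simp]: "v \<in> carrier V \<Longrightarrow> 1 \<odot>\<^bsub>V\<^esub> v = v"
  using smult_one[of v] by simp

lemma scalar_zero [simp]: "v \<in> carrier V \<Longrightarrow> 0 \<odot>\<^bsub>V\<^esub> v = \<zero>\<^bsub>V\<^esub>"
  using smult_l_null[of v] by simp

lemma scalar_of_zero [simp]: "c \<odot>\<^bsub>V\<^esub> \<zero>\<^bsub>V\<^esub> = \<zero>\<^bsub>V\<^esub>"
  using smult_r_null[of c] by simp

lemma scalar_minus_one: "v \<in> carrier V \<Longrightarrow> (- 1) \<odot>\<^bsub>V\<^esub> v = \<ominus>\<^bsub>V\<^esub> v"
  using scalar_add_left[of v "- 1" 1] M.minus_equality[of "(- 1) \<odot>\<^bsub>V\<^esub> v" v] by simp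

lemma act_closed [simp]: "A \<in> L \<Longrightarrow> v \<in> carrier V \<Longrightarrow> act V A v \<in> carrier V"
  using rep by (auto simp: lie_rep_def LinearCombinations.module_hom_def)

lemma act_plus: "A \<in> L \<Longrightarrow> v \<in> carrier V \<Longrightarrow> w \<in> carrier V \<Longrightarrow>
    act V A (v \<oplus>\<^bsub>V\<^esub> w) = act V A v \<oplus>\<^bsub>V\<^esub> act V A w"
  using rep by (auto simp: lie_rep_def LinearCombinations.module_hom_def)

lemma act_scalar: "A \<in> L \<Longrightarrow> v \<in> carrier V \<Longrightarrow> act V A (c \<odot>\<^bsub>V\<^esub> v) = c \<odot>\<^bsub>V\<^esub> act V A v"
  using rep by (auto simp: lie_rep_def LinearCombinations.module_hom_def)

lemma act_add: "A \<in> L \<Longrightarrow> B \<in> L \<Longrightarrow> v \<in> carrier V \<Longrightarrow> act V (A + B) v = act V A v \<oplus>\<^bsub>V\<^esub> act V B v"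
  using rep by (auto simp: lie_rep_def)

lemma act_smult: "A \<in> L \<Longrightarrow> v \<in> carrier V \<Longrightarrow> act V (c \<cdot>\<^sub>m A) v = c \<odot>\<^bsub>V\<^esub> act V A v"
  using rep by (auto simp: lie_rep_def)

lemma act_bracket: "A \<in> L \<Longrightarrow> B \<in> L \<Longrightarrow> v \<in> carrier V \<Longrightarrow>
    act V (A * B - B * A) v = act V A (act V B v) \<ominus>\<^bsub>V\<^esub> act V B (act V A v)"
  using rep by (auto simp: lie_rep_def)

lemma act_zero [simp]: "A \<in> L \<Longrightarrow> act V A \<zero>\<^bsub>V\<^esub> = \<zero>\<^bsub>V\<^esub>"
  using act_scalar[of A "\<zero>\<^bsub>V\<^esub>" 0] by simp

lemma word_act_closed [simp]:
  "set ws \<subseteq> L \<Longrightarrow> v \<in> carrier V \<Longrightarrow> foldr (act V) ws v \<in> carrier V"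
  by (induction ws) auto

lemma word_act_plus: "set ws \<subseteq> L \<Longrightarrow> v \<in> carrier V \<Longrightarrow> w \<in> carrier V \<Longrightarrow>
    foldr (act V) ws (v \<oplus>\<^bsub>V\<^esub> w) = foldr (act V) ws v \<oplus>\<^bsub>V\<^esub> foldr (act V) ws w"
  by (induction ws) (auto simp: act_plus)

lemma word_act_scalar: "set ws \<subseteq> L \<Longrightarrow> v \<in> carrier V \<Longrightarrow>
    foldr (act V) ws (c \<odot>\<^bsub>V\<^esub> v) = c \<odot>\<^bsub>V\<^esub> foldr (act V) ws v"
  by (induction ws) (auto simp: act_scalar)

definition linear_ext :: "('i \<Rightarrow> 'w) \<Rightarrow> ('i \<Rightarrow>\<^sub>0 complex) \<Rightarrow> 'w" where
  "linear_ext b p = (\<Oplus>\<^bsub>V\<^esub>m\<in>keys p. lookup p m \<odot>\<^bsub>V\<^esub> b m)"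

lemma linear_ext_over:
  assumes "finite S" "keys p \<subseteq> S" "\<And>m. m \<in> S \<Longrightarrow> b m \<in> carrier V"
  shows "linear_ext b p = (\<Oplus>\<^bsub>V\<^esub>m\<in>S. lookup p m \<odot>\<^bsub>V\<^esub> b m)"
  unfolding linear_ext_def
  by (rule M.add.finprod_mono_neutral_cong_left) (use assms in \<open>auto simp: in_keys_iff\<close>)

lemma linear_ext_closed: "(\<And>m. m \<in> keys p \<Longrightarrow> b m \<in> carrier V) \<Longrightarrow> linear_ext b p \<in> carrier V"
  unfolding linear_ext_def by (rule M.finsum_closed) auto

lemma linear_ext_add:
  assumes b: "\<And>m. m \<in> keys p \<union> keys q \<Longrightarrow> b m \<in> carrier V"
  shows "linear_ext b (p + q) = linear_ext b p \<oplus>\<^bsub>V\<^esub> linear_ext b q"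
proof -
  let ?S = "keys p \<union> keys q"
  have "linear_ext b (p + q) = (\<Oplus>\<^bsub>V\<^esub>m\<in>?S. lookup (p + q) m \<odot>\<^bsub>V\<^esub> b m)"
    by (rule linear_ext_over) (use b Poly_Mapping.keys_add[of p q] in auto)
  also have "\<dots> = (\<Oplus>\<^bsub>V\<^esub>m\<in>?S. lookup p m \<odot>\<^bsub>V\<^esub> b m \<oplus>\<^bsub>V\<^esub> lookup q m \<odot>\<^bsub>V\<^esub> b m)"
    by (rule M.finsum_cong') (use b in \<open>auto simp: lookup_add scalar_add_left\<close>)
  also have "\<dots> = (\<Oplus>\<^bsub>V\<^esub>m\<in>?S. lookup p m \<odot>\<^bsub>V\<^esub> b m) \<oplus>\<^bsub>V\<^esub> (\<Oplus>\<^bsub>V\<^esub>m\<in>?S. lookup q m \<odot>\<^bsub>V\<^esub> b m)"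
    by (rule M.finsum_addf) (use b in auto)
  also have "\<dots> = linear_ext b p \<oplus>\<^bsub>V\<^esub> linear_ext b q"
    using b by (subst (1 2) linear_ext_over[symmetric]) auto
  finally show ?thesis .
qed

lemma linear_ext_single: "b m \<in> carrier V \<Longrightarrow> linear_ext b (Poly_Mapping.single m c) = c \<odot>\<^bsub>V\<^esub> b m"
  using linear_ext_over[of "{m}" "Poly_Mapping.single m c" b] by simp

lemma free_act_linear_ext: "free_act V f v = linear_ext (\<lambda>w. foldr (act V) (letters w) v) f"
  by (simp add: free_act_def linear_ext_def)

lemma free_act_closed [simp]: "f \<in> carrier (free_alg L) \<Longrightarrow> v \<in> carrier V \<Longrightarrow> free_act V f v \<in> carrier V"
  unfolding free_act_linear_ext by (rule linear_ext_closed) (auto simp: free_alg_carrier)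

lemma free_act_of_zero: "f \<in> carrier (free_alg L) \<Longrightarrow> free_act V f \<zero>\<^bsub>V\<^esub> = \<zero>\<^bsub>V\<^esub>"
  unfolding free_act_def
  by (rule M.add.finprod_one_eqI) (use word_act_scalar[of _ "\<zero>\<^bsub>V\<^esub>" 0] in \<open>auto simp: free_alg_carrier\<close>)

lemma free_act_add:
  assumes "f \<in> carrier (free_alg L)" "g \<in> carrier (free_alg L)" "v \<in> carrier V"
  shows "free_act V (f + g) v = free_act V f v \<oplus>\<^bsub>V\<^esub> free_act V g v"
  unfolding free_act_linear_ext by (rule linear_ext_add) (use assms in \<open>auto simp: free_alg_carrier\<close>)

lemma free_act_single:
  assumes "set (letters w) \<subseteq> L" "v \<in> carrier V"
  shows "free_act V (Poly_Mapping.single w c) v = c \<odot>\<^bsub>V\<^esub> foldr (act V) (letters w) v"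
  unfolding free_act_linear_ext by (rule linear_ext_single) (use assms in simp)

lemma free_act_const: "v \<in> carrier V \<Longrightarrow> free_act V (const_poly c) v = c \<odot>\<^bsub>V\<^esub> v"
  by (simp add: const_poly_def free_act_single)

lemma free_act_letter: "A \<in> L \<Longrightarrow> v \<in> carrier V \<Longrightarrow> free_act V (letter A) v = act V A v"
  by (simp add: letter_def free_act_single)

lemma free_act_one: "v \<in> carrier V \<Longrightarrow> free_act V 1 v = v"
  using free_act_const[of v 1] by (simp add: const_poly_def)

lemma free_act_plus:
  assumes f: "f \<in> carrier (free_alg L)" and "v \<in> carrier V" "w \<in> carrier V"
  shows "free_act V f (v \<oplus>\<^bsub>V\<^esub> w) = free_act V f v \<oplus>\<^bsub>V\<^esub> free_act V f w"
  using f
proof (induction rule: free_alg_induct)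
  case (single w c)
  then show ?case using assms by (simp add: free_act_single word_act_plus scalar_add_right)
next
  case (add f g)
  then show ?case using assms by (simp add: free_act_add M.a_ac)
qed

lemma free_act_mult:
  assumes f: "f \<in> carrier (free_alg L)" and g: "g \<in> carrier (free_alg L)" and v: "v \<in> carrier V"
  shows "free_act V (f * g) v = free_act V f (free_act V g v)"
  using f
proof (induction rule: free_alg_induct)
  case (single w c)
  show ?case using g
  proof (induction rule: free_alg_induct)
    case (single w' c')
    then show ?case using \<open>set (letters w) \<subseteq> L\<close> v
      by (simp add: mult_single free_act_single letters_plus word_act_scalar scalar_mult)
  next
    case (add f' g')
    then show ?case using \<open>set (letters w) \<subseteq> L\<close> v
      by (simp add: distrib_left free_act_add free_act_plus free_alg_mult free_alg_single)
  qed
next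
  case (add f f')
  then show ?case using g v by (simp add: distrib_right free_act_add free_alg_mult)
qed

lemma free_act_uminus:
  assumes "f \<in> carrier (free_alg L)" "v \<in> carrier V"
  shows "free_act V (- f) v = \<ominus>\<^bsub>V\<^esub> free_act V f v"
proof -
  have "free_act V (- f) v \<oplus>\<^bsub>V\<^esub> free_act V f v = free_act V (- f + f) v"
    using assms by (subst free_act_add) (auto simp: free_alg_uminus)
  also have "\<dots> = \<zero>\<^bsub>V\<^esub>" by (simp add: free_act_def)
  finally show ?thesis using assms by (simp add: M.minus_equality free_alg_uminus)
qed

lemma free_act_minus:
  assumes "f \<in> carrier (free_alg L)" "g \<in> carrier (free_alg L)" "v \<in> carrier V"
  shows "free_act V (f - g) v = free_act V f v \<ominus>\<^bsub>V\<^esub> free_act V g v"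
  using free_act_add[of f "- g" v] free_act_uminus[of g v] assms
  by (simp add: free_alg_uminus M.minus_eq)

end

locale lie_algebra_rep = matrix_lie_algebra L + lie_representation L V
  for L and V :: "'w lie_module" (structure)
begin

text \<open>
  The polynomials that act by zero form an ideal, and the axioms of a representation say that the
  generators of the defining ideal belong to it.
\<close>

lemma uea_ideal_annihilates:
  assumes "f \<in> uea_ideal L" "v \<in> carrier V"
  shows "free_act V f v = \<zero>\<^bsub>V\<^esub>"
proof -
  let ?J = "{f \<in> carrier (free_alg L). \<forall>v\<in>carrier V. free_act V f v = \<zero>\<^bsub>V\<^esub>}"
  have "ideal ?J (free_alg L)"
  proof (rule idealI[OF free_alg_ring])
    show "subgroup ?J (add_monoid (free_alg L))"
    proof (rule group.subgroupI[OF abelian_group.a_group[OF ring.is_abelian_group[OF free_alg_ring]]])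
      show "?J \<noteq> {}" using free_alg_zero by (auto simp: free_act_def intro!: exI[of _ 0])
      fix a assume "a \<in> ?J"
      then show "inv\<^bsub>add_monoid (free_alg L)\<^esub> a \<in> ?J"
        using free_alg_a_inv[of a L] by (auto simp: free_act_uminus free_alg_uminus a_inv_def)
    qed (auto simp: free_act_add free_alg_add)
  qed (auto simp: free_act_mult free_alg_mult free_act_of_zero)
  then have "uea_ideal L \<subseteq> ?J"
  proof (rule uea_ideal_least)
    note closed = free_alg_minus free_alg_letter free_alg_mult free_alg_const
      mat_add_closed mat_smult_closed mat_bracket_closed
    fix A B assume A: "A \<in> L" and B: "B \<in> L"
    have "(x \<oplus>\<^bsub>V\<^esub> y) \<ominus>\<^bsub>V\<^esub> x \<ominus>\<^bsub>V\<^esub> y = \<zero>\<^bsub>V\<^esub>" "x \<ominus>\<^bsub>V\<^esub> x = \<zero>\<^bsub>V\<^esub>"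
      if "x \<in> carrier V" "y \<in> carrier V" for x y
    proof -
      have "(x \<oplus>\<^bsub>V\<^esub> y) \<ominus>\<^bsub>V\<^esub> x = y"
        using that M.a_comm[of "x \<oplus>\<^bsub>V\<^esub> y" "\<ominus>\<^bsub>V\<^esub> x"] by (simp add: M.minus_eq M.r_neg1)
      then show "(x \<oplus>\<^bsub>V\<^esub> y) \<ominus>\<^bsub>V\<^esub> x \<ominus>\<^bsub>V\<^esub> y = \<zero>\<^bsub>V\<^esub>" using that by simp
    qed (use that in simp)
    then show "letter (A + B) - letter A - letter B \<in> ?J"
      and "letter A * letter B - letter B * letter A - letter (A * B - B * A) \<in> ?J"
      using A B by (simp_all add: closed free_act_minus free_act_mult free_act_letter act_add act_bracket)
  next
    fix c A assume A: "A \<in> L"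
    then show "letter (c \<cdot>\<^sub>m A) - const_poly c * letter A \<in> ?J"
      by (simp add: free_alg_minus free_alg_letter free_alg_mult free_alg_const mat_smult_closed
          free_act_minus free_act_mult free_act_letter free_act_const act_smult M.minus_eq M.r_neg)
  qed
  then show ?thesis using assms by blast
qed

text \<open>
  All members of a residue class act alike, so the image in the definition of \<open>uea_act\<close> is indeed a
  singleton.
\<close>

lemma uea_act_class:
  assumes f: "f \<in> carrier (free_alg L)" and v: "v \<in> carrier V"
  shows "uea_act V (uea_class L f) v = free_act V f v"
proof -
  have "free_act V g v = free_act V f v" if "g \<in> uea_class L f" for g
  proof -
    have "g - f \<in> uea_ideal L" "g \<in> carrier (free_alg L)" using uea_class_memD f that by auto
    then have "free_act V (f + (g - f)) v = free_act V f v"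
      using f v uea_ideal_annihilates by (subst free_act_add) (auto simp: free_alg_minus)
    then show ?thesis by simp
  qed
  then have "(\<lambda>g. free_act V g v) ` uea_class L f = (\<lambda>g. free_act V f v) ` uea_class L f"
    by (rule image_cong[OF refl])
  also have "\<dots> = {free_act V f v}"
    using uea_class_self[OF f] by (intro image_constant)
  finally have "(\<lambda>g. free_act V g v) ` uea_class L f = {free_act V f v}" .
  then show ?thesis by (simp add: uea_act_def)
qed

end

section \<open>Intertwining maps\<close>

text \<open>
  Unlike \<open>lie_hom\<close>, this puts no condition on the values outside the carrier, so that composites and
  scalar multiples are again of this kind; the restriction to the carrier is made only at the end.
\<close>

definition intertwiner :: "complex mat set \<Rightarrow> 'v lie_module \<Rightarrow> 'w lie_module \<Rightarrow> ('v \<Rightarrow> 'w) \<Rightarrow> bool" where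
  "intertwiner L V W f \<longleftrightarrow> f \<in> LinearCombinations.module_hom C_ring V W
     \<and> (\<forall>A\<in>L. \<forall>v\<in>carrier V. f (act V A v) = act W A (f v))"

lemma lie_hom_iff: "f \<in> lie_hom L V W \<longleftrightarrow> intertwiner L V W f \<and> f \<in> extensional (carrier V)"
  by (auto simp: lie_hom_def intertwiner_def)

lemma intertwinerI:
  assumes "\<And>v. v \<in> carrier V \<Longrightarrow> f v \<in> carrier W"
    and "\<And>v w. v \<in> carrier V \<Longrightarrow> w \<in> carrier V \<Longrightarrow> f (v \<oplus>\<^bsub>V\<^esub> w) = f v \<oplus>\<^bsub>W\<^esub> f w"
    and "\<And>c v. v \<in> carrier V \<Longrightarrow> f (c \<odot>\<^bsub>V\<^esub> v) = c \<odot>\<^bsub>W\<^esub> f v"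
    and "\<And>A v. A \<in> L \<Longrightarrow> v \<in> carrier V \<Longrightarrow> f (act V A v) = act W A (f v)"
  shows "intertwiner L V W f"
  using assms by (auto simp: intertwiner_def LinearCombinations.module_hom_def)

lemma intertwinerD:
  assumes "intertwiner L V W f"
  shows intertwiner_closed: "v \<in> carrier V \<Longrightarrow> f v \<in> carrier W"
    and intertwiner_add: "v \<in> carrier V \<Longrightarrow> w \<in> carrier V \<Longrightarrow> f (v \<oplus>\<^bsub>V\<^esub> w) = f v \<oplus>\<^bsub>W\<^esub> f w"
    and intertwiner_scalar: "v \<in> carrier V \<Longrightarrow> f (c \<odot>\<^bsub>V\<^esub> v) = c \<odot>\<^bsub>W\<^esub> f v"
    and intertwiner_act: "A \<in> L \<Longrightarrow> v \<in> carrier V \<Longrightarrow> f (act V A v) = act W A (f v)"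
  using assms by (auto simp: intertwiner_def LinearCombinations.module_hom_def)

lemma intertwiner_cong:
  assumes "lie_rep L V" "intertwiner L V W f" "\<And>v. v \<in> carrier V \<Longrightarrow> f v = g v"
  shows "intertwiner L V W g"
proof -
  interpret lie_representation L V using assms(1) by unfold_locales
  show ?thesis
    by (rule intertwinerI) (use assms(2) in \<open>simp_all flip: assms(3) add: intertwinerD\<close>)
qed

lemma intertwiner_comp:
  assumes "intertwiner L V W f" "intertwiner L W X g"
  shows "intertwiner L V X (\<lambda>v. g (f v))"
  by (rule intertwinerI) (simp_all add: intertwinerD[OF assms(1)] intertwinerD[OF assms(2)])

lemma lie_rep_mono: "lie_rep L V \<Longrightarrow> K \<subseteq> L \<Longrightarrow> lie_rep K V"
proof -
  assume V: "lie_rep L V" and sub: "K \<subseteq> L"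
  have 1: "\<forall>A\<in>K. P A" if "\<forall>A\<in>L. P A" for P using that sub by blast
  have 2: "\<forall>A\<in>K. \<forall>B\<in>K. P A B" if "\<forall>A\<in>L. \<forall>B\<in>L. P A B" for P using that sub by blast
  note V' = V[unfolded lie_rep_def]
  show ?thesis unfolding lie_rep_def
  proof (intro conjI allI)
    show "vectorspace C_ring V" using V' by (rule conjunct1)
    show "\<forall>A\<in>K. act V A \<in> LinearCombinations.module_hom C_ring V V"
      by (rule 1) (rule V'[THEN conjunct2, THEN conjunct1])
    show "\<forall>A\<in>K. \<forall>B\<in>K. \<forall>v\<in>carrier V. act V (A + B) v = act V A v \<oplus>\<^bsub>V\<^esub> act V B v"
      by (rule 2) (rule V'[THEN conjunct2, THEN conjunct2, THEN conjunct1])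
    show "\<forall>A\<in>K. \<forall>v\<in>carrier V. act V (c \<cdot>\<^sub>m A) v = c \<odot>\<^bsub>V\<^esub> act V A v" for c
      by (rule 1) (rule V'[THEN conjunct2, THEN conjunct2, THEN conjunct2, THEN conjunct1, THEN spec])
    show "\<forall>A\<in>K. \<forall>B\<in>K. \<forall>v\<in>carrier V.
        act V (A * B - B * A) v = act V A (act V B v) \<ominus>\<^bsub>V\<^esub> act V B (act V A v)"
      by (rule 2) (rule V'[THEN conjunct2, THEN conjunct2, THEN conjunct2, THEN conjunct2])
  qed
qed

lemma intertwiner_zero:
  assumes "lie_rep L V" "lie_rep L W" "intertwiner L V W f"
  shows "f \<zero>\<^bsub>V\<^esub> = \<zero>\<^bsub>W\<^esub>"
proof -
  interpret V: lie_representation L V using assms(1) by unfold_locales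
  interpret W: lie_representation L W using assms(2) by unfold_locales
  show ?thesis using intertwiner_scalar[OF assms(3), of "\<zero>\<^bsub>V\<^esub>" 0] by (simp add: intertwinerD[OF assms(3)])
qed

lemma intertwiner_scaled:
  assumes "lie_rep L W" "intertwiner L V W f"
  shows "intertwiner L V W (\<lambda>v. c \<odot>\<^bsub>W\<^esub> f v)"
proof -
  interpret W: lie_representation L W using assms(1) by unfold_locales
  show ?thesis
    by (rule intertwinerI)
       (simp_all add: intertwinerD[OF assms(2)] W.scalar_add_right W.scalar_mult W.act_scalar mult.commute)
qed

lemma intertwiner_inverse:
  assumes V: "lie_rep L V" and f: "intertwiner L V W f" and bij: "bij_betw f (carrier V) (carrier W)"
  shows "intertwiner L W V (inv_into (carrier V) f)"
proof -
  interpret V: lie_representation L V using V by unfold_locales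
  note inj = bij_betw_imp_inj_on[OF bij]
  have *: "\<exists>v\<in>carrier V. w = f v" if "w \<in> carrier W" for w
    using bij that by (auto simp: bij_betw_def)
  show ?thesis
    by (rule intertwinerI; (drule * )+; elim bexE)
       (simp_all add: inj flip: intertwinerD(2-)[OF f])
qed

lemma intertwiner_free_act:
  assumes V: "lie_rep L V" and W: "lie_rep L W" and f: "intertwiner L V W f"
    and p: "p \<in> carrier (free_alg L)" and v: "v \<in> carrier V"
  shows "f (free_act V p v) = free_act W p (f v)"
proof -
  interpret V: lie_representation L V using V by unfold_locales
  interpret W: lie_representation L W using W by unfold_locales
  note D = intertwinerD[OF f]
  have word: "f (foldr (act V) ws v) = foldr (act W) ws (f v)" if "set ws \<subseteq> L" for ws
    using that by (induction ws) (auto simp: D v)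
  from p show ?thesis
  proof (induction rule: free_alg_induct)
    case (single w c)
    then show ?case by (simp add: V.free_act_single W.free_act_single v D word)
  next
    case (add p q)
    then show ?case by (simp add: V.free_act_add W.free_act_add v D)
  qed
qed

lemma (in matrix_lie_algebra) intertwiner_uea_act:
  assumes V: "lie_rep L V" and W: "lie_rep L W" and f: "intertwiner L V W f"
    and u: "u \<in> carrier (uea L)" and v: "v \<in> carrier V"
  shows "f (uea_act V u v) = uea_act W u (f v)"
proof -
  interpret V: lie_algebra_rep L V using V by unfold_locales
  interpret W: lie_algebra_rep L W using W by unfold_locales
  from u obtain p where "p \<in> carrier (free_alg L)" "u = uea_class L p" by (rule uea_carrier_cases)
  then show ?thesis using V.uea_act_class W.uea_act_class intertwiner_free_act[OF V W f] v
    by (simp add: intertwinerD[OF f])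
qed

section \<open>Induced modules\<close>

locale induced_rep = L: matrix_lie_algebra L + V: lie_algebra_rep K V
  for L K and V :: "'w lie_module" +
  assumes sub: "K \<subseteq> L"
begin

abbreviation U where "U \<equiv> uea L"
abbreviation G where "G \<equiv> pair_group L V"
abbreviation R where "R \<equiv> tensor_rels L K V"
abbreviation M where "M \<equiv> induced_module L K V"
abbreviation T where "T \<equiv> tensor L K V"
abbreviation lm where "lm \<equiv> left_mult L K V"

sublocale U: ring U by (rule L.uea_ring)

lemma free_alg_mono: "f \<in> carrier (free_alg K) \<Longrightarrow> f \<in> carrier (free_alg L)"
  using sub by (fastforce simp: free_alg_carrier)

text \<open>
  The ideal of \<open>L\<close> cuts out of the smaller free algebra an ideal that contains the relations of \<open>K\<close>.
  Hence \<open>uea_incl\<close> is well defined on residue classes.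
\<close>

lemma uea_ideal_mono: "uea_ideal K \<subseteq> uea_ideal L"
proof -
  have "ideal (uea_ideal L \<inter> carrier (free_alg K)) (free_alg K)"
  proof (rule idealI[OF free_alg_ring])
    show "subgroup (uea_ideal L \<inter> carrier (free_alg K)) (add_monoid (free_alg K))"
    proof (rule group.subgroupI[OF abelian_group.a_group[OF ring.is_abelian_group[OF free_alg_ring]]])
      show "uea_ideal L \<inter> carrier (free_alg K) \<noteq> {}"
        using L.uea_ideal_zero free_alg_zero by auto
      fix a assume a: "a \<in> uea_ideal L \<inter> carrier (free_alg K)"
      then show "inv\<^bsub>add_monoid (free_alg K)\<^esub> a \<in> uea_ideal L \<inter> carrier (free_alg K)"
        using free_alg_a_inv[of a K] free_alg_uminus[of a K] L.uea_ideal_uminus by (simp add: a_inv_def)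
    qed (auto simp: free_alg_add L.uea_ideal_add)
  qed (auto simp: free_alg_mult free_alg_mono L.uea_ideal_mult)
  then have "uea_ideal K \<subseteq> uea_ideal L \<inter> carrier (free_alg K)"
    by (rule V.uea_ideal_least)
       (use sub in \<open>auto intro!: L.uea_ideal_gens free_alg_minus free_alg_mult free_alg_letter free_alg_const
          V.mat_add_closed V.mat_smult_closed V.mat_bracket_closed\<close>)
  then show ?thesis by blast
qed

lemma uea_incl_class:
  assumes f: "f \<in> carrier (free_alg K)"
  shows "uea_incl L (uea_class K f) = uea_class L f"
proof -
  have *: "uea_class L g = uea_class L f" if "g \<in> uea_class K f" for g
    using V.uea_class_memD[OF f that] uea_ideal_mono f free_alg_mono
    by (intro L.uea_class_eqI) auto
  have "uea_class K f \<noteq> {}" using V.uea_class_self[OF f] by blast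
  then show ?thesis unfolding uea_incl_def using * by (rule SUP_eq_const)
qed

lemma G_carrier: "x \<in> carrier G \<longleftrightarrow> keys x \<subseteq> carrier U \<times> carrier V"
  by (simp add: pair_group_def)

lemma G_simps [simp]: "x \<otimes>\<^bsub>G\<^esub> y = x + y" "\<one>\<^bsub>G\<^esub> = 0"
  by (simp_all add: pair_group_def)

lemma G_comm_group: "comm_group G"
  by (simp add: pair_group_def abelian_free_Abelian_group)

sublocale G: comm_group G by (rule G_comm_group)

lemma G_inv: "x \<in> carrier G \<Longrightarrow> inv\<^bsub>G\<^esub> x = - x"
  unfolding pair_group_def by (subst inv_free_Abelian_group) auto

lemma G_frag: "u \<in> carrier U \<Longrightarrow> v \<in> carrier V \<Longrightarrow> frag_of (u, v) \<in> carrier G"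
  by (simp add: pair_group_def)

lemma G_add: "x \<in> carrier G \<Longrightarrow> y \<in> carrier G \<Longrightarrow> x + y \<in> carrier G"
  using G.m_closed[of x y] by simp

lemma G_diff: "x \<in> carrier G \<Longrightarrow> y \<in> carrier G \<Longrightarrow> x - y \<in> carrier G"
  using keys_diff[of x y] by (auto simp: G_carrier)

lemma G_uminus: "x \<in> carrier G \<Longrightarrow> - x \<in> carrier G"
  by (simp add: G_carrier)

lemma incl_act_cases:
  assumes "b \<in> carrier (uea K)"
  obtains f where "f \<in> carrier (free_alg K)" "uea_incl L b = uea_class L f"
    "\<And>v. v \<in> carrier V \<Longrightarrow> uea_act V b v = free_act V f v"
    "f \<in> carrier (free_alg L)" "b = uea_class K f"
  using assms by (rule V.uea_carrier_cases) (use uea_incl_class V.uea_act_class free_alg_mono in blast)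

abbreviation rels where "rels \<equiv>
     {frag_of (u \<oplus>\<^bsub>U\<^esub> u', v) - frag_of (u, v) - frag_of (u', v) | u u' v.
         u \<in> carrier U \<and> u' \<in> carrier U \<and> v \<in> carrier V}
    \<union> {frag_of (u, v \<oplus>\<^bsub>V\<^esub> v') - frag_of (u, v) - frag_of (u, v') | u v v'.
         u \<in> carrier U \<and> v \<in> carrier V \<and> v' \<in> carrier V}
    \<union> {frag_of (u \<otimes>\<^bsub>U\<^esub> uea_incl L b, v) - frag_of (u, uea_act V b v) | u b v.
         u \<in> carrier U \<and> b \<in> carrier (uea K) \<and> v \<in> carrier V}"

lemma rels_closed:
  assumes "b \<in> carrier (uea K)"
  shows "uea_incl L b \<in> carrier U" "v \<in> carrier V \<Longrightarrow> uea_act V b v \<in> carrier V"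
  using assms by (auto elim!: incl_act_cases intro!: L.uea_class_closed)

lemma rels_carrier: "rels \<subseteq> carrier G"
  by (auto intro!: G_diff G_frag simp: rels_closed)

lemma R_subgroup: "subgroup R G"
  unfolding tensor_rels_def by (rule G.generate_is_subgroup[OF rels_carrier])

lemma R_least: "subgroup H G \<Longrightarrow> rels \<subseteq> H \<Longrightarrow> R \<subseteq> H"
  unfolding tensor_rels_def by (rule G.generate_subgroup_incl)

lemma R_gens: "x \<in> rels \<Longrightarrow> x \<in> R"
  unfolding tensor_rels_def by (rule generate.incl)

lemma R_normal: "R \<lhd> G"
  by (simp add: R_subgroup G.normal_iff_subgroup)

abbreviation cos where "cos x \<equiv> R #>\<^bsub>G\<^esub> x"

lemma M_fields: "carrier M = carrier (G Mod R)" "add M = monoid.mult (G Mod R)" "\<zero>\<^bsub>M\<^esub> = \<one>\<^bsub>G Mod R\<^esub>"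
  by (simp_all add: induced_module_def Let_def)

lemma M_abelian: "abelian_group M"
proof -
  interpret Q: comm_group "G Mod R" by (rule G.abelian_FactGroup[OF R_subgroup])
  show ?thesis
    by (rule abelian_groupI; simp only: M_fields)
       (rule Q.m_closed Q.one_closed Q.m_assoc Q.m_comm Q.l_one Q.l_inv_ex; assumption)+
qed

sublocale M: abelian_group M by (rule M_abelian)

lemma M_carrier: "carrier M = cos ` carrier G"
  by (simp add: induced_module_def Let_def carrier_FactGroup)

lemma cos_closed [simp]: "x \<in> carrier G \<Longrightarrow> cos x \<in> carrier M"
  by (simp add: M_carrier)

lemma cos_add: "x \<in> carrier G \<Longrightarrow> y \<in> carrier G \<Longrightarrow> cos (x + y) = cos x \<oplus>\<^bsub>M\<^esub> cos y"
  using normal.rcos_sum[OF R_normal, of x y] by (simp add: induced_module_def Let_def)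

lemma cos_eqI: "x \<in> carrier G \<Longrightarrow> y \<in> carrier G \<Longrightarrow> x - y \<in> R \<Longrightarrow> cos x = cos y"
  using subgroup.rcos_module_rev[OF R_subgroup G.is_group, of y x]
    G.repr_independence[of x R y] by (simp add: G_inv R_subgroup)

lemma cos_memD: "x \<in> carrier G \<Longrightarrow> y \<in> cos x \<Longrightarrow> y \<in> carrier G \<and> y - x \<in> R"
  using subgroup.mem_carrier[OF R_subgroup] G.m_closed by (fastforce simp: r_coset_def)

lemma cos_self: "x \<in> carrier G \<Longrightarrow> x \<in> cos x"
  using G.rcos_self R_subgroup by blast

lemma cos_zero: "cos 0 = \<zero>\<^bsub>M\<^esub>"
  using cos_add[of 0 0] M.add.r_cancel_one'[of "cos 0" "cos 0"] by (simp add: G_carrier)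

lemma T_def: "T u v = cos (frag_of (u, v))"
  by (simp add: tensor_def)

lemma T_closed [simp]: "u \<in> carrier U \<Longrightarrow> v \<in> carrier V \<Longrightarrow> T u v \<in> carrier M"
  by (simp add: T_def G_frag)

lemma T_add_left:
  assumes "u \<in> carrier U" "u' \<in> carrier U" "v \<in> carrier V"
  shows "T (u \<oplus>\<^bsub>U\<^esub> u') v = T u v \<oplus>\<^bsub>M\<^esub> T u' v"
proof -
  have "frag_of (u \<oplus>\<^bsub>U\<^esub> u', v) - frag_of (u, v) - frag_of (u', v) \<in> R"
    by (rule R_gens) (use assms in blast)
  then show ?thesis unfolding T_def using assms
    by (subst cos_add[symmetric]) (simp_all add: cos_eqI G_frag G_add diff_diff_eq)
qed

lemma T_add_right:
  assumes "u \<in> carrier U" "v \<in> carrier V" "v' \<in> carrier V"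
  shows "T u (v \<oplus>\<^bsub>V\<^esub> v') = T u v \<oplus>\<^bsub>M\<^esub> T u v'"
proof -
  have "frag_of (u, v \<oplus>\<^bsub>V\<^esub> v') - frag_of (u, v) - frag_of (u, v') \<in> R"
    by (rule R_gens) (use assms in blast)
  then show ?thesis unfolding T_def using assms
    by (subst cos_add[symmetric]) (simp_all add: cos_eqI G_frag G_add diff_diff_eq)
qed

lemma T_balanced:
  assumes "u \<in> carrier U" "b \<in> carrier (uea K)" "v \<in> carrier V"
  shows "T (u \<otimes>\<^bsub>U\<^esub> uea_incl L b) v = T u (uea_act V b v)"
  unfolding T_def
  by (rule cos_eqI) (use assms in \<open>auto intro!: G_frag R_gens simp: rels_closed\<close>)

lemma T_letter:
  assumes "u \<in> carrier U" "A \<in> K" "v \<in> carrier V"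
  shows "T (u \<otimes>\<^bsub>U\<^esub> uea_class L (letter A)) v = T u (act V A v)"
  using T_balanced[of u "uea_class K (letter A)" v] assms
  by (simp add: uea_incl_class V.uea_act_class V.free_act_letter free_alg_letter V.uea_class_closed)

lemma T_const:
  assumes "u \<in> carrier U" "v \<in> carrier V"
  shows "T (u \<otimes>\<^bsub>U\<^esub> uea_class L (const_poly c)) v = T u (c \<odot>\<^bsub>V\<^esub> v)"
  using T_balanced[of u "uea_class K (const_poly c)" v] assms
  by (simp add: uea_incl_class V.uea_act_class V.free_act_const free_alg_const V.uea_class_closed)

lemma T_zero_left: "v \<in> carrier V \<Longrightarrow> T \<zero>\<^bsub>U\<^esub> v = \<zero>\<^bsub>M\<^esub>"
  using T_add_left[of "\<zero>\<^bsub>U\<^esub>" "\<zero>\<^bsub>U\<^esub>" v] M.add.r_cancel_one'[of "T \<zero>\<^bsub>U\<^esub> v" "T \<zero>\<^bsub>U\<^esub> v"] by simp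

lemma cos_uminus_T:
  assumes "u \<in> carrier U" "v \<in> carrier V"
  shows "cos (- frag_of (u, v)) = T (\<ominus>\<^bsub>U\<^esub> u) v"
proof -
  have "T (\<ominus>\<^bsub>U\<^esub> u) v \<oplus>\<^bsub>M\<^esub> T u v = \<zero>\<^bsub>M\<^esub>"
    using assms by (simp add: T_add_left[symmetric] U.l_neg T_zero_left)
  moreover have "cos (- frag_of (u, v)) \<oplus>\<^bsub>M\<^esub> T u v = \<zero>\<^bsub>M\<^esub>"
    unfolding T_def using assms by (subst cos_add[symmetric]) (auto simp: G_frag G_uminus cos_zero)
  ultimately show ?thesis
    using assms M.add.right_cancel[of "T u v" "cos (- frag_of (u, v))" "T (\<ominus>\<^bsub>U\<^esub> u) v"]
    by (simp add: G_frag G_uminus)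
qed

text \<open>
  Differences are not among the cases: the negative of a pure tensor is a pure tensor.
\<close>

lemma M_induct [consumes 1, case_names tensor add]:
  assumes x: "x \<in> carrier M"
    and tensor: "\<And>u v. u \<in> carrier U \<Longrightarrow> v \<in> carrier V \<Longrightarrow> P (T u v)"
    and add: "\<And>x y. x \<in> carrier M \<Longrightarrow> y \<in> carrier M \<Longrightarrow> P x \<Longrightarrow> P y \<Longrightarrow> P (x \<oplus>\<^bsub>M\<^esub> y)"
  shows "P x"
proof -
  obtain a where a: "a \<in> carrier G" "x = cos a" using x by (auto simp: M_carrier)
  have "keys a \<subseteq> carrier U \<times> carrier V" using a by (simp add: G_carrier)
  \<comment> \<open>the statement about \<open>- a\<close> is what makes the step for differences go through\<close>
  then have "P (cos a) \<and> P (cos (- a))"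
  proof (induction a rule: free_Abelian_group_induct[consumes 1, case_names zero diff one])
    case zero
    have "P (cos 0)" using tensor[of "\<zero>\<^bsub>U\<^esub>" "\<zero>\<^bsub>V\<^esub>"] by (simp add: T_zero_left cos_zero)
    then show ?case by simp
  next
    case (diff a b)
    then have ab: "a \<in> carrier G" "b \<in> carrier G" by (simp_all add: G_carrier)
    have "P (cos (a + - b))" "P (cos (b + - a))"
      using diff ab by (simp_all only: cos_add G_uminus) (simp_all add: add G_uminus)
    then show ?case by simp
  next
    case (one p)
    then show ?case using tensor by (auto simp: cos_uminus_T) (auto simp flip: T_def)
  qed
  with a show ?thesis by simp
qed

lemma M_eqI:
  assumes H: "abelian_group H"
    and f: "\<And>x. x \<in> carrier M \<Longrightarrow> f x \<in> carrier H"
      "\<And>x y. x \<in> carrier M \<Longrightarrow> y \<in> carrier M \<Longrightarrow> f (x \<oplus>\<^bsub>M\<^esub> y) = f x \<oplus>\<^bsub>H\<^esub> f y"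
    and g: "\<And>x y. x \<in> carrier M \<Longrightarrow> y \<in> carrier M \<Longrightarrow> g (x \<oplus>\<^bsub>M\<^esub> y) = g x \<oplus>\<^bsub>H\<^esub> g y"
    and T: "\<And>u v. u \<in> carrier U \<Longrightarrow> v \<in> carrier V \<Longrightarrow> f (T u v) = g (T u v)"
    and x: "x \<in> carrier M"
  shows "f x = g x"
  using x by (induction rule: M_induct) (simp_all add: T f g)

subsection \<open>Left multiplication\<close>

text \<open>
  Left multiplication on formal sums of pairs, before passing to cosets.
\<close>

abbreviation lmf where "lmf u \<equiv> frag_extend (\<lambda>(u', v). frag_of (u \<otimes>\<^bsub>U\<^esub> u', v))"

lemma lmf_closed:
  assumes "u \<in> carrier U" "x \<in> carrier G"
  shows "lmf u x \<in> carrier G"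
proof -
  have "(\<Union>p\<in>keys x. keys (case p of (u', v) \<Rightarrow> frag_of (u \<otimes>\<^bsub>U\<^esub> u', v)))
      \<subseteq> carrier U \<times> carrier V"
    using assms by (auto simp: G_carrier subset_iff)
  with keys_frag_extend[of "\<lambda>(u', v). frag_of (u \<otimes>\<^bsub>U\<^esub> u', v)" x] show ?thesis
    unfolding G_carrier by (rule order_trans)
qed

text \<open>
  The formal sums that are mapped into the relations form a subgroup, so it is enough to look at the
  generating relations, each of which goes to a relation of the same kind.
\<close>

lemma lmf_R:
  assumes u: "u \<in> carrier U" and x: "x \<in> R"
  shows "lmf u x \<in> R"
proof -
  let ?H = "{x \<in> carrier G. lmf u x \<in> R}"
  have "subgroup ?H G"
  proof (rule G.subgroupI)
    show "?H \<noteq> {}" using subgroup.one_closed[OF R_subgroup] by (auto simp: G_carrier intro!: exI[of _ 0])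
    show "inv\<^bsub>G\<^esub> a \<in> ?H" if "a \<in> ?H" for a
      using that subgroup.m_inv_closed[OF R_subgroup, of "lmf u a"] u
      by (simp add: G_inv frag_extend_minus lmf_closed G_uminus)
    show "a \<otimes>\<^bsub>G\<^esub> b \<in> ?H" if "a \<in> ?H" "b \<in> ?H" for a b
      using that subgroup.m_closed[OF R_subgroup] G.m_closed by (simp add: frag_extend_add)
  qed simp
  moreover have "rels \<subseteq> ?H"
  proof
    fix x assume x: "x \<in> rels"
    then have "lmf u x \<in> rels"
    proof (elim UnE CollectE exE conjE)
      fix u1 u2 v
      assume "x = frag_of (u1 \<oplus>\<^bsub>U\<^esub> u2, v) - frag_of (u1, v) - frag_of (u2, v)"
        "u1 \<in> carrier U" "u2 \<in> carrier U" "v \<in> carrier V"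
      then have "lmf u x = frag_of (u \<otimes>\<^bsub>U\<^esub> u1 \<oplus>\<^bsub>U\<^esub> u \<otimes>\<^bsub>U\<^esub> u2, v) - frag_of (u \<otimes>\<^bsub>U\<^esub> u1, v) - frag_of (u \<otimes>\<^bsub>U\<^esub> u2, v)"
        using u by (simp add: frag_extend_diff U.r_distr)
      then show ?thesis using u \<open>u1 \<in> carrier U\<close> \<open>u2 \<in> carrier U\<close> \<open>v \<in> carrier V\<close>
        by (intro UnI1 CollectI exI[of _ "u \<otimes>\<^bsub>U\<^esub> u1"] exI[of _ "u \<otimes>\<^bsub>U\<^esub> u2"] exI[of _ v]) simp
    next
      fix u1 v v'
      assume "x = frag_of (u1, v \<oplus>\<^bsub>V\<^esub> v') - frag_of (u1, v) - frag_of (u1, v')"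
        "u1 \<in> carrier U" "v \<in> carrier V" "v' \<in> carrier V"
      then have "lmf u x = frag_of (u \<otimes>\<^bsub>U\<^esub> u1, v \<oplus>\<^bsub>V\<^esub> v') - frag_of (u \<otimes>\<^bsub>U\<^esub> u1, v) - frag_of (u \<otimes>\<^bsub>U\<^esub> u1, v')"
        by (simp add: frag_extend_diff)
      then show ?thesis using u \<open>u1 \<in> carrier U\<close> \<open>v \<in> carrier V\<close> \<open>v' \<in> carrier V\<close>
        by (intro UnI1 UnI2 CollectI exI[of _ "u \<otimes>\<^bsub>U\<^esub> u1"] exI[of _ v] exI[of _ v']) simp
    next
      fix u1 b v
      assume "x = frag_of (u1 \<otimes>\<^bsub>U\<^esub> uea_incl L b, v) - frag_of (u1, uea_act V b v)"
        "u1 \<in> carrier U" "b \<in> carrier (uea K)" "v \<in> carrier V"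
      then have "lmf u x = frag_of ((u \<otimes>\<^bsub>U\<^esub> u1) \<otimes>\<^bsub>U\<^esub> uea_incl L b, v) - frag_of (u \<otimes>\<^bsub>U\<^esub> u1, uea_act V b v)"
        using u by (simp add: frag_extend_diff U.m_assoc rels_closed)
      then show ?thesis using u \<open>u1 \<in> carrier U\<close> \<open>v \<in> carrier V\<close> \<open>b \<in> carrier (uea K)\<close>
        by (intro UnI2 CollectI exI[of _ "u \<otimes>\<^bsub>U\<^esub> u1"] exI[of _ b] exI[of _ v]) simp
    qed
    then have "lmf u x \<in> R" by (rule R_gens)
    with subsetD[OF rels_carrier x] show "x \<in> ?H" by (intro CollectI conjI)
  qed
  ultimately have "R \<subseteq> ?H" by (rule R_least)
  from subsetD[OF this x] show ?thesis by (elim CollectE conjE)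
qed

lemma lm_cos:
  assumes u: "u \<in> carrier U" and x: "x \<in> carrier G"
  shows "lm u (cos x) = cos (lmf u x)"
proof -
  have *: "cos (lmf u y) = cos (lmf u x)" if "y \<in> cos x" for y
    using cos_memD[OF x that] lmf_R[OF u, of "y - x"] u x
    by (intro cos_eqI) (auto simp: lmf_closed frag_extend_diff)
  have "cos x \<noteq> {}" using cos_self[OF x] by blast
  then show ?thesis unfolding left_mult_def using * by (rule SUP_eq_const)
qed

lemma lm_closed [simp]: "u \<in> carrier U \<Longrightarrow> x \<in> carrier M \<Longrightarrow> lm u x \<in> carrier M"
  by (auto simp: M_carrier lm_cos intro!: imageI lmf_closed)

lemma lm_T: "u \<in> carrier U \<Longrightarrow> u' \<in> carrier U \<Longrightarrow> v \<in> carrier V \<Longrightarrow> lm u (T u' v) = T (u \<otimes>\<^bsub>U\<^esub> u') v"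
  by (simp add: T_def lm_cos G_frag)

lemma lm_add:
  assumes "u \<in> carrier U" "x \<in> carrier M" "y \<in> carrier M"
  shows "lm u (x \<oplus>\<^bsub>M\<^esub> y) = lm u x \<oplus>\<^bsub>M\<^esub> lm u y"
proof -
  obtain a b where ab: "a \<in> carrier G" "x = cos a" "b \<in> carrier G" "y = cos b"
    using assms by (auto simp: M_carrier)
  then have "a + b \<in> carrier G" using G.m_closed by simp
  with ab assms(1) show ?thesis
    by (simp add: lm_cos frag_extend_add lmf_closed flip: cos_add)
qed

lemma lm_add_left:
  assumes "u \<in> carrier U" "u' \<in> carrier U" "x \<in> carrier M"
  shows "lm (u \<oplus>\<^bsub>U\<^esub> u') x = lm u x \<oplus>\<^bsub>M\<^esub> lm u' x"
  by (rule M_eqI[OF M_abelian _ _ _ _ assms(3)])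
     (use assms in \<open>simp_all add: lm_add lm_T U.l_distr T_add_left M.a_ac\<close>)

lemma lm_mult:
  assumes "u \<in> carrier U" "u' \<in> carrier U" "x \<in> carrier M"
  shows "lm (u \<otimes>\<^bsub>U\<^esub> u') x = lm u (lm u' x)"
  by (rule M_eqI[OF M_abelian _ _ _ _ assms(3)])
     (use assms in \<open>simp_all add: lm_add lm_T U.m_assoc\<close>)

lemma lm_one:
  assumes "x \<in> carrier M"
  shows "lm \<one>\<^bsub>U\<^esub> x = x"
  by (rule M_eqI[OF M_abelian _ _ _ _ assms])
     (simp_all add: lm_add lm_T)

lemma M_smult: "c \<odot>\<^bsub>M\<^esub> x = lm (uea_class L (const_poly c)) x"
  by (simp add: induced_module_def Let_def)

lemma M_act: "act M A x = lm (uea_class L (letter A)) x"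
  by (simp add: induced_module_def Let_def)

lemma const_class_closed [simp]: "uea_class L (const_poly c) \<in> carrier U"
  by (simp add: L.uea_class_closed free_alg_const)

lemma letter_class_closed [simp]: "A \<in> L \<Longrightarrow> uea_class L (letter A) \<in> carrier U"
  by (simp add: L.uea_class_closed free_alg_letter)

lemma const_class_commute:
  assumes "u \<in> carrier U"
  shows "uea_class L (const_poly c) \<otimes>\<^bsub>U\<^esub> u = u \<otimes>\<^bsub>U\<^esub> uea_class L (const_poly c)"
proof -
  obtain f where f: "f \<in> carrier (free_alg L)" "u = uea_class L f" using assms by (rule L.uea_carrier_cases)
  have "const_poly c * f = f * const_poly c"
    using f(1) by (induction rule: free_alg_induct)
      (auto simp: const_poly_def mult_single mult.commute distrib_left distrib_right)
  then show ?thesis using f by (simp add: L.uea_class_mult[symmetric] free_alg_const)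
qed

lemma M_module: "module C_ring M"
proof (rule moduleI)
  show "cring (C_ring :: complex ring)" ..
  fix c d :: complex and x y
  assume x: "x \<in> carrier M"
  show "c \<odot>\<^bsub>M\<^esub> x \<in> carrier M" using x by (simp add: M_smult)
  have "(const_poly (c + d) :: complex mat free_poly) = const_poly c + const_poly d" by (simp add: const_poly_def single_add)
  then show "(c \<oplus>\<^bsub>C_ring\<^esub> d) \<odot>\<^bsub>M\<^esub> x = c \<odot>\<^bsub>M\<^esub> x \<oplus>\<^bsub>M\<^esub> d \<odot>\<^bsub>M\<^esub> x"
    using x by (simp add: M_smult L.uea_class_add free_alg_const lm_add_left)
  have "(const_poly (c * d) :: complex mat free_poly) = const_poly c * const_poly d" by (simp add: const_poly_def mult_single)
  then show "(c \<otimes>\<^bsub>C_ring\<^esub> d) \<odot>\<^bsub>M\<^esub> x = c \<odot>\<^bsub>M\<^esub> (d \<odot>\<^bsub>M\<^esub> x)"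
    using x by (simp add: M_smult L.uea_class_mult free_alg_const lm_mult)
  show "\<one>\<^bsub>C_ring\<^esub> \<odot>\<^bsub>M\<^esub> x = x"
    using x L.uea_class_one lm_one by (simp add: M_smult const_poly_def)
  assume y: "y \<in> carrier M"
  show "c \<odot>\<^bsub>M\<^esub> (x \<oplus>\<^bsub>M\<^esub> y) = c \<odot>\<^bsub>M\<^esub> x \<oplus>\<^bsub>M\<^esub> c \<odot>\<^bsub>M\<^esub> y"
    using x y by (simp add: M_smult lm_add)
qed (rule M_abelian)

text \<open>
  The relations of the enveloping algebra, read through left multiplication, are the axioms of a
  representation.  The constants are central, which makes the action of a matrix linear.
\<close>

lemma M_lie_rep: "lie_rep L M"
  unfolding lie_rep_def
proof (intro conjI ballI allI)
  show "vectorspace C_ring M"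
    by (intro vectorspace.intro M_module class_field)
next
  fix A assume A: "A \<in> L"
  show "act M A \<in> LinearCombinations.module_hom C_ring M M"
    using A by (auto simp: LinearCombinations.module_hom_def M_act lm_add M_smult const_class_commute lm_mult[symmetric])
  fix v assume v: "v \<in> carrier M"
  show "act M (c \<cdot>\<^sub>m A) v = c \<odot>\<^bsub>M\<^esub> act M A v" for c
    using A v by (simp add: M_act M_smult L.uea_class_letter lm_mult)
  fix B assume B: "B \<in> L"
  show "act M (A + B) v = act M A v \<oplus>\<^bsub>M\<^esub> act M B v"
    using A B v by (simp add: M_act L.uea_class_letter lm_add_left)
  have "act M A (act M B v) = act M (A * B - B * A) v \<oplus>\<^bsub>M\<^esub> act M B (act M A v)"
    using A B v L.mat_bracket_closed[OF A B]
    by (simp add: M_act lm_mult[symmetric] L.uea_class_letter(3)[OF A B] lm_add_left)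
  moreover have "act M X w \<in> carrier M" if "X \<in> L" "w \<in> carrier M" for X w
    using that by (simp add: M_act)
  ultimately show "act M (A * B - B * A) v = act M A (act M B v) \<ominus>\<^bsub>M\<^esub> act M B (act M A v)"
    using A B v L.mat_bracket_closed[OF A B] by (simp only: M.minus_eq M.a_assoc M.r_neg M.r_zero M.a_inv_closed)
qed

sublocale M: lie_algebra_rep L M
  by unfold_locales (rule M_lie_rep)

lemma lm_uea_act:
  assumes u: "u \<in> carrier U" and x: "x \<in> carrier M"
  shows "uea_act M u x = lm u x"
proof -
  obtain f where f: "f \<in> carrier (free_alg L)" "u = uea_class L f" using u by (rule L.uea_carrier_cases)
  have word: "set ws \<subseteq> L \<Longrightarrow> foldr (act M) ws x = lm (uea_class L (Poly_Mapping.single (Word ws) 1)) x" for ws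
  proof (induction ws)
    case Nil
    then show ?case using L.uea_class_one lm_one[OF x] by (simp flip: zero_free_word_def)
  next
    case (Cons A ws)
    have "Poly_Mapping.single (Word (A # ws)) 1 = letter A * Poly_Mapping.single (Word ws) 1"
      by (simp add: letter_def mult_single plus_free_word_def)
    with Cons show ?case
      by (simp add: M_act L.uea_class_mult free_alg_letter free_alg_single lm_mult x L.uea_class_closed)
  qed
  from f(1) have "free_act M f x = lm (uea_class L f) x"
  proof (induction rule: free_alg_induct)
    case (single w c)
    obtain ws where w: "w = Word ws" by (cases w)
    have "Poly_Mapping.single (Word ws) c = const_poly c * Poly_Mapping.single (Word ws) 1"
      by (simp add: const_poly_def mult_single)
    then have "lm (uea_class L (Poly_Mapping.single (Word ws) c)) x =
        lm (uea_class L (const_poly c)) (lm (uea_class L (Poly_Mapping.single (Word ws) 1)) x)"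
      using single w by (simp add: L.uea_class_mult free_alg_const free_alg_single lm_mult x L.uea_class_closed)
    with single w show ?case by (simp add: M.free_act_single x word M_smult)
  next
    case (add f g)
    then show ?case by (simp add: M.free_act_add x L.uea_class_add lm_add_left L.uea_class_closed)
  qed
  then show ?thesis using f x M.uea_act_class by simp
qed

lemma T_uea_act: "u \<in> carrier U \<Longrightarrow> v \<in> carrier V \<Longrightarrow> T u v = uea_act M u (T \<one>\<^bsub>U\<^esub> v)"
  by (simp add: lm_uea_act lm_T)

lemma T_one_intertwines: "intertwiner K V M (T \<one>\<^bsub>U\<^esub>)"
proof (rule intertwinerI)
  fix c v assume v: "v \<in> carrier V"
  show "T \<one>\<^bsub>U\<^esub> (c \<odot>\<^bsub>V\<^esub> v) = c \<odot>\<^bsub>M\<^esub> T \<one>\<^bsub>U\<^esub> v"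
    using v T_const[of "\<one>\<^bsub>U\<^esub>" v c] by (simp add: M_smult lm_T)
next
  fix A v assume A: "A \<in> K" and v: "v \<in> carrier V"
  show "T \<one>\<^bsub>U\<^esub> (act V A v) = act M A (T \<one>\<^bsub>U\<^esub> v)"
    using v T_letter[of "\<one>\<^bsub>U\<^esub>" A v] A sub by (auto simp: M_act lm_T)
qed (simp_all add: T_add_right)

subsection \<open>The universal property\<close>

lemma hom_on_tensor:
  assumes N: "lie_rep L N" and f: "intertwiner L M N f" and u: "u \<in> carrier U" and v: "v \<in> carrier V"
  shows "f (T u v) = uea_act N u (f (T \<one>\<^bsub>U\<^esub> v))"
  using L.intertwiner_uea_act[OF M_lie_rep N f u, of "T \<one>\<^bsub>U\<^esub> v"] u v by (simp flip: T_uea_act)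

text \<open>
  The vectors \<open>1 \<otimes> v\<close> generate the induced module.
\<close>

lemma hom_eqI:
  assumes N: "lie_rep L N" and f: "intertwiner L M N f" and g: "intertwiner L M N g"
    and eq: "\<And>v. v \<in> carrier V \<Longrightarrow> f (T \<one>\<^bsub>U\<^esub> v) = g (T \<one>\<^bsub>U\<^esub> v)" and x: "x \<in> carrier M"
  shows "f x = g x"
proof -
  interpret N: lie_representation L N using N by unfold_locales
  have "f (T u v) = g (T u v)" if "u \<in> carrier U" "v \<in> carrier V" for u v
    using hom_on_tensor[OF N f that] hom_on_tensor[OF N g that] eq[OF that(2)] by simp
  from M_eqI[where f = f and g = g, OF N.M.abelian_group_axioms _ _ _ this x] show ?thesis
    using intertwiner_closed[OF f] intertwiner_add[OF f] intertwiner_add[OF g] by blast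
qed

text \<open>
  The assignment \<open>(u, v) \<mapsto> u h(v)\<close> extends additively to formal sums.  It kills the relations of
  balancedness because \<open>h\<close> commutes with \<open>K\<close>, hence with its enveloping algebra, and therefore
  descends to cosets.
\<close>

lemma universal_map:
  assumes N: "lie_rep L N" and h: "intertwiner K V N h"
  shows "\<exists>f. intertwiner L M N f \<and> f \<in> extensional (carrier M)
    \<and> (\<forall>u\<in>carrier U. \<forall>v\<in>carrier V. f (T u v) = uea_act N u (h v))"
proof -
  interpret N: lie_algebra_rep L N using N by unfold_locales
  note hD = intertwinerD[OF h]
  interpret NK: lie_representation K N
    using lie_rep_mono[OF N sub] by unfold_locales
  let ?B = "add_monoid N"
  have N_act: "uea_act N u n \<in> carrier N" if "u \<in> carrier U" "n \<in> carrier N" for u n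
    using that by (elim L.uea_carrier_cases) (simp add: N.uea_act_class)
  have N_plus: "uea_act N u (n \<oplus>\<^bsub>N\<^esub> n') = uea_act N u n \<oplus>\<^bsub>N\<^esub> uea_act N u n'"
    if "u \<in> carrier U" "n \<in> carrier N" "n' \<in> carrier N" for u n n'
    using that by (elim L.uea_carrier_cases) (simp add: N.uea_act_class N.free_act_plus)
  have N_add: "uea_act N (u \<oplus>\<^bsub>U\<^esub> u') n = uea_act N u n \<oplus>\<^bsub>N\<^esub> uea_act N u' n"
    if "u \<in> carrier U" "u' \<in> carrier U" "n \<in> carrier N" for u u' n
    using that by (elim L.uea_carrier_cases)
      (simp add: N.uea_act_class N.free_act_add free_alg_add flip: L.uea_class_add)
  have N_mult: "uea_act N (u \<otimes>\<^bsub>U\<^esub> u') n = uea_act N u (uea_act N u' n)"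
    if "u \<in> carrier U" "u' \<in> carrier U" "n \<in> carrier N" for u u' n
    using that by (elim L.uea_carrier_cases)
      (simp add: N.uea_act_class N.free_act_mult free_alg_mult flip: L.uea_class_mult)
  have N_incl: "uea_act N (uea_incl L b) (h v) = h (uea_act V b v)"
    if b: "b \<in> carrier (uea K)" and v: "v \<in> carrier V" for b v
  proof -
    obtain p where p: "p \<in> carrier (free_alg K)" "uea_incl L b = uea_class L p"
      "uea_act V b v = free_act V p v" "p \<in> carrier (free_alg L)"
      using b v by (metis incl_act_cases)
    then show ?thesis
      using intertwiner_free_act[OF V.rep NK.rep h p(1) v] v by (simp add: N.uea_act_class hD)
  qed
  interpret B: comm_group ?B by (rule N.M.a_comm_group)
  let ?f = "\<lambda>(u, v). uea_act N u (h v)"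
  obtain F where F: "F \<in> hom (free_Abelian_group (carrier U \<times> carrier V)) ?B"
    "\<And>p. p \<in> carrier U \<times> carrier V \<Longrightarrow> F (frag_of p) = ?f p"
    by (rule comm_group.free_Abelian_group_universal[OF N.M.a_comm_group, of ?f "carrier U \<times> carrier V"])
       (auto simp: N_act hD)
  have FG: "F \<in> hom G ?B" using F(1) by (simp add: pair_group_def)
  interpret F: group_hom G ?B F
    using FG by unfold_locales
  have F_frag: "F (frag_of (u, v)) = uea_act N u (h v)" if "u \<in> carrier U" "v \<in> carrier V" for u v
    using F(2)[of "(u, v)"] that by simp
  have F_diff: "F (x - y) = F x \<ominus>\<^bsub>N\<^esub> F y" if "x \<in> carrier G" "y \<in> carrier G" for x y
    using F.hom_mult[of x "- y"] F.hom_inv[of y] that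
    by (simp add: G_uminus G_inv a_minus_def a_inv_def)
  have "R \<subseteq> kernel G ?B F"
  proof (rule R_least[OF F.subgroup_kernel])
    have eq: "((x \<oplus>\<^bsub>N\<^esub> y) \<ominus>\<^bsub>N\<^esub> x) \<ominus>\<^bsub>N\<^esub> y = \<zero>\<^bsub>N\<^esub>" if "x \<in> carrier N" "y \<in> carrier N" for x y
    proof -
      have "(x \<oplus>\<^bsub>N\<^esub> y) \<ominus>\<^bsub>N\<^esub> x = y"
        using that N.M.a_comm[of "x \<oplus>\<^bsub>N\<^esub> y" "\<ominus>\<^bsub>N\<^esub> x"] by (simp add: N.M.minus_eq N.M.r_neg1)
      then show ?thesis using that by simp
    qed
    show "rels \<subseteq> kernel G ?B F"
    proof
      fix x assume x: "x \<in> rels"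
      then have "F x = \<zero>\<^bsub>N\<^esub>"
        by (elim UnE CollectE exE conjE)
           (simp_all add: F_diff F_frag G_diff G_frag rels_closed N_add N_plus N_mult N_incl hD N_act eq)
      with subsetD[OF rels_carrier x] show "x \<in> kernel G ?B F"
        unfolding kernel_def by (intro CollectI conjI) simp_all
    qed
  qed
  then have ker: "F x = F y" if "x \<in> carrier G" "y \<in> carrier G" "cos x = cos y" for x y
  proof -
    have "x \<in> cos y" using cos_self[of x] that by simp
    then have "x - y \<in> kernel G ?B F" using cos_memD that(2) \<open>R \<subseteq> _\<close> by blast
    then have "F x \<ominus>\<^bsub>N\<^esub> F y = \<zero>\<^bsub>N\<^esub>" using that by (simp add: kernel_def F_diff)
    then show ?thesis using that F.hom_closed by simp
  qed
  obtain g where g: "g \<in> hom (G Mod R) ?B" "\<And>x. x \<in> carrier G \<Longrightarrow> g (cos x) = F x"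
    using FactGroup_universal[OF FG R_normal ker] by metis
  have g_closed: "g x \<in> carrier N" if "x \<in> carrier M" for x
    using hom_in_carrier[OF g(1)] that by (simp add: M_fields)
  have g_add: "g (x \<oplus>\<^bsub>M\<^esub> y) = g x \<oplus>\<^bsub>N\<^esub> g y" if "x \<in> carrier M" "y \<in> carrier M" for x y
    using hom_mult[OF g(1), of x y] that by (simp add: M_fields)
  have g_T: "g (T u v) = uea_act N u (h v)" if "u \<in> carrier U" "v \<in> carrier V" for u v
    using that by (simp add: T_def g(2) G_frag F_frag)
  have g_lm: "g (lm u x) = uea_act N u (g x)" if u: "u \<in> carrier U" and x: "x \<in> carrier M" for u x
    by (rule M_eqI[OF N.M.abelian_group_axioms _ _ _ _ x])
       (simp_all add: g_closed g_add lm_add g_T lm_T N_mult N_plus N_act hD u)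
  have "intertwiner L M N g"
    by (rule intertwinerI)
       (simp_all add: g_closed g_add M_smult M_act g_lm N.uea_act_class free_alg_const free_alg_letter
          N.free_act_const N.free_act_letter)
  then have "intertwiner L M N (restrict g (carrier M))"
    by (rule intertwiner_cong[OF M_lie_rep]) simp
  then show ?thesis by (intro exI[of _ "restrict g (carrier M)"]) (simp add: g_T)
qed

lemma induced_map:
  assumes N: "lie_rep L N" and h: "intertwiner K V N h"
  shows "intertwiner L M N (induced_map L K V N h)"
    and "induced_map L K V N h \<in> extensional (carrier M)"
    and "\<And>u v. u \<in> carrier U \<Longrightarrow> v \<in> carrier V \<Longrightarrow> induced_map L K V N h (T u v) = uea_act N u (h v)"
proof -
  interpret N: lie_representation L N using N by unfold_locales
  obtain f where f: "intertwiner L M N f" "f \<in> extensional (carrier M)"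
    "\<And>u v. u \<in> carrier U \<Longrightarrow> v \<in> carrier V \<Longrightarrow> f (T u v) = uea_act N u (h v)"
    using universal_map[OF N h] by blast
  have "induced_map L K V N h = f"
    unfolding induced_map_def
  proof (rule the_equality, intro conjI ballI)
    fix g assume g: "g \<in> LinearCombinations.module_hom C_ring M N \<and> g \<in> extensional (carrier M)
      \<and> (\<forall>u\<in>carrier U. \<forall>v\<in>carrier V. g (T u v) = uea_act N u (h v))"
    show "g = f"
    proof (rule extensionalityI)
      fix x assume x: "x \<in> carrier M"
      show "g x = f x"
        by (rule M_eqI[OF N.M.abelian_group_axioms _ _ _ _ x])
           (use g f in \<open>auto simp: LinearCombinations.module_hom_def intertwinerD\<close>)
    qed (use g f in auto)
  qed (use f in \<open>auto simp: intertwiner_def\<close>)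
  with f show "intertwiner L M N (induced_map L K V N h)" "induced_map L K V N h \<in> extensional (carrier M)"
    "\<And>u v. u \<in> carrier U \<Longrightarrow> v \<in> carrier V \<Longrightarrow> induced_map L K V N h (T u v) = uea_act N u (h v)"
    by auto
qed

lemma induced_map_one:
  assumes N: "lie_rep L N" and h: "intertwiner K V N h" and v: "v \<in> carrier V"
  shows "induced_map L K V N h (T \<one>\<^bsub>U\<^esub> v) = h v"
proof -
  interpret N: lie_algebra_rep L N using N by unfold_locales
  have "uea_act N \<one>\<^bsub>U\<^esub> (h v) = h v"
    using N.uea_act_class[of 1 "h v"] intertwiner_closed[OF h v]
    by (simp add: free_alg_one L.uea_class_one N.free_act_one)
  then show ?thesis using induced_map(3)[OF N h] v by simp
qed

end

section \<open>Differential operators on polynomials\<close>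

type_synonym cpoly = "(nat \<Rightarrow>\<^sub>0 nat) \<Rightarrow>\<^sub>0 complex"

definition var :: "nat \<Rightarrow> nat \<Rightarrow>\<^sub>0 nat" where "var i = Poly_Mapping.single i 1"
abbreviation cst :: "complex \<Rightarrow> cpoly" where "cst c \<equiv> Poly_Mapping.single 0 c"

definition mdeg :: "(nat \<Rightarrow>\<^sub>0 nat) \<Rightarrow> nat" where
  "mdeg m = (\<Sum>j\<in>keys m. lookup m j)"

definition Xop :: "nat \<Rightarrow> cpoly \<Rightarrow> cpoly" where
  "Xop i p = Poly_Mapping.single (var i) 1 * p"

text \<open>
  The derivative with respect to \<open>x\<^sub>j\<close>.  Subtracting from an exponent 0 does no harm, since the
  coefficient vanishes then.
\<close>

definition Dop :: "nat \<Rightarrow> cpoly \<Rightarrow> cpoly" where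
  "Dop j p = (\<Sum>m\<in>keys p.
     Poly_Mapping.single (m - var j) (lookup p m * of_nat (lookup m j)))"

text \<open>
  The operator \<open>s - Eu\<close>, where the Euler operator \<open>Eu\<close> multiplies a monomial by its degree.
\<close>

definition Hop :: "complex \<Rightarrow> cpoly \<Rightarrow> cpoly" where
  "Hop s p = Poly_Mapping.mapp (\<lambda>m c. (s - of_nat (mdeg m)) * c) p"

lemma mdeg_over: "finite S \<Longrightarrow> keys m \<subseteq> S \<Longrightarrow> mdeg m = (\<Sum>j\<in>S. lookup m j)"
  unfolding mdeg_def by (rule sum.mono_neutral_left) (auto simp: in_keys_iff)

lemma mdeg_split: "mdeg m = lookup m i + (\<Sum>j\<in>keys m - {i}. lookup m j)"
proof -
  have "mdeg m = (\<Sum>j\<in>insert i (keys m). lookup m j)"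
    by (rule mdeg_over) auto
  then show ?thesis by (simp add: sum.insert_remove)
qed

lemma mdeg_add: "mdeg (m + m') = mdeg m + mdeg m'"
proof -
  let ?S = "keys m \<union> keys m'"
  have "mdeg (m + m') = (\<Sum>j\<in>?S. lookup (m + m') j)"
    by (rule mdeg_over) (use Poly_Mapping.keys_add[of m m'] in auto)
  also have "\<dots> = mdeg m + mdeg m'"
    by (simp add: lookup_add sum.distrib mdeg_over[of ?S m] mdeg_over[of ?S m'])
  finally show ?thesis .
qed

lemma mdeg_var [simp]: "mdeg (var i) = 1"
  by (simp add: mdeg_def var_def)

lemma mdeg_zero_iff: "mdeg m = 0 \<longleftrightarrow> m = 0"
proof
  assume "mdeg m = 0"
  then have "\<forall>j\<in>keys m. lookup m j = 0" by (simp add: mdeg_def)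
  then show "m = 0" by (intro poly_mapping_eqI) (auto simp: in_keys_iff)
qed (simp add: mdeg_def)

lemma lookup_var [simp]: "lookup (var i) j = (if i = j then 1 else 0)"
  by (simp add: var_def lookup_single when_def)

lemma minus_var_cancel: "lookup m j > 0 \<Longrightarrow> m - var j + var j = m"
  by (rule poly_mapping_eqI) (auto simp: lookup_add lookup_minus)

lemma lookup_cst_mult [simp]: "lookup (cst c * p) m = c * lookup p m"
  by (simp add: mult_map_scale_conv_mult[symmetric] Poly_Mapping.map.rep_eq when_def)

lemma lookup_Hop [simp]: "lookup (Hop s p) m = (s - of_nat (mdeg m)) * lookup p m"
  by (simp add: Hop_def lookup_mapp when_def in_keys_iff)

lemma Xop_expand:
  "Xop i p = (\<Sum>m\<in>keys p. Poly_Mapping.single (var i + m) (lookup p m))"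
  unfolding Xop_def by (subst free_poly_expand[of p]) (simp add: sum_distrib_left mult_single)

lemma lookup_Xop [simp]: "lookup (Xop i p) m =
    (if lookup m i > 0 then lookup p (m - var i) else 0)"
proof -
  have *: "(var i + m' = m) \<longleftrightarrow> lookup m i > 0 \<and> m' = m - var i" for m'
    using minus_var_cancel[of m i] by (auto simp: lookup_add add.commute)
  have "lookup (Xop i p) m =
      (\<Sum>m'\<in>keys p. if var i + m' = m then lookup p m' else 0)"
    by (simp add: Xop_expand lookup_sum lookup_single when_def)
  also have "\<dots> = (if lookup m i > 0 then lookup p (m - var i) else 0)"
    unfolding * by (auto simp: sum.delta in_keys_iff)
  finally show ?thesis .
qed

lemma lookup_Dop [simp]: "lookup (Dop j p) m =
    of_nat (lookup m j + 1) * lookup p (m + var j)"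
proof -
  have *: "(if m' - var j = m then lookup p m' * of_nat (lookup m' j) else 0) =
      (if m' = m + var j then lookup p m' * of_nat (lookup m' j) else 0)" for m'
    using minus_var_cancel[of m' j] by auto
  have "lookup (Dop j p) m = (\<Sum>m'\<in>keys p.
      if m' - var j = m then lookup p m' * of_nat (lookup m' j) else 0)"
    by (simp add: Dop_def lookup_sum lookup_single when_def)
  also have "\<dots> = of_nat (lookup m j + 1) * lookup p (m + var j)"
    unfolding * by (auto simp: sum.delta in_keys_iff lookup_add)
  finally show ?thesis .
qed

lemma cst_simps:
  "cst (a + b) = cst a + cst b" "cst (a * b) = cst a * cst b" "cst 1 = 1" "cst (a - b) = cst a - cst b"
  "cst (- a) = - cst a"
  by (simp_all add: single_add single_diff mult_single single_uminus)

lemma cst_sum: "cst (sum f S) = (\<Sum>x\<in>S. cst (f x))"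
  by (induction S rule: infinite_finite_induct) (simp_all add: single_add)

lemma op_linear:
  "Xop i (p + q) = Xop i p + Xop i q" "Xop i (p - q) = Xop i p - Xop i q" "Xop i 0 = 0"
  "Dop i (p + q) = Dop i p + Dop i q" "Dop i (p - q) = Dop i p - Dop i q" "Dop i 0 = 0"
  "Hop s (p + q) = Hop s p + Hop s q" "Hop s (p - q) = Hop s p - Hop s q" "Hop s 0 = 0"
  "Xop i (cst c * p) = cst c * Xop i p" "Dop i (cst c * p) = cst c * Dop i p" "Hop s (cst c * p) = cst c * Hop s p"
  by (rule poly_mapping_eqI; simp add: lookup_add lookup_minus distrib_left right_diff_distrib mult.left_commute)+

lemma Xop_commute: "Xop i (Xop j p) = Xop j (Xop i p)"
  by (simp add: Xop_def mult.left_commute)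

lemma Dop_commute: "Dop i (Dop j p) = Dop j (Dop i p)"
  by (rule poly_mapping_eqI) (simp add: lookup_add algebra_simps)

lemma Dop_Xop: "Dop j (Xop i p) = Xop i (Dop j p) + (if i = j then p else 0)"
proof (rule poly_mapping_eqI)
  fix m
  have "m + var j - var i = m - var i + var j" if "i \<noteq> j \<or> lookup m i > 0"
    using that by (intro poly_mapping_eqI) (auto simp: lookup_add lookup_minus)
  then show "lookup (Dop j (Xop i p)) m =
      lookup (Xop i (Dop j p) + (if i = j then p else 0)) m"
    by (cases "i = j"; cases "lookup m i > 0")
       (simp_all add: lookup_add lookup_minus distrib_right minus_var_cancel of_nat_diff)
qed

lemma Xop_Hop: "Xop i (Hop s p) = Hop s (Xop i p) + Xop i p"
proof (rule poly_mapping_eqI)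
  fix m
  have "mdeg m = mdeg (m - var i) + 1" if "lookup m i > 0"
    using mdeg_add[of "m - var i" "var i"] minus_var_cancel[OF that] by simp
  then show "lookup (Xop i (Hop s p)) m = lookup (Hop s (Xop i p) + Xop i p) m"
    by (auto simp: lookup_add algebra_simps)
qed

lemma Dop_Hop: "Dop j (Hop s p) = Hop s (Dop j p) - Dop j p"
  by (rule poly_mapping_eqI) (simp add: lookup_minus mdeg_add algebra_simps)

text \<open>
  The matrix unit with indices \<open>i\<close> and \<open>j\<close> acts as \<open>raise_op s i\<close> after \<open>lower_op j\<close>.  The matrix index
  \<open>i + 1\<close> belongs to the variable \<open>x\<^sub>i\<close>; the matrix index 0 has no variable, and its factor
  \<open>s - Eu\<close> is put on the raising side so that the column of the \<open>N_minus\<close> acts by plain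
  multiplication.
\<close>

definition raise_op :: "complex \<Rightarrow> nat \<Rightarrow> cpoly \<Rightarrow> cpoly" where
  "raise_op s i = (case i of 0 \<Rightarrow> Hop s | Suc i \<Rightarrow> Xop i)"

definition lower_op :: "nat \<Rightarrow> cpoly \<Rightarrow> cpoly" where
  "lower_op j = (case j of 0 \<Rightarrow> id | Suc j \<Rightarrow> Dop j)"

text \<open>
  Everything reduces to the relations of the Weyl algebra, by moving \<open>s - Eu\<close> to the left and the
  derivatives to the right.
\<close>

lemma gl_relation:
  "raise_op s i (lower_op j (raise_op s k (lower_op l p))) - raise_op s k (lower_op l (raise_op s i (lower_op j p)))
   = (if j = k then raise_op s i (lower_op l p) else 0) - (if l = i then raise_op s k (lower_op j p) else 0)"
  by (cases i; cases j; cases k; cases l)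
     (simp_all add: raise_op_def lower_op_def op_linear Xop_commute Dop_commute Dop_Xop Xop_Hop Dop_Hop)

text \<open>
  The commutation relations of the matrix units, which two families satisfy: the one of
  \<open>gl_relation\<close> for \<open>sl n\<close>, and \<open>x\<^sub>i \<partial>\<^sub>j\<close> alone for the symmetric powers of \<open>sl (n - 1)\<close>.
\<close>

locale gl_operators =
  fixes E :: "nat \<Rightarrow> nat \<Rightarrow> cpoly \<Rightarrow> cpoly"
  assumes E_add: "E i j (p + q) = E i j p + E i j q"
    and E_cst: "E i j (cst c * p) = cst c * E i j p"
    and E_bracket: "E i j (E k l p) - E k l (E i j p) =
      (if j = k then E i l p else 0) - (if l = i then E k j p else 0)"
begin

definition mat_op :: "nat \<Rightarrow> complex mat \<Rightarrow> cpoly \<Rightarrow> cpoly" where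
  "mat_op n A p = (\<Sum>i<n. \<Sum>j<n. cst (A $$ (i, j)) * E i j p)"

lemma E_zero: "E i j 0 = 0"
  using E_cst[of i j 0 0] by simp

lemma E_sum: "E i j (sum f S) = (\<Sum>x\<in>S. E i j (f x))"
  by (induction S rule: infinite_finite_induct) (simp_all add: E_add E_zero)

lemma mat_op_plus: "mat_op n A (p + q) = mat_op n A p + mat_op n A q"
  by (simp add: mat_op_def E_add distrib_left sum.distrib)

lemma mat_op_cst: "mat_op n A (cst c * p) = cst c * mat_op n A p"
  by (simp add: mat_op_def E_cst sum_distrib_left mult.left_commute)

lemma mat_op_add: "A \<in> carrier_mat n n \<Longrightarrow> B \<in> carrier_mat n n \<Longrightarrow> mat_op n (A + B) p = mat_op n A p + mat_op n B p"
  by (simp add: mat_op_def cst_simps distrib_right sum.distrib)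

lemma mat_op_smult: "A \<in> carrier_mat n n \<Longrightarrow> mat_op n (c \<cdot>\<^sub>m A) p = cst c * mat_op n A p"
  by (simp add: mat_op_def cst_simps sum_distrib_left mult.assoc)

lemma mat_op_comp:
  "mat_op n A (mat_op n B p) = (\<Sum>i<n. \<Sum>j<n. \<Sum>k<n. \<Sum>l<n. cst (A $$ (i, j) * B $$ (k, l)) * E i j (E k l p))"
  by (simp add: mat_op_def E_sum E_cst sum_distrib_left cst_simps mult.assoc)

lemma mat_op_mult:
  assumes "A \<in> carrier_mat n n" "B \<in> carrier_mat n n"
  shows "mat_op n (A * B) p = (\<Sum>i<n. \<Sum>j<n. \<Sum>l<n. cst (A $$ (i, j) * B $$ (j, l)) * E i l p)"
proof -
  have "mat_op n (A * B) p = (\<Sum>i<n. \<Sum>l<n. \<Sum>j<n. cst (A $$ (i, j) * B $$ (j, l)) * E i l p)"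
    using assms by (simp add: mat_op_def scalar_prod_def cst_sum sum_distrib_right atLeast0LessThan)
  also have "\<dots> = (\<Sum>i<n. \<Sum>j<n. \<Sum>l<n. cst (A $$ (i, j) * B $$ (j, l)) * E i l p)"
    by (rule sum.cong[OF refl]) (rule sum.swap)
  finally show ?thesis .
qed

lemma mat_op_bracket:
  assumes A: "A \<in> carrier_mat n n" and B: "B \<in> carrier_mat n n"
  shows "mat_op n (A * B - B * A) p = mat_op n A (mat_op n B p) - mat_op n B (mat_op n A p)"
proof -
  have "mat_op n B (mat_op n A p) = (\<Sum>i<n. \<Sum>j<n. \<Sum>k<n. \<Sum>l<n. cst (A $$ (k, l) * B $$ (i, j)) * E i j (E k l p))"
    by (simp add: mat_op_comp mult.commute)
  also have "\<dots> = (\<Sum>i<n. \<Sum>k<n. \<Sum>j<n. \<Sum>l<n. cst (A $$ (k, l) * B $$ (i, j)) * E i j (E k l p))"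
    by (rule sum.cong[OF refl]) (rule sum.swap)
  also have "\<dots> = (\<Sum>k<n. \<Sum>i<n. \<Sum>j<n. \<Sum>l<n. cst (A $$ (k, l) * B $$ (i, j)) * E i j (E k l p))"
    by (rule sum.swap)
  also have "\<dots> = (\<Sum>k<n. \<Sum>i<n. \<Sum>l<n. \<Sum>j<n. cst (A $$ (k, l) * B $$ (i, j)) * E i j (E k l p))"
    by (rule sum.cong[OF refl], rule sum.cong[OF refl]) (rule sum.swap)
  also have "\<dots> = (\<Sum>k<n. \<Sum>l<n. \<Sum>i<n. \<Sum>j<n. cst (A $$ (k, l) * B $$ (i, j)) * E i j (E k l p))"
    by (rule sum.cong[OF refl]) (rule sum.swap)
  finally have "mat_op n A (mat_op n B p) - mat_op n B (mat_op n A p) =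
      (\<Sum>i<n. \<Sum>j<n. \<Sum>k<n. \<Sum>l<n. cst (A $$ (i, j) * B $$ (k, l)) * (E i j (E k l p) - E k l (E i j p)))"
    by (simp add: mat_op_comp sum_subtractf right_diff_distrib)
  also have "\<dots> = (\<Sum>i<n. \<Sum>j<n. \<Sum>k<n. \<Sum>l<n. if j = k then cst (A $$ (i, j) * B $$ (k, l)) * E i l p else 0)
      - (\<Sum>i<n. \<Sum>j<n. \<Sum>k<n. \<Sum>l<n. if l = i then cst (A $$ (i, j) * B $$ (k, l)) * E k j p else 0)"
    unfolding E_bracket sum_subtractf[symmetric]
    by (intro sum.cong refl) (simp add: right_diff_distrib)
  also have "(\<Sum>i<n. \<Sum>j<n. \<Sum>k<n. \<Sum>l<n. if j = k then cst (A $$ (i, j) * B $$ (k, l)) * E i l p else 0)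
      = mat_op n (A * B) p"
  proof -
    have *: "(\<Sum>k<n. \<Sum>l<n. if j = k then cst (A $$ (i, j) * B $$ (k, l)) * E i l p else 0) =
        (\<Sum>l<n. cst (A $$ (i, j) * B $$ (j, l)) * E i l p)" if "j < n" for i j
    proof -
      have "(\<Sum>k<n. \<Sum>l<n. if j = k then cst (A $$ (i, j) * B $$ (k, l)) * E i l p else 0) =
          (\<Sum>k<n. if j = k then (\<Sum>l<n. cst (A $$ (i, j) * B $$ (k, l)) * E i l p) else 0)"
        by (rule sum.cong) auto
      then show ?thesis using that by simp
    qed
    show ?thesis unfolding mat_op_mult[OF A B]
      by (rule sum.cong[OF refl], rule sum.cong[OF refl]) (simp add: *)
  qed
  also have "(\<Sum>i<n. \<Sum>j<n. \<Sum>k<n. \<Sum>l<n. if l = i then cst (A $$ (i, j) * B $$ (k, l)) * E k j p else 0)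
      = (\<Sum>i<n. \<Sum>j<n. \<Sum>k<n. cst (B $$ (k, i) * A $$ (i, j)) * E k j p)"
    by (intro sum.cong refl) (simp add: mult.commute)
  also have "\<dots> = (\<Sum>i<n. \<Sum>k<n. \<Sum>j<n. cst (B $$ (k, i) * A $$ (i, j)) * E k j p)"
    by (rule sum.cong[OF refl]) (rule sum.swap)
  also have "\<dots> = (\<Sum>k<n. \<Sum>i<n. \<Sum>j<n. cst (B $$ (k, i) * A $$ (i, j)) * E k j p)"
    by (rule sum.swap)
  also have "\<dots> = mat_op n (B * A) p"
    by (simp add: mat_op_mult[OF B A])
  also have "mat_op n (A * B) p - mat_op n (B * A) p = mat_op n (A * B - B * A) p"
    using A B by (simp add: mat_op_def cst_simps left_diff_distrib sum_subtractf)
  finally show ?thesis by simp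
qed

end

lemma (in gl_operators) mat_op_unit:
  assumes "i < n" "j < n"
  shows "mat_op n (E_unit n i j) p = E i j p"
proof -
  have "mat_op n (E_unit n i j) p = (\<Sum>i'<n. \<Sum>j'<n. if j' = j then (if i' = i then E i j p else 0) else 0)"
    unfolding mat_op_def by (intro sum.cong refl) (auto simp: E_unit_def cst_simps)
  then show ?thesis using assms by simp
qed

interpretation pol_op: gl_operators "\<lambda>i j p. raise_op s i (lower_op j p)" for s
  by unfold_locales (simp_all add: gl_relation, simp_all add: raise_op_def lower_op_def op_linear split: nat.splits)

interpretation sym_op: gl_operators "\<lambda>i j p. Xop i (Dop j p)"
  by unfold_locales (use gl_relation[of 0 "Suc _" "Suc _" "Suc _" "Suc _"] in \<open>simp_all add: op_linear raise_op_def lower_op_def\<close>)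

definition poly_space :: "cpoly set \<Rightarrow> (complex mat \<Rightarrow> cpoly \<Rightarrow> cpoly) \<Rightarrow> cpoly lie_module" where
  "poly_space S f = \<lparr>carrier = S, monoid.mult = (*), one = 1, ring.zero = 0, add = (+),
      smult = (\<lambda>c p. cst c * p), act = f\<rparr>"

lemma poly_space_simps [simp]:
  "carrier (poly_space S f) = S" "\<zero>\<^bsub>poly_space S f\<^esub> = 0" "p \<oplus>\<^bsub>poly_space S f\<^esub> q = p + q"
  "c \<odot>\<^bsub>poly_space S f\<^esub> p = cst c * p" "act (poly_space S f) = f"
  by (simp_all add: poly_space_def)

lemma poly_space_lie_rep:
  fixes S :: "cpoly set"
  assumes S: "0 \<in> S" "\<And>p q. p \<in> S \<Longrightarrow> q \<in> S \<Longrightarrow> p + q \<in> S" "\<And>c p. p \<in> S \<Longrightarrow> cst c * p \<in> S"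
    and f: "\<And>A p. A \<in> L \<Longrightarrow> p \<in> S \<Longrightarrow> f A p \<in> S"
      "\<And>A p q. A \<in> L \<Longrightarrow> f A (p + q) = f A p + f A q"
      "\<And>A c p. A \<in> L \<Longrightarrow> f A (cst c * p) = cst c * f A p"
      "\<And>A B p. A \<in> L \<Longrightarrow> B \<in> L \<Longrightarrow> f (A + B) p = f A p + f B p"
      "\<And>A c p. A \<in> L \<Longrightarrow> f (c \<cdot>\<^sub>m A) p = cst c * f A p"
      "\<And>A B p. A \<in> L \<Longrightarrow> B \<in> L \<Longrightarrow> f (A * B - B * A) p = f A (f B p) - f B (f A p)"
  shows "lie_rep L (poly_space S f)"
proof -
  let ?V = "poly_space S f"
  have neg: "- p \<in> S" if "p \<in> S" for p
    using S(3)[OF that, of "- 1"] by (simp add: cst_simps)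
  have mod: "module C_ring ?V"
  proof (rule moduleI)
    show "cring (C_ring :: complex ring)" ..
    show "abelian_group ?V"
      by (rule abelian_groupI) (use S neg in \<open>auto simp: add.assoc add.commute intro!: bexI[of _ "- _"]\<close>)
  qed (use S in \<open>auto simp: cst_simps distrib_left distrib_right mult.assoc\<close>)
  interpret V: Module.module C_ring ?V by (rule mod)
  have minus: "p \<ominus>\<^bsub>?V\<^esub> q = p - q" if "p \<in> S" "q \<in> S" for p q
    using that V.M.minus_equality[of "- q" q] neg by (simp add: a_minus_def)
  show ?thesis unfolding lie_rep_def
  proof (intro conjI ballI allI)
    show "vectorspace C_ring ?V" by (intro vectorspace.intro mod class_field)
  qed (use f in \<open>auto simp: LinearCombinations.module_hom_def minus\<close>)
qed

section \<open>Homogeneous polynomials\<close>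

definition mono_in :: "nat \<Rightarrow> (nat \<Rightarrow>\<^sub>0 nat) \<Rightarrow> bool" where
  "mono_in d m \<longleftrightarrow> (\<forall>j\<ge>d. lookup m j = 0)"

lemma mono_in_keys: "mono_in d m \<longleftrightarrow> keys m \<subseteq> {..<d}"
  by (auto simp: mono_in_def in_keys_iff subset_iff) (metis le_less_linear less_irrefl)

lemma Xi_iff: "m \<in> Xi d k \<longleftrightarrow> mono_in d m \<and> mdeg m = k"
  using mdeg_over[of "{..<d}" m] by (auto simp: Xi_def mono_in_keys)

definition poly_in :: "nat \<Rightarrow> cpoly set" where
  "poly_in d = {p. \<forall>m. lookup p m \<noteq> 0 \<longrightarrow> mono_in d m}"

definition homog :: "nat \<Rightarrow> nat \<Rightarrow> cpoly set" where
  "homog d k = {p. \<forall>m. lookup p m \<noteq> 0 \<longrightarrow> mono_in d m \<and> mdeg m = k}"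

lemma homog_poly_in: "p \<in> homog d k \<Longrightarrow> p \<in> poly_in d"
  by (auto simp: homog_def poly_in_def)

lemma poly_in_closed:
  "0 \<in> poly_in d" "p \<in> poly_in d \<Longrightarrow> q \<in> poly_in d \<Longrightarrow> p + q \<in> poly_in d"
  "p \<in> poly_in d \<Longrightarrow> cst c * p \<in> poly_in d"
  unfolding poly_in_def mem_Collect_eq by (simp, metis add.right_neutral lookup_add, simp)

lemma homog_closed:
  "0 \<in> homog d k" "p \<in> homog d k \<Longrightarrow> q \<in> homog d k \<Longrightarrow> p + q \<in> homog d k"
  "p \<in> homog d k \<Longrightarrow> cst c * p \<in> homog d k"
  unfolding homog_def mem_Collect_eq by (simp, metis add.right_neutral lookup_add, simp)

lemma poly_in_sum: "(\<And>x. x \<in> A \<Longrightarrow> f x \<in> poly_in d) \<Longrightarrow> sum f A \<in> poly_in d"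
  by (induction A rule: infinite_finite_induct) (auto simp: poly_in_closed)

lemma homog_sum: "(\<And>x. x \<in> A \<Longrightarrow> f x \<in> homog d k) \<Longrightarrow> sum f A \<in> homog d k"
  by (induction A rule: infinite_finite_induct) (auto simp: homog_closed)

lemma mono_in_minus: "mono_in d (m - var i) \<Longrightarrow> i < d \<Longrightarrow> mono_in d m"
  by (auto simp: mono_in_def lookup_minus)

lemma mono_in_plus: "mono_in d (m + var i) \<longleftrightarrow> mono_in d m \<and> i < d"
  by (auto simp: mono_in_def lookup_add)

lemma poly_in_ops:
  "p \<in> poly_in d \<Longrightarrow> i < d \<Longrightarrow> Xop i p \<in> poly_in d"
  "p \<in> poly_in d \<Longrightarrow> Dop j p \<in> poly_in d"
  "p \<in> poly_in d \<Longrightarrow> Hop s p \<in> poly_in d"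
  using mono_in_plus mono_in_minus by (auto simp: poly_in_def split: if_splits simp del: of_nat_Suc) 

lemma mdeg_minus_var: "lookup m i > 0 \<Longrightarrow> mdeg (m - var i) + 1 = mdeg m"
  using mdeg_add[of "m - var i" "var i"] minus_var_cancel[of m i] by simp

lemma homog_ops:
  assumes "p \<in> homog d k" "i < d"
  shows "Xop i (Dop j p) \<in> homog d k"
proof -
  have "mono_in d m \<and> mdeg m = k" if "lookup (Xop i (Dop j p)) m \<noteq> 0" for m
  proof -
    have m: "lookup m i > 0" "lookup p (m - var i + var j) \<noteq> 0"
      using that by (auto split: if_splits)
    then have "mono_in d (m - var i + var j)" "mdeg (m - var i + var j) = k"
      using assms by (auto simp: homog_def)
    then show ?thesis using m(1) mono_in_minus[of d m i] assms(2) mdeg_minus_var[of m i]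
      by (auto simp: mono_in_plus mdeg_add)
  qed
  then show ?thesis by (simp add: homog_def)
qed

lemma Dop_single: "Dop j (Poly_Mapping.single m c) = Poly_Mapping.single (m - var j) (c * of_nat (lookup m j))"
  by (simp add: Dop_def)

lemma Xop_single: "Xop i (Poly_Mapping.single m c) = Poly_Mapping.single (m + var i) c"
  by (simp add: Xop_def mult_single add.commute)

lemma sym_power_eq: "sym_power d k = poly_space (homog d k) (sym_op.mat_op d)"
proof -
  have c: "{p. keys p \<subseteq> Xi d k} = homog d k"
    by (auto simp: homog_def Xi_iff in_keys_iff subset_iff)
  have "(\<Sum>m\<in>keys p. \<Sum>i<d. \<Sum>j<d. Poly_Mapping.single (m - Poly_Mapping.single j 1 + Poly_Mapping.single i 1)
         (lookup p m * of_nat (lookup m j) * X $$ (i, j))) = sym_op.mat_op d X p" for X p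
  proof -
    have "(\<Sum>m\<in>keys p. Poly_Mapping.single (m - var j + var i)
         (lookup p m * of_nat (lookup m j) * X $$ (i, j))) = cst (X $$ (i, j)) * Xop i (Dop j p)" for i j
      by (simp add: Xop_def Dop_def sum_distrib_left mult_single mult_ac add_ac)
    then have "sym_op.mat_op d X p = (\<Sum>i<d. \<Sum>j<d. \<Sum>m\<in>keys p. Poly_Mapping.single (m - var j + var i)
         (lookup p m * of_nat (lookup m j) * X $$ (i, j)))"
      by (simp add: sym_op.mat_op_def)
    also have "\<dots> = (\<Sum>i<d. \<Sum>m\<in>keys p. \<Sum>j<d. Poly_Mapping.single (m - var j + var i)
         (lookup p m * of_nat (lookup m j) * X $$ (i, j)))"
      by (rule sum.cong[OF refl]) (rule sum.swap)
    also have "\<dots> = (\<Sum>m\<in>keys p. \<Sum>i<d. \<Sum>j<d. Poly_Mapping.single (m - var j + var i)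
         (lookup p m * of_nat (lookup m j) * X $$ (i, j)))"
      by (rule sum.swap)
    finally show ?thesis by (simp add: var_def)
  qed
  then show ?thesis unfolding sym_power_def poly_space_def c by simp
qed

lemma sl_carrier: "A \<in> sl n \<Longrightarrow> A \<in> carrier_mat n n"
  by (simp add: sl_def)

lemma sl_lie_algebra: "matrix_lie_algebra (sl n)"
proof
  fix A B assume A: "A \<in> sl n" and B: "B \<in> sl n"
  note [simp] = carrier_matD[OF sl_carrier[OF A]] carrier_matD[OF sl_carrier[OF B]]
  show "A + B \<in> sl n" using A B by (simp add: sl_def sum.distrib)
  show "c \<cdot>\<^sub>m A \<in> sl n" for c using A by (simp add: sl_def flip: sum_distrib_left)
  have "(\<Sum>i<n. (A * B) $$ (i, i)) = (\<Sum>i<n. \<Sum>j<n. A $$ (i, j) * B $$ (j, i))"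
    by (simp add: scalar_prod_def atLeast0LessThan)
  also have "\<dots> = (\<Sum>j<n. \<Sum>i<n. A $$ (i, j) * B $$ (j, i))" by (rule sum.swap)
  also have "\<dots> = (\<Sum>i<n. (B * A) $$ (i, i))"
    by (simp add: scalar_prod_def atLeast0LessThan mult.commute)
  finally have tr: "(\<Sum>i<n. (A * B) $$ (i, i)) = (\<Sum>i<n. (B * A) $$ (i, i))" .
  have "(\<Sum>i<n. (A * B - B * A) $$ (i, i)) = (\<Sum>i<n. (A * B) $$ (i, i) - (B * A) $$ (i, i))"
    by (rule sum.cong) (simp_all del: index_mult_mat(1))
  also have "\<dots> = 0" unfolding sum_subtractf tr by (rule diff_self)
  finally show "A * B - B * A \<in> sl n" unfolding sl_def by (intro CollectI conjI carrier_matI) simp_all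
qed

lemma E_unit_sl: "i < n \<Longrightarrow> j < n \<Longrightarrow> i \<noteq> j \<Longrightarrow> E_unit n i j \<in> sl n"
  by (auto simp: sl_def E_unit_def intro: sum.neutral)

lemma sym_power_rep: "lie_rep (sl d) (sym_power d k)"
  unfolding sym_power_eq
proof (rule poly_space_lie_rep)
  show "sym_op.mat_op d A p \<in> homog d k" if "p \<in> homog d k" for A p
    unfolding sym_op.mat_op_def using that by (intro homog_sum) (auto intro!: homog_closed homog_ops)
qed (auto simp: homog_closed sym_op.mat_op_plus sym_op.mat_op_cst sym_op.mat_op_add sym_op.mat_op_smult
    sym_op.mat_op_bracket sl_carrier)

subsection \<open>Highest weight vectors in symmetric powers\<close>

abbreviation top_power :: "nat \<Rightarrow> cpoly" where
  "top_power k \<equiv> Poly_Mapping.single (Poly_Mapping.single 0 k) 1"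

lemma Xop_eq_0: "Xop i p = 0 \<Longrightarrow> p = 0"
proof (rule poly_mapping_eqI)
  fix m assume "Xop i p = 0"
  then have "lookup (Xop i p) (m + var i) = 0" by (simp del: lookup_Xop)
  then show "lookup p m = lookup 0 m" by (simp add: lookup_add)
qed

text \<open>
  Multiplication by \<open>x\<^sub>0\<close> is injective, so the derivatives with respect to the other variables vanish and
  \<open>p\<close> is a polynomial in \<open>x\<^sub>0\<close> alone.
\<close>

lemma highest_weight_unique:
  assumes p: "p \<in> homog d k" and hw: "\<And>j. 1 \<le> j \<Longrightarrow> j < d \<Longrightarrow> Xop 0 (Dop j p) = 0"
  shows "\<exists>c. p = cst c * top_power k"
proof (intro exI poly_mapping_eqI)
  fix m
  have "m = Poly_Mapping.single 0 k" if m: "lookup p m \<noteq> 0"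
  proof -
    have mm: "mono_in d m" "mdeg m = k" using p m by (auto simp: homog_def)
    have 0: "lookup m j = 0" if "j \<noteq> 0" for j
    proof (rule ccontr)
      assume j: "lookup m j \<noteq> 0"
      then have "j < d" using mm by (auto simp: mono_in_def not_less[symmetric])
      then have "Dop j p = 0" using that by (simp add: Xop_eq_0[OF hw])
      then have "lookup (Dop j p) (m - var j) = 0" by (simp del: lookup_Dop)
      then show False using j m minus_var_cancel[of m j] by (auto simp del: of_nat_Suc)
    qed
    have "mdeg m = lookup m 0"
      using 0 by (subst mdeg_split[of m 0]) simp
    then show ?thesis using 0 mm by (intro poly_mapping_eqI) (auto simp: lookup_single when_def)
  qed
  then show "lookup p m =
      lookup (cst (lookup p (Poly_Mapping.single 0 k)) * top_power k) m"
    by (auto simp: lookup_single when_def)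
qed

text \<open>
  The operators \<open>x\<^sub>0 \<partial>\<^sub>j\<close> raise the least exponent of \<open>x\<^sub>0\<close>, which cannot exceed \<open>k\<close>; after finitely many
  of them a nonzero polynomial is reached that all of them kill.
\<close>

lemma highest_weight_exists:
  assumes S: "S \<subseteq> homog d k" "\<And>p j. p \<in> S \<Longrightarrow> 1 \<le> j \<Longrightarrow> j < d \<Longrightarrow> Xop 0 (Dop j p) \<in> S"
    and p: "p \<in> S" "p \<noteq> 0"
  shows "\<exists>q\<in>S. q \<noteq> 0 \<and> (\<forall>j. 1 \<le> j \<longrightarrow> j < d \<longrightarrow> Xop 0 (Dop j q) = 0)"
proof -
  \<comment> \<open>\<open>N\<close> bounds how far the least exponent of \<open>x\<^sub>0\<close> is below \<open>k\<close>\<close>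
  have "\<exists>q\<in>S. q \<noteq> 0 \<and> (\<forall>j. 1 \<le> j \<longrightarrow> j < d \<longrightarrow> Xop 0 (Dop j q) = 0)"
    if "p \<in> S" "p \<noteq> 0" "\<And>m. lookup p m \<noteq> 0 \<Longrightarrow> k \<le> lookup m 0 + N" for p N
    using that
  proof (induction N arbitrary: p)
    case 0
    have "Dop j p = 0" if "1 \<le> j" for j
    proof (rule poly_mapping_eqI)
      fix m
      have "lookup p (m + var j) = 0"
      proof (rule ccontr)
        assume nz: "lookup p (m + var j) \<noteq> 0"
        then have "mdeg (m + var j) = k" using 0(1) S(1) by (auto simp: homog_def)
        moreover have "k \<le> lookup m 0" using 0(3)[OF nz] that by (simp add: lookup_add)
        moreover have "lookup m 0 \<le> mdeg m"
          by (subst mdeg_split[of m 0]) simp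
        ultimately show False by (simp add: mdeg_add)
      qed
      then show "lookup (Dop j p) m = lookup 0 m" by simp
    qed
    then show ?case using 0 by (intro bexI[of _ p]) (auto simp: op_linear)
  next
    case (Suc N)
    show ?case
    proof (cases "\<forall>j. 1 \<le> j \<longrightarrow> j < d \<longrightarrow> Xop 0 (Dop j p) = 0")
      case False
      then obtain j where j: "1 \<le> j" "j < d" "Xop 0 (Dop j p) \<noteq> 0" by auto
      show ?thesis
      proof (rule Suc.IH[of "Xop 0 (Dop j p)"])
        fix m assume "lookup (Xop 0 (Dop j p)) m \<noteq> 0"
        then have "lookup m 0 > 0" "lookup p (m - var 0 + var j) \<noteq> 0"
          by (auto split: if_splits)
        then show "k \<le> lookup m 0 + N"
          using Suc.prems(3)[of "m - var 0 + var j"] j by (simp add: lookup_add lookup_minus)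
      qed (use S Suc j in auto)
    qed (use Suc in auto)
  qed
  from this[of p k] show ?thesis using p by simp
qed

text \<open>
  From \<open>x\<^sub>0\<^sup>k\<close> the operators \<open>x\<^sub>j \<partial>\<^sub>0\<close> produce all monomials of degree \<open>k\<close>, replacing one factor \<open>x\<^sub>0\<close> at a
  time.
\<close>

lemma top_power_generates:
  assumes S: "0 \<in> S" "\<And>p q. p \<in> S \<Longrightarrow> q \<in> S \<Longrightarrow> p + q \<in> S" "\<And>c p. p \<in> S \<Longrightarrow> cst c * p \<in> S"
    "\<And>p j. p \<in> S \<Longrightarrow> 1 \<le> j \<Longrightarrow> j < d \<Longrightarrow> Xop j (Dop 0 p) \<in> S"
    and top: "top_power k \<in> S"
  shows "homog d k \<subseteq> S"
proof
  have mon: "Poly_Mapping.single m 1 \<in> S"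
    if "mono_in d m" "mdeg m = k" "k - lookup m 0 = N" for m N
    using that
  proof (induction N arbitrary: m)
    case 0
    note deg = mdeg_split[of m 0]
    then have "\<forall>j\<in>keys m - {0}. lookup m j = 0" using 0 by auto
    then have "m = Poly_Mapping.single 0 k"
      using 0 deg by (intro poly_mapping_eqI) (auto simp: lookup_single when_def in_keys_iff)
    then show ?case using top by simp
  next
    case (Suc N)
    note deg = mdeg_split[of m 0]
    obtain j where j: "j \<noteq> 0" "lookup m j > 0"
    proof (rule ccontr)
      assume "\<not> thesis"
      then have "\<forall>j\<in>keys m - {0}. lookup m j = 0" using that by auto
      then show False using deg Suc.prems by simp
    qed
    then have jd: "j < d" using Suc.prems(1) by (auto simp: mono_in_def not_less[symmetric])
    define m' where "m' = m - var j + var 0"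
    have m': "m' - var 0 + var j = m" using j by (simp add: m'_def minus_var_cancel)
    have 0: "lookup m' 0 = lookup m 0 + 1"
      using j by (simp add: m'_def lookup_add lookup_minus)
    have "mono_in d m'" using Suc.prems(1) jd j
      by (simp add: m'_def mono_in_plus) (simp add: mono_in_def lookup_minus)
    moreover have "mdeg m' = k" using mdeg_minus_var[OF j(2)] Suc.prems(2) by (simp add: m'_def mdeg_add)
    moreover have "k - lookup m' 0 = N" using Suc.prems(3) 0 by simp
    ultimately have "Poly_Mapping.single m' 1 \<in> S" by (rule Suc.IH)
    then have "Xop j (Dop 0 (Poly_Mapping.single m' 1)) \<in> S" using S(4) j jd by simp
    then have "Poly_Mapping.single m (of_nat (lookup m' 0)) \<in> S"
      by (simp add: Dop_single Xop_single m')
    then have "cst (1 / of_nat (lookup m' 0)) * Poly_Mapping.single m (of_nat (lookup m' 0)) \<in> S"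
      by (rule S(3))
    then show ?case using 0 by (simp add: mult_single del: of_nat_Suc)
  qed
  fix p assume p: "p \<in> homog d k"
  have "(\<Sum>m\<in>A. cst (lookup p m) * Poly_Mapping.single m 1) \<in> S" if "A \<subseteq> keys p" "finite A" for A
    using that(2,1)
  proof (induction A)
    case (insert m A)
    then have "mono_in d m" "mdeg m = k" using p by (auto simp: homog_def in_keys_iff)
    then have "cst (lookup p m) * Poly_Mapping.single m 1 \<in> S" using mon S(3) by blast
    then show ?case using insert S(2) by simp
  qed (simp add: S)
  from this[of "keys p"] show "p \<in> S"
    using free_poly_expand[of p] by (simp add: mult_single)
qed

subsection \<open>Schur's lemma for symmetric powers\<close>

lemma (in lie_representation) subspaceI:
  assumes "S \<subseteq> carrier V" "\<zero>\<^bsub>V\<^esub> \<in> S" "\<And>v w. v \<in> S \<Longrightarrow> w \<in> S \<Longrightarrow> v \<oplus>\<^bsub>V\<^esub> w \<in> S"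
    "\<And>c v. v \<in> S \<Longrightarrow> c \<odot>\<^bsub>V\<^esub> v \<in> S"
  shows "subspace C_ring S V"
  by (intro VectorSpace.subspace.intro LinearCombinations.submodule.intro vectorspace_axioms module_axioms)
     (use assms in auto)

lemma irrep_lie_rep: "fin_dim_irrep L V \<Longrightarrow> lie_rep L V"
  by (simp add: fin_dim_irrep_def)

lemma irrep_subspace:
  assumes V: "fin_dim_irrep L V" and S: "S \<subseteq> carrier V" "\<zero>\<^bsub>V\<^esub> \<in> S"
    "\<And>v w. v \<in> S \<Longrightarrow> w \<in> S \<Longrightarrow> v \<oplus>\<^bsub>V\<^esub> w \<in> S" "\<And>c v. v \<in> S \<Longrightarrow> c \<odot>\<^bsub>V\<^esub> v \<in> S"
    "\<And>A v. A \<in> L \<Longrightarrow> v \<in> S \<Longrightarrow> act V A v \<in> S"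
    and v: "v \<in> S" "v \<noteq> \<zero>\<^bsub>V\<^esub>"
  shows "S = carrier V"
proof -
  interpret lie_representation L V using V by unfold_locales (rule irrep_lie_rep)
  have "subspace C_ring S V" by (rule subspaceI) (use S in auto)
  with S(5) V v show ?thesis unfolding fin_dim_irrep_def by blast
qed

lemma sym_act_unit: "i < d \<Longrightarrow> j < d \<Longrightarrow> act (sym_power d k) (E_unit d i j) p = Xop i (Dop j p)"
  by (simp add: sym_power_eq sym_op.mat_op_unit)

text \<open>
  The map \<open>g\<close> sends the preimage of \<open>x\<^sub>0\<^sup>k\<close> under \<open>\<iota>\<close> to a vector killed by all \<open>x\<^sub>0 \<partial>\<^sub>j\<close>, hence to a
  multiple of \<open>x\<^sub>0\<^sup>k\<close>.  The vectors on which \<open>g\<close> agrees with this multiple of \<open>\<iota>\<close> form a nonzero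
  submodule.
\<close>

lemma sym_schur:
  assumes d: "d \<ge> 1" and V: "fin_dim_irrep (sl d) V"
    and \<iota>: "intertwiner (sl d) V (sym_power d k) \<iota>" "bij_betw \<iota> (carrier V) (carrier (sym_power d k))"
    and g: "intertwiner (sl d) V (sym_power d k) g"
  shows "\<exists>c. \<forall>v\<in>carrier V. g v = cst c * \<iota> v"
proof -
  interpret lie_representation "sl d" V using V by unfold_locales (rule irrep_lie_rep)
  note D = intertwinerD[OF g] intertwinerD[OF \<iota>(1)]
  have top: "top_power k \<in> carrier (sym_power d k)"
    using d by (auto simp: sym_power_eq homog_def lookup_single when_def mono_in_def mdeg_def)
  then obtain v0 where v0: "v0 \<in> carrier V" "\<iota> v0 = top_power k"
    using \<iota>(2) by (metis bij_betw_imp_surj_on imageE)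
  have z: "\<iota> \<zero>\<^bsub>V\<^esub> = 0" "g \<zero>\<^bsub>V\<^esub> = 0"
    using intertwiner_zero[OF rep sym_power_rep] \<iota>(1) g by (auto simp: sym_power_eq)
  have "Xop 0 (Dop j (g v0)) = 0" if j: "1 \<le> j" "j < d" for j
  proof -
    have E: "E_unit d 0 j \<in> sl d" using j by (intro E_unit_sl) auto
    have "\<iota> (act V (E_unit d 0 j) v0) = Xop 0 (Dop j (top_power k))"
      using D(8)[OF E v0(1)] j by (simp add: sym_act_unit v0)
    also have "\<dots> = 0" using j by (simp add: Dop_single lookup_single op_linear)
    finally have "act V (E_unit d 0 j) v0 = \<zero>\<^bsub>V\<^esub>"
      using z v0 E \<iota>(2) by (metis act_closed bij_betw_imp_inj_on inj_onD M.zero_closed)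
    then show ?thesis using D(4)[OF E v0(1)] j z by (simp add: sym_act_unit)
  qed
  moreover have "g v0 \<in> homog d k" using D(1)[OF v0(1)] by (simp add: sym_power_eq)
  ultimately obtain c where c: "g v0 = cst c * top_power k" using highest_weight_unique by blast
  let ?S = "{v \<in> carrier V. g v = cst c * \<iota> v}"
  have "?S = carrier V"
  proof (rule irrep_subspace[OF V, where v = v0])
    show "v0 \<noteq> \<zero>\<^bsub>V\<^esub>" using v0 z by (metis single_zero inj_single zero_neq_one injD)
    show "act V A v \<in> ?S" if "A \<in> sl d" "v \<in> ?S" for A v
      using that by (simp add: D sym_power_eq sym_op.mat_op_cst)
  qed (use c v0 z D in \<open>auto simp: sym_power_eq distrib_left mult.left_commute\<close>)
  then show ?thesis by blast
qed

text \<open>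
  The kernel is a proper submodule of an irreducible representation.  The image is a nonzero submodule
  of the symmetric power, so it contains \<open>x\<^sub>0\<^sup>k\<close> and with it everything.
\<close>

lemma sym_hom_bij:
  assumes d: "d \<ge> 1" and V: "fin_dim_irrep (sl d) V"
    and g: "intertwiner (sl d) V (sym_power d k) g" and nz: "v \<in> carrier V" "g v \<noteq> 0"
  shows "bij_betw g (carrier V) (carrier (sym_power d k))"
proof -
  interpret lie_representation "sl d" V using V by unfold_locales (rule irrep_lie_rep)
  note D = intertwinerD[OF g]
  have z: "g \<zero>\<^bsub>V\<^esub> = 0"
    using intertwiner_zero[OF rep sym_power_rep g] by (auto simp: sym_power_eq)
  have ker: "w = \<zero>\<^bsub>V\<^esub>" if w: "w \<in> carrier V" "g w = 0" for w
  proof (rule ccontr)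
    assume w0: "w \<noteq> \<zero>\<^bsub>V\<^esub>"
    have "{w \<in> carrier V. g w = 0} = carrier V"
    proof (rule irrep_subspace[OF V, where v = w])
      show "act V A u \<in> {w \<in> carrier V. g w = 0}" if "A \<in> sl d" "u \<in> {w \<in> carrier V. g w = 0}" for A u
        using that sym_op.mat_op_cst[of d A 0 0] by (simp add: D sym_power_eq)
    qed (use w w0 z D in \<open>auto simp: sym_power_eq\<close>)
    then show False using nz by auto
  qed
  have "inj_on g (carrier V)"
  proof (rule inj_onI)
    fix x y assume xy: "x \<in> carrier V" "y \<in> carrier V" "g x = g y"
    have "g (x \<oplus>\<^bsub>V\<^esub> (- 1) \<odot>\<^bsub>V\<^esub> y) = 0"
      using xy by (simp add: D sym_power_eq cst_simps)
    then have "x \<ominus>\<^bsub>V\<^esub> y = \<zero>\<^bsub>V\<^esub>" using ker xy by (simp add: scalar_minus_one M.minus_eq)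
    then show "x = y" using xy by simp
  qed
  moreover have "homog d k \<subseteq> g ` carrier V"
  proof -
    let ?S = "g ` carrier V"
    have sub: "?S \<subseteq> homog d k" using D(1) by (auto simp: sym_power_eq)
    have act: "Xop i (Dop j p) \<in> ?S" if "p \<in> ?S" "i < d" "j < d" "i \<noteq> j" for p i j
    proof -
      from that(1) obtain w where w: "w \<in> carrier V" "p = g w" by blast
      have "g (act V (E_unit d i j) w) = Xop i (Dop j p)"
        using that w by (simp add: D E_unit_sl sym_act_unit)
      then show ?thesis using that w by (metis act_closed E_unit_sl imageI)
    qed
    have add: "p + q \<in> ?S" if "p \<in> ?S" "q \<in> ?S" for p q
      using that D(2) by (auto simp: sym_power_eq) (metis M.add.m_closed imageI)
    have sc: "cst c * p \<in> ?S" if "p \<in> ?S" for p c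
      using that D(3) by (auto simp: sym_power_eq) (metis scalar imageI)
    have act0: "Xop 0 (Dop j p) \<in> ?S" if "p \<in> ?S" "1 \<le> j" "j < d" for p j
      using act[of p 0 j] that by simp
    have "g v \<in> ?S" using nz by simp
    from highest_weight_exists[OF sub act0 this nz(2)]
    obtain q where q: "q \<in> ?S" "q \<noteq> 0" "\<forall>j. 1 \<le> j \<longrightarrow> j < d \<longrightarrow> Xop 0 (Dop j q) = 0"
      by blast
    then obtain c where c: "q = cst c * top_power k" using highest_weight_unique[of q d k] sub by blast
    have "c \<noteq> 0" using c q by auto
    then have "top_power k = cst (1 / c) * q" using c by (simp add: mult.assoc[symmetric] mult_single)
    then have "top_power k \<in> ?S" using sc q by simp
    then show ?thesis
      using d by (intro top_power_generates act add sc) (use z in \<open>auto intro!: image_eqI[of _ _ "\<zero>\<^bsub>V\<^esub>"]\<close>)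
  qed
  ultimately show ?thesis using D(1) unfolding bij_betw_def by (auto simp: sym_power_eq)
qed

section \<open>The parabolic subalgebra\<close>

text \<open>
  With \<open>n\<close> in the form \<open>Suc d\<close>, a matrix index is either 0 or the successor of the index of a variable.
\<close>

locale maximal_parabolic =
  fixes n d :: nat
  assumes n_Suc: "n = Suc d" and d_pos: "d \<ge> 1"
begin

lemma n_minus [simp]: "n - 1 = d" "n - Suc 0 = d"
  by (simp_all add: n_Suc)

lemma less_n_cases: "i < n \<Longrightarrow> (i = 0 \<Longrightarrow> P) \<Longrightarrow> (\<And>i'. i' < d \<Longrightarrow> i = Suc i' \<Longrightarrow> P) \<Longrightarrow> P"
  by (cases i) (auto simp: n_Suc)

lemma zero_less_n [simp]: "0 < n"
  by (simp add: n_Suc)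

lemma Suc_less_n [simp]: "Suc i < n \<longleftrightarrow> i < d"
  by (simp add: n_Suc)

lemma sum_less_n: "(\<Sum>i<n. f i) = f 0 + (\<Sum>i<d. f (Suc i))" for f :: "nat \<Rightarrow> 'a::comm_monoid_add"
  unfolding n_Suc by (rule sum.lessThan_Suc_shift)

definition lower_free :: "complex mat \<Rightarrow> bool" where
  "lower_free Z \<longleftrightarrow> (\<forall>i<d. Z $$ (Suc i, 0) = 0)"

text \<open>
  The projection to the Levi part.  In \<open>m_embed n X + a \<cdot>\<^sub>m H0 n + Y\<close> the entry at \<open>(0, 0)\<close> is \<open>a\<close> and the
  lower right block is \<open>X\<close> minus \<open>a / d\<close> times the identity; the summand \<open>a / d\<close> undoes this.
\<close>

definition levi :: "complex mat \<Rightarrow> complex mat" where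
  "levi Z = mat d d (\<lambda>(i, j). Z $$ (Suc i, Suc j) + (if i = j then Z $$ (0, 0) / of_nat d else 0))"

lemma levi_index:
  "i < d \<Longrightarrow> j < d \<Longrightarrow> levi Z $$ (i, j) = Z $$ (Suc i, Suc j) + (if i = j then Z $$ (0, 0) / of_nat d else 0)"
  by (simp add: levi_def)

lemma levi_dim [simp]: "dim_row (levi Z) = d" "dim_col (levi Z) = d" "levi Z \<in> carrier_mat d d"
  by (simp_all add: levi_def)

lemma H0_index: "i < n \<Longrightarrow> j < n \<Longrightarrow> H0 n $$ (i, j) = (if i = j then if i = 0 then 1 else - 1 / of_nat d else 0)"
  using d_pos by (simp add: H0_def mat_diag_def)

lemma H0_dim [simp]: "dim_row (H0 n) = n" "dim_col (H0 n) = n"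
  by (simp_all add: H0_def mat_diag_def)

lemma m_embed_index:
  assumes "X \<in> carrier_mat d d" "i < n" "j < n"
  shows "m_embed n X $$ (i, j) = (case i of 0 \<Rightarrow> 0 | Suc i \<Rightarrow> (case j of 0 \<Rightarrow> 0 | Suc j \<Rightarrow> X $$ (i, j)))"
  using assms by (auto simp: m_embed_def n_Suc split: nat.splits)

lemma m_embed_dim [simp]: "X \<in> carrier_mat d d \<Longrightarrow> dim_row (m_embed n X) = n \<and> dim_col (m_embed n X) = n"
  by (simp add: m_embed_def n_Suc)

definition top_row :: "complex mat \<Rightarrow> bool" where
  "top_row Y \<longleftrightarrow> Y \<in> carrier_mat n n \<and> Y $$ (0, 0) = 0 \<and> (\<forall>i<d. \<forall>j<n. Y $$ (Suc i, j) = 0)"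

lemma N_plus_index: "i < n \<Longrightarrow> i' < n \<Longrightarrow> N_plus n j $$ (i, i') = (if i = 0 \<and> i' = Suc j then 1 else 0)"
  by (simp add: N_plus_def E_unit_def)

lemma N_minus_index: "i < n \<Longrightarrow> i' < n \<Longrightarrow> N_minus n j $$ (i, i') = (if i = Suc j \<and> i' = 0 then 1 else 0)"
  by (simp add: N_minus_def E_unit_def)

lemma N_dim [simp]: "dim_row (N_plus n j) = n" "dim_col (N_plus n j) = n" "dim_row (N_minus n j) = n" "dim_col (N_minus n j) = n"
  by (simp_all add: N_plus_def N_minus_def E_unit_def)

text \<open>
  For the inclusion from right to left, the entries of the first row are collected column by column.
\<close>

lemma n_plus_iff: "Y \<in> n_plus n \<longleftrightarrow> top_row Y"
proof -
  interpret MV: vectorspace C_ring "module_mat TYPE(complex) n n" by (rule matrix_vs)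
  let ?S = "N_plus n ` {..<n - 1}"
  have S: "?S \<subseteq> carrier (module_mat TYPE(complex) n n)"
    by (auto simp: module_mat_simps intro!: carrier_matI)
  have sub: "LinearCombinations.submodule C_ring {Y. top_row Y} (module_mat TYPE(complex) n n)"
    by (intro LinearCombinations.submodule.intro MV.module_axioms)
       (auto simp: module_mat_simps top_row_def)
  have "n_plus n \<subseteq> {Y. top_row Y}"
    unfolding n_plus_def
    by (rule MV.span_is_subset[OF _ sub]) (auto simp: top_row_def N_plus_index intro!: carrier_matI)
  moreover have "top_row Y \<Longrightarrow> Y \<in> n_plus n"
  proof -
    assume Y: "top_row Y"
    let ?Y = "\<lambda>k. mat n n (\<lambda>(i, j). if i = 0 \<and> j \<noteq> 0 \<and> j \<le> k then Y $$ (0, j) else 0)"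
    interpret sp: LinearCombinations.submodule C_ring "n_plus n" "module_mat TYPE(complex) n n"
      unfolding n_plus_def by (rule MV.span_is_submodule[OF S])
    have "?Y k \<in> n_plus n" if "k \<le> d" for k
      using that
    proof (induction k)
      case 0
      have "?Y 0 = 0\<^sub>m n n" by (rule eq_matI) auto
      then show ?case using sp.zero_closed by (simp add: module_mat_simps)
    next
      case (Suc k)
      have "N_plus n k \<in> n_plus n"
        unfolding n_plus_def using subsetD[OF MV.in_own_span[OF S], of "N_plus n k"] Suc.prems by auto
      then have "Y $$ (0, Suc k) \<cdot>\<^sub>m N_plus n k \<in> n_plus n"
        using sp.smult_closed by (simp add: module_mat_simps)
      then have "?Y k + Y $$ (0, Suc k) \<cdot>\<^sub>m N_plus n k \<in> n_plus n"
        using sp.m_closed Suc by (simp add: module_mat_simps)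
      also have "?Y k + Y $$ (0, Suc k) \<cdot>\<^sub>m N_plus n k = ?Y (Suc k)"
        by (rule eq_matI) (auto simp: N_plus_index le_Suc_eq)
      finally show ?case .
    qed
    from this[of d] have "?Y d \<in> n_plus n" by simp
    also have "?Y d = Y"
      by (rule eq_matI) (use Y in \<open>auto simp: top_row_def elim!: less_n_cases\<close>)
    finally show ?thesis .
  qed
  ultimately show ?thesis by blast
qed

lemma parabolic_decomp:
  assumes "X \<in> sl d" "top_row Y" "Z = m_embed n X + a \<cdot>\<^sub>m H0 n + Y"
  shows "Z \<in> sl n" "lower_free Z" "a = Z $$ (0, 0)" "X = levi Z"
proof -
  have X: "X \<in> carrier_mat d d" using assms by (simp add: sl_def)
  have Y: "Y \<in> carrier_mat n n" "\<And>i j. i < n \<Longrightarrow> j < n \<Longrightarrow> i \<noteq> 0 \<or> j = 0 \<Longrightarrow> Y $$ (i, j) = 0"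
    using assms by (auto simp: top_row_def elim!: less_n_cases)
  note [simp] = m_embed_index[OF X] m_embed_dim[OF X] H0_index carrier_matD[OF Y(1)] Y(2)
  show "lower_free Z" "a = Z $$ (0, 0)" by (simp_all add: assms(3) lower_free_def)
  show "X = levi Z"
    by (rule eq_matI) (use X in \<open>auto simp: levi_index assms\<close>)
  have "(\<Sum>i<n. Z $$ (i, i)) = a + (\<Sum>i<d. X $$ (i, i) - a / of_nat d)"
    by (simp add: sum_less_n assms(3))
  also have "\<dots> = 0" using assms(1) d_pos by (simp add: sl_def sum_subtractf)
  finally have tr: "(\<Sum>i<n. Z $$ (i, i)) = 0" .
  have "Z \<in> carrier_mat n n" by (rule carrier_matI) (simp_all add: assms(3))
  with tr show "Z \<in> sl n" unfolding sl_def by (intro CollectI conjI)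
qed

lemma levi_sl: "Z \<in> sl n \<Longrightarrow> levi Z \<in> sl d"
  using d_pos by (auto simp: sl_def levi_def sum_less_n sum.distrib add.commute)

lemma parabolic_iff: "Z \<in> parabolic n \<longleftrightarrow> Z \<in> sl n \<and> lower_free Z"
proof
  assume "Z \<in> parabolic n"
  then show "Z \<in> sl n \<and> lower_free Z"
    using parabolic_decomp by (auto simp: parabolic_def n_plus_iff)
next
  assume Z: "Z \<in> sl n \<and> lower_free Z"
  let ?Y = "mat n n (\<lambda>(i, j). if i = 0 \<and> j \<noteq> 0 then Z $$ (i, j) else 0)"
  have X: "levi Z \<in> carrier_mat d d" by simp
  note [simp] = m_embed_index[OF X] m_embed_dim[OF X] H0_index
  have "Z = m_embed n (levi Z) + Z $$ (0, 0) \<cdot>\<^sub>m H0 n + ?Y"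
  proof (rule eq_matI)
    fix i j assume "i < dim_row (m_embed n (levi Z) + Z $$ (0, 0) \<cdot>\<^sub>m H0 n + ?Y)"
      "j < dim_col (m_embed n (levi Z) + Z $$ (0, 0) \<cdot>\<^sub>m H0 n + ?Y)"
    then have "i < n" "j < n" by simp_all
    then show "Z $$ (i, j) = (m_embed n (levi Z) + Z $$ (0, 0) \<cdot>\<^sub>m H0 n + ?Y) $$ (i, j)"
      using Z by (elim less_n_cases) (auto simp: levi_index lower_free_def)
  qed (use Z in \<open>auto simp: sl_def\<close>)
  moreover have "top_row ?Y" by (auto simp: top_row_def)
  ultimately show "Z \<in> parabolic n"
    using Z levi_sl unfolding parabolic_def n_plus_iff by auto
qed

lemma parabolic_sub: "parabolic n \<subseteq> sl n"
  by (auto simp: parabolic_iff)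

lemma parabolic_carrier: "Z \<in> parabolic n \<Longrightarrow> Z \<in> carrier_mat n n"
  by (simp add: parabolic_iff sl_def)

lemma parabolic_mult:
  assumes A: "A \<in> parabolic n" and B: "B \<in> parabolic n"
  shows "(A * B) $$ (0, 0) = A $$ (0, 0) * B $$ (0, 0)" "lower_free (A * B)"
    "i < d \<Longrightarrow> j < d \<Longrightarrow> (A * B) $$ (Suc i, Suc j) = (\<Sum>k<d. A $$ (Suc i, Suc k) * B $$ (Suc k, Suc j))"
proof -
  note [simp] = carrier_matD[OF parabolic_carrier[OF A]] carrier_matD[OF parabolic_carrier[OF B]]
  have [simp]: "A $$ (Suc i, 0) = 0" "B $$ (Suc i, 0) = 0" if "i < d" for i
    using A B that by (auto simp: parabolic_iff lower_free_def)
  have *: "(A * B) $$ (i, j) = A $$ (i, 0) * B $$ (0, j) + (\<Sum>k<d. A $$ (i, Suc k) * B $$ (Suc k, j))"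
    if "i < n" "j < n" for i j
    using that by (simp add: scalar_prod_def atLeast0LessThan sum_less_n)
  show "(A * B) $$ (0, 0) = A $$ (0, 0) * B $$ (0, 0)" "lower_free (A * B)"
    "i < d \<Longrightarrow> j < d \<Longrightarrow> (A * B) $$ (Suc i, Suc j) = (\<Sum>k<d. A $$ (Suc i, Suc k) * B $$ (Suc k, Suc j))"
    by (simp_all add: * lower_free_def del: index_mult_mat(1))
qed

lemma bracket_index:
  "A \<in> carrier_mat n n \<Longrightarrow> B \<in> carrier_mat n n \<Longrightarrow> i < n \<Longrightarrow> j < n \<Longrightarrow>
    (A * B - B * A) $$ (i, j) = (A * B) $$ (i, j) - (B * A) $$ (i, j)"
  by simp

lemma parabolic_lie_algebra: "matrix_lie_algebra (parabolic n)"
proof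
  interpret G: matrix_lie_algebra "sl n" by (rule sl_lie_algebra)
  fix A B assume A: "A \<in> parabolic n" and B: "B \<in> parabolic n"
  note c = parabolic_carrier[OF A] parabolic_carrier[OF B]
  note [simp] = carrier_matD[OF c(1)] carrier_matD[OF c(2)]
  show "A + B \<in> parabolic n" using A B G.mat_add_closed by (simp add: parabolic_iff lower_free_def)
  show "c \<cdot>\<^sub>m A \<in> parabolic n" for c using A G.mat_smult_closed by (simp add: parabolic_iff lower_free_def)
  show "A * B - B * A \<in> parabolic n"
    using A B G.mat_bracket_closed parabolic_mult(2)[OF A B] parabolic_mult(2)[OF B A] c
    by (simp add: parabolic_iff lower_free_def bracket_index del: index_minus_mat(1) index_mult_mat(1))
qed

lemma levi_add: "A \<in> carrier_mat n n \<Longrightarrow> B \<in> carrier_mat n n \<Longrightarrow> levi (A + B) = levi A + levi B"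
  by (rule eq_matI) (auto simp: levi_index add_divide_distrib)

lemma levi_smult: "A \<in> carrier_mat n n \<Longrightarrow> levi (c \<cdot>\<^sub>m A) = c \<cdot>\<^sub>m levi A"
  by (rule eq_matI) (auto simp: levi_index distrib_left)

lemma bracket_00:
  assumes A: "A \<in> parabolic n" and B: "B \<in> parabolic n"
  shows "(A * B - B * A) $$ (0, 0) = 0"
  using parabolic_mult(1)[OF A B] parabolic_mult(1)[OF B A] parabolic_carrier[OF A] parabolic_carrier[OF B]
  by (simp add: bracket_index del: index_minus_mat(1) index_mult_mat(1))

text \<open>
  Passing to the lower right block is multiplicative on matrices with vanishing lower left block, and the
  scalar matrices by which \<open>levi\<close> differs from it cancel in a commutator.
\<close>

lemma levi_bracket:
  assumes A: "A \<in> parabolic n" and B: "B \<in> parabolic n"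
  shows "levi (A * B - B * A) = levi A * levi B - levi B * levi A"
proof (rule eq_matI)
  have c: "A \<in> carrier_mat n n" "B \<in> carrier_mat n n" using A B parabolic_carrier by auto
  fix i j assume "i < dim_row (levi A * levi B - levi B * levi A)" "j < dim_col (levi A * levi B - levi B * levi A)"
  then have ij: "i < d" "j < d" by (simp_all add: levi_def)
  note L = levi_index
  have prod: "(levi Z * levi W) $$ (i, j) = (\<Sum>k<d. Z $$ (Suc i, Suc k) * W $$ (Suc k, Suc j))
      + Z $$ (Suc i, Suc j) * (W $$ (0, 0) / of_nat d) + (Z $$ (0, 0) / of_nat d) * levi W $$ (i, j)" for Z W
  proof -
    have "(levi Z * levi W) $$ (i, j) = (\<Sum>k<d. levi Z $$ (i, k) * levi W $$ (k, j))"
      using ij by (simp add: scalar_prod_def atLeast0LessThan)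
    also have "\<dots> = (\<Sum>k<d. Z $$ (Suc i, Suc k) * levi W $$ (k, j))
        + (\<Sum>k<d. if i = k then Z $$ (0, 0) / of_nat d * levi W $$ (k, j) else 0)"
      unfolding sum.distrib[symmetric] by (rule sum.cong) (auto simp: L ij distrib_right)
    also have "(\<Sum>k<d. Z $$ (Suc i, Suc k) * levi W $$ (k, j)) = (\<Sum>k<d. Z $$ (Suc i, Suc k) * W $$ (Suc k, Suc j))
        + (\<Sum>k<d. if k = j then Z $$ (Suc i, Suc k) * (W $$ (0, 0) / of_nat d) else 0)"
      unfolding sum.distrib[symmetric] by (rule sum.cong) (auto simp: L ij distrib_left)
    finally show ?thesis using ij by simp
  qed
  have "(levi A * levi B - levi B * levi A) $$ (i, j) = (levi A * levi B) $$ (i, j) - (levi B * levi A) $$ (i, j)"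
    using ij by (simp add: levi_def)
  also have "\<dots> = (A * B - B * A) $$ (Suc i, Suc j)"
    unfolding prod using ij c
    by (simp add: L bracket_index parabolic_mult(3)[OF A B] parabolic_mult(3)[OF B A] algebra_simps
        del: index_minus_mat(1) index_mult_mat(1))
  also have "\<dots> = levi (A * B - B * A) $$ (i, j)"
    using ij bracket_00[OF A B] by (simp add: L del: index_minus_mat(1))
  finally show "levi (A * B - B * A) $$ (i, j) = (levi A * levi B - levi B * levi A) $$ (i, j)" by (rule sym)
qed (simp_all add: levi_def)

subsection \<open>Modules of the parabolic subalgebra\<close>

lemma parabolic_module_simps [simp]:
  "carrier (parabolic_module n \<sigma> s) = carrier \<sigma>" "add (parabolic_module n \<sigma> s) = add \<sigma>"
  "smult (parabolic_module n \<sigma> s) = smult \<sigma>" "ring.zero (parabolic_module n \<sigma> s) = ring.zero \<sigma>"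
  by (simp_all add: parabolic_module_def)

lemma parabolic_act:
  assumes Z: "Z \<in> parabolic n"
  shows "act (parabolic_module n \<sigma> s) Z w = act \<sigma> (levi Z) w \<oplus>\<^bsub>\<sigma>\<^esub> (Z $$ (0, 0) * s) \<odot>\<^bsub>\<sigma>\<^esub> w"
proof -
  obtain X a Y where dec: "X \<in> sl d" "Y \<in> n_plus n" "Z = m_embed n X + a \<cdot>\<^sub>m H0 n + Y"
    using Z by (auto simp: parabolic_def)
  have "(THE v. \<exists>X\<in>sl d. \<exists>a. \<exists>Y\<in>n_plus n. Z = m_embed n X + a \<cdot>\<^sub>m H0 n + Y \<and> v = act \<sigma> X w \<oplus>\<^bsub>\<sigma>\<^esub> (a * s) \<odot>\<^bsub>\<sigma>\<^esub> w)
      = act \<sigma> (levi Z) w \<oplus>\<^bsub>\<sigma>\<^esub> (Z $$ (0, 0) * s) \<odot>\<^bsub>\<sigma>\<^esub> w"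
  proof (rule the_equality)
    have eq: "a = Z $$ (0, 0)" "X = levi Z"
      using parabolic_decomp(3,4)[OF dec(1) _ dec(3)] dec(2) n_plus_iff by auto
    show "\<exists>X\<in>sl d. \<exists>a. \<exists>Y\<in>n_plus n. Z = m_embed n X + a \<cdot>\<^sub>m H0 n + Y
        \<and> act \<sigma> (levi Z) w \<oplus>\<^bsub>\<sigma>\<^esub> (Z $$ (0, 0) * s) \<odot>\<^bsub>\<sigma>\<^esub> w = act \<sigma> X w \<oplus>\<^bsub>\<sigma>\<^esub> (a * s) \<odot>\<^bsub>\<sigma>\<^esub> w"
      by (intro bexI[of _ X] exI[of _ a] bexI[of _ Y] conjI dec) (simp only: eq[symmetric])
  next
    fix v assume "\<exists>X\<in>sl d. \<exists>a. \<exists>Y\<in>n_plus n. Z = m_embed n X + a \<cdot>\<^sub>m H0 n + Y \<and> v = act \<sigma> X w \<oplus>\<^bsub>\<sigma>\<^esub> (a * s) \<odot>\<^bsub>\<sigma>\<^esub> w"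
    then obtain X a Y where dec: "X \<in> sl d" "Y \<in> n_plus n" "Z = m_embed n X + a \<cdot>\<^sub>m H0 n + Y"
      and v: "v = act \<sigma> X w \<oplus>\<^bsub>\<sigma>\<^esub> (a * s) \<odot>\<^bsub>\<sigma>\<^esub> w" by blast
    have "a = Z $$ (0, 0)" "X = levi Z"
      using parabolic_decomp(3,4)[OF dec(1) _ dec(3)] dec(2) n_plus_iff by auto
    with v show "v = act \<sigma> (levi Z) w \<oplus>\<^bsub>\<sigma>\<^esub> (Z $$ (0, 0) * s) \<odot>\<^bsub>\<sigma>\<^esub> w" by simp
  qed
  then show ?thesis by (simp add: parabolic_module_def)
qed

lemma parabolic_module_vectorspace:
  assumes "lie_rep (sl d) \<sigma>"
  shows "vectorspace C_ring (parabolic_module n \<sigma> s)"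
proof -
  interpret \<sigma>: lie_representation "sl d" \<sigma> using assms by unfold_locales
  have "Module.module C_ring (parabolic_module n \<sigma> s)"
  proof (rule moduleI)
    show "cring (C_ring :: complex ring)" ..
    show "abelian_group (parabolic_module n \<sigma> s)"
      by (rule abelian_groupI)
         (use \<sigma>.M.add.l_inv_ex in \<open>auto simp: \<sigma>.M.a_ac\<close>)
  qed (simp_all add: \<sigma>.scalar_add_left \<sigma>.scalar_add_right \<sigma>.scalar_mult)
  then show ?thesis by (intro vectorspace.intro class_field)
qed

lemma parabolic_module_rep:
  assumes "lie_rep (sl d) \<sigma>"
  shows "lie_rep (parabolic n) (parabolic_module n \<sigma> s)"
  unfolding lie_rep_def
proof (intro conjI ballI allI)
  interpret \<sigma>: lie_representation "sl d" \<sigma> using assms by unfold_locales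
  interpret P: matrix_lie_algebra "parabolic n" by (rule parabolic_lie_algebra)
  let ?V = "parabolic_module n \<sigma> s"
  show vs: "vectorspace C_ring ?V" by (rule parabolic_module_vectorspace[OF assms])
  have minus: "x \<ominus>\<^bsub>?V\<^esub> y = x \<ominus>\<^bsub>\<sigma>\<^esub> y" for x y
    by (simp add: a_minus_def a_inv_def m_inv_def)
  note [simp] = parabolic_act
  fix A assume A: "A \<in> parabolic n"
  have lA: "levi A \<in> sl d" and cA: "A \<in> carrier_mat n n" using A levi_sl parabolic_sub sl_carrier by auto
  note [simp] = lA cA
  show "act ?V A \<in> LinearCombinations.module_hom C_ring ?V ?V"
    using A by (auto simp: LinearCombinations.module_hom_def \<sigma>.act_plus \<sigma>.scalar_add_right \<sigma>.act_scalar
        \<sigma>.scalar_mult \<sigma>.M.a_ac mult.commute)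
  fix v assume "v \<in> carrier ?V"
  then have v [simp]: "v \<in> carrier \<sigma>" by simp
  show "act ?V (c \<cdot>\<^sub>m A) v = c \<odot>\<^bsub>?V\<^esub> act ?V A v" for c
    using A carrier_matD[OF cA]
    by (simp add: P.mat_smult_closed levi_smult \<sigma>.act_smult \<sigma>.scalar_add_right \<sigma>.scalar_mult mult.assoc)
  fix B assume B: "B \<in> parabolic n"
  have lB: "levi B \<in> sl d" and cB: "B \<in> carrier_mat n n" using B levi_sl parabolic_sub sl_carrier by auto
  note [simp] = lB cB
  show "act ?V (A + B) v = act ?V A v \<oplus>\<^bsub>?V\<^esub> act ?V B v"
    using A B carrier_matD[OF cB]
    by (simp add: P.mat_add_closed levi_add \<sigma>.act_add distrib_right \<sigma>.scalar_add_left \<sigma>.M.a_ac)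
  let ?a = "A $$ (0, 0) * s" and ?b = "B $$ (0, 0) * s"
  let ?X = "act \<sigma> (levi A)" and ?Y = "act \<sigma> (levi B)"
  have cancel: "(x \<oplus>\<^bsub>\<sigma>\<^esub> z) \<ominus>\<^bsub>\<sigma>\<^esub> (y \<oplus>\<^bsub>\<sigma>\<^esub> z) = x \<ominus>\<^bsub>\<sigma>\<^esub> y" if "x \<in> carrier \<sigma>" "y \<in> carrier \<sigma>" "z \<in> carrier \<sigma>" for x y z
  proof -
    have "(x \<oplus>\<^bsub>\<sigma>\<^esub> z) \<ominus>\<^bsub>\<sigma>\<^esub> (y \<oplus>\<^bsub>\<sigma>\<^esub> z) = x \<oplus>\<^bsub>\<sigma>\<^esub> (z \<oplus>\<^bsub>\<sigma>\<^esub> (\<ominus>\<^bsub>\<sigma>\<^esub> z \<oplus>\<^bsub>\<sigma>\<^esub> \<ominus>\<^bsub>\<sigma>\<^esub> y))"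
      using that by (simp add: \<sigma>.M.minus_eq \<sigma>.M.minus_add \<sigma>.M.a_ac)
    then show ?thesis using that by (simp only: \<sigma>.M.r_neg2 \<sigma>.M.a_inv_closed \<sigma>.M.minus_eq)
  qed
  have "act ?V A (act ?V B v) = ?X (?Y v) \<oplus>\<^bsub>\<sigma>\<^esub> (?b \<odot>\<^bsub>\<sigma>\<^esub> ?X v \<oplus>\<^bsub>\<sigma>\<^esub> (?a \<odot>\<^bsub>\<sigma>\<^esub> ?Y v \<oplus>\<^bsub>\<sigma>\<^esub> (?a * ?b) \<odot>\<^bsub>\<sigma>\<^esub> v))"
    using A B by (simp add: \<sigma>.act_plus \<sigma>.scalar_add_right \<sigma>.act_scalar \<sigma>.scalar_mult \<sigma>.M.a_assoc)
  moreover have "act ?V B (act ?V A v) = ?Y (?X v) \<oplus>\<^bsub>\<sigma>\<^esub> (?b \<odot>\<^bsub>\<sigma>\<^esub> ?X v \<oplus>\<^bsub>\<sigma>\<^esub> (?a \<odot>\<^bsub>\<sigma>\<^esub> ?Y v \<oplus>\<^bsub>\<sigma>\<^esub> (?a * ?b) \<odot>\<^bsub>\<sigma>\<^esub> v))"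
    using A B by (simp add: \<sigma>.act_plus \<sigma>.scalar_add_right \<sigma>.act_scalar \<sigma>.scalar_mult \<sigma>.M.a_ac mult.commute mult.left_commute)
  ultimately have "act ?V A (act ?V B v) \<ominus>\<^bsub>?V\<^esub> act ?V B (act ?V A v) = ?X (?Y v) \<ominus>\<^bsub>\<sigma>\<^esub> ?Y (?X v)"
    unfolding minus by (simp add: cancel)
  also have "\<dots> = act ?V (A * B - B * A) v"
    using A B P.mat_bracket_closed[OF A B] bracket_00[OF A B] \<sigma>.act_bracket[OF lA lB v]
    by (simp add: levi_bracket del: index_minus_mat(1))
  finally show "act ?V (A * B - B * A) v = act ?V A (act ?V B v) \<ominus>\<^bsub>?V\<^esub> act ?V B (act ?V A v)" by (rule sym)
qed

section \<open>The action of the special linear Lie algebra on polynomials\<close>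

text \<open>
  The variable \<open>x\<^sub>i\<close> stands for \<open>N_minus n i\<close>.
\<close>

definition pol :: "complex \<Rightarrow> cpoly lie_module" where
  "pol s = poly_space (poly_in d) (pol_op.mat_op s n)"

lemma pol_simps [simp]:
  "carrier (pol s) = poly_in d" "\<zero>\<^bsub>pol s\<^esub> = 0" "p \<oplus>\<^bsub>pol s\<^esub> q = p + q"
  "c \<odot>\<^bsub>pol s\<^esub> p = cst c * p" "act (pol s) = pol_op.mat_op s n"
  by (simp_all add: pol_def)

lemma pol_expand:
  "pol_op.mat_op s n A p = cst (A $$ (0, 0)) * Hop s p
    + (\<Sum>j<d. cst (A $$ (0, Suc j)) * Hop s (Dop j p))
    + (\<Sum>i<d. cst (A $$ (Suc i, 0)) * Xop i p)
    + (\<Sum>i<d. \<Sum>j<d. cst (A $$ (Suc i, Suc j)) * Xop i (Dop j p))"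
  unfolding pol_op.mat_op_def by (simp add: sum_less_n raise_op_def lower_op_def sum.distrib)

lemma pol_rep: "lie_rep (sl n) (pol s)"
  unfolding pol_def
proof (rule poly_space_lie_rep)
  show "pol_op.mat_op s n A p \<in> poly_in d" if "p \<in> poly_in d" for A p
    unfolding pol_expand using that by (intro poly_in_closed poly_in_sum poly_in_ops) auto
qed (auto simp: poly_in_closed pol_op.mat_op_plus pol_op.mat_op_cst pol_op.mat_op_add pol_op.mat_op_smult
    pol_op.mat_op_bracket sl_carrier)

lemma lookup_Euler:
  assumes "mono_in d m"
  shows "lookup (\<Sum>i<d. Xop i (Dop i p)) m = of_nat (mdeg m) * lookup p m"
proof -
  have "lookup (Xop i (Dop i p)) m = of_nat (lookup m i) * lookup p m" for i
    by (auto simp: minus_var_cancel lookup_minus of_nat_diff)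
  moreover have "mdeg m = (\<Sum>i<d. lookup m i)"
    by (rule mdeg_over) (use assms in \<open>auto simp: mono_in_keys\<close>)
  ultimately show ?thesis by (simp add: lookup_sum sum_distrib_right del: lookup_Xop lookup_Dop)
qed

lemma Euler_homog:
  assumes "p \<in> homog d k"
  shows "(\<Sum>i<d. Xop i (Dop i p)) = cst (of_nat k) * p"
proof (rule poly_mapping_eqI)
  have E: "(\<Sum>i<d. Xop i (Dop i p)) \<in> homog d k"
    by (intro homog_sum homog_ops assms) simp
  fix m show "lookup (\<Sum>i<d. Xop i (Dop i p)) m = lookup (cst (of_nat k) * p) m"
  proof (cases "mono_in d m \<and> mdeg m = k")
    case True
    then show ?thesis using lookup_Euler[of m p] by (simp del: single_of_nat)
  next
    case False
    then show ?thesis using E assms unfolding homog_def by (metis (mono_tags, lifting) lookup_cst_mult mem_Collect_eq mult_zero_right)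
  qed
qed

lemma Hop_homog: "p \<in> homog d k \<Longrightarrow> Hop s p = cst (s - of_nat k) * p"
  by (rule poly_mapping_eqI) (auto simp: homog_def)

text \<open>
  In degree \<open>k\<close> the operator \<open>s - Eu\<close> is \<open>s - k\<close>, and the multiple of the identity that \<open>levi\<close> adds
  contributes a multiple of \<open>Eu = k\<close>, which accounts for the term \<open>k / d\<close>.  The last sum is the action of
  the nilradical.
\<close>

lemma pol_parabolic:
  assumes Z: "Z \<in> parabolic n" and p: "p \<in> homog d k"
  shows "pol_op.mat_op s n Z p = sym_op.mat_op d (levi Z) p
      + cst (Z $$ (0, 0) * (s - of_nat k - of_nat k / of_nat d)) * p
      + (\<Sum>j<d. cst (Z $$ (0, Suc j)) * Hop s (Dop j p))"
proof -
  have "sym_op.mat_op d (levi Z) p =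
      (\<Sum>i<d. \<Sum>j<d. cst (Z $$ (Suc i, Suc j)) * Xop i (Dop j p)
        + (if j = i then cst (Z $$ (0, 0) / of_nat d) * Xop i (Dop j p) else 0))"
    unfolding sym_op.mat_op_def by (intro sum.cong refl) (auto simp: levi_def cst_simps distrib_right)
  also have "\<dots> = (\<Sum>i<d. \<Sum>j<d. cst (Z $$ (Suc i, Suc j)) * Xop i (Dop j p))
      + cst (Z $$ (0, 0) / of_nat d) * (\<Sum>i<d. Xop i (Dop i p))"
    by (simp add: sum.distrib sum_distrib_left)
  finally have L: "sym_op.mat_op d (levi Z) p = (\<Sum>i<d. \<Sum>j<d. cst (Z $$ (Suc i, Suc j)) * Xop i (Dop j p))
      + cst (Z $$ (0, 0) / of_nat d * of_nat k) * p"
    by (simp only: Euler_homog[OF p] cst_simps(2) mult.assoc)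
  have 0: "(\<Sum>i<d. cst (Z $$ (Suc i, 0)) * Xop i p) = 0"
    using Z by (intro sum.neutral) (auto simp: parabolic_iff lower_free_def)
  have c: "cst (Z $$ (0, 0)) * cst (s - of_nat k) =
      cst (Z $$ (0, 0) / of_nat d * of_nat k) + cst (Z $$ (0, 0) * (s - of_nat k - of_nat k / of_nat d))"
    unfolding cst_simps(1,2)[symmetric] by (rule arg_cong[where f = cst]) (simp add: algebra_simps)
  show ?thesis unfolding pol_expand L 0 Hop_homog[OF p] mult.assoc[symmetric] c by (simp add: distrib_right)
qed

end

section \<open>The scalar generalized Verma module\<close>

lemma triv_simps [simp]:
  "carrier triv = UNIV" "\<zero>\<^bsub>triv\<^esub> = 0" "x \<oplus>\<^bsub>triv\<^esub> y = x + y" "c \<odot>\<^bsub>triv\<^esub> x = c * x" "act triv A x = 0"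
  by (simp_all add: triv_def)

lemma triv_rep: "lie_rep L triv"
proof -
  have ab: "abelian_group triv"
    by (rule abelian_groupI) (auto intro!: exI[of _ "- _"])
  have mod: "Module.module C_ring triv"
  proof (rule moduleI)
    show "cring (C_ring :: complex ring)" ..
  qed (simp_all add: ab distrib_left distrib_right)
  interpret V: Module.module C_ring triv by (rule mod)
  have "0 \<ominus>\<^bsub>triv\<^esub> 0 = (0 :: complex)" using V.M.r_neg[of 0] by (simp add: a_minus_def)
  then show ?thesis unfolding lie_rep_def
    using vectorspace.intro[OF mod class_field] by (simp add: LinearCombinations.module_hom_def)
qed

lemma intertwiner_mono: "intertwiner L V W f \<Longrightarrow> K \<subseteq> L \<Longrightarrow> intertwiner K V W f"
  by (auto simp: intertwiner_def)

lemma poly_mapping_single_induct [case_names single add]: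
  fixes p :: "'a \<Rightarrow>\<^sub>0 'b::comm_monoid_add"
  assumes single: "\<And>m c. P (Poly_Mapping.single m c)" and add: "\<And>p q. P p \<Longrightarrow> P q \<Longrightarrow> P (p + q)"
  shows "P p"
proof -
  have "P (\<Sum>m\<in>A. Poly_Mapping.single m (lookup p m))" if "finite A" for A
    using that by (induction A) (use single[of undefined 0] in \<open>auto intro: single add\<close>)
  then show ?thesis using free_poly_expand[of p] by (metis finite_keys)
qed

lemma poly_in_induct [consumes 1, case_names one var cst add]:
  assumes p: "p \<in> poly_in d"
    and one: "P 1"
    and var: "\<And>i p. i < d \<Longrightarrow> p \<in> poly_in d \<Longrightarrow> P p \<Longrightarrow> P (Xop i p)"
    and cst: "\<And>c p. p \<in> poly_in d \<Longrightarrow> P p \<Longrightarrow> P (cst c * p)"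
    and add: "\<And>p q. p \<in> poly_in d \<Longrightarrow> q \<in> poly_in d \<Longrightarrow> P p \<Longrightarrow> P q \<Longrightarrow> P (p + q)"
  shows "P p"
proof -
  have single_in: "Poly_Mapping.single m c \<in> poly_in d" if "mono_in d m" for m c
    using that by (auto simp: poly_in_def lookup_single when_def)
  have mon: "P (Poly_Mapping.single m 1)" if "mono_in d m" "mdeg m = N" for m N
    using that
  proof (induction N arbitrary: m)
    case 0
    then show ?case using one by (simp add: mdeg_zero_iff)
  next
    case (Suc N)
    obtain i where i: "lookup m i > 0"
      using Suc.prems(2) by (metis gr0I mdeg_zero_iff nat.distinct(1) poly_mapping_eqI lookup_zero)
    then have "i < d" using Suc.prems(1) by (auto simp: mono_in_def not_less[symmetric])
    have m: "m - var i + var i = m" by (rule minus_var_cancel[OF i])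
    then have "mono_in d (m - var i)" "mdeg (m - var i) = N"
      using Suc.prems mono_in_plus[of d "m - var i" i] mdeg_minus_var[OF i] by auto
    then have "P (Xop i (Poly_Mapping.single (m - var i) 1))"
      using Suc.IH single_in var \<open>i < d\<close> by blast
    then show ?case by (simp add: Xop_single m)
  qed
  have monom: "P (Poly_Mapping.single m c)" if "mono_in d m" for m c
    using cst[OF single_in mon, of m "mdeg m" c] that by (simp add: mult_single)
  have "A \<subseteq> keys p \<Longrightarrow> P (\<Sum>m\<in>A. Poly_Mapping.single m (lookup p m))
      \<and> (\<Sum>m\<in>A. Poly_Mapping.single m (lookup p m)) \<in> poly_in d" if "finite A" for A
    using that
  proof (induction A)
    case empty
    then show ?case using monom[of 0 0] by (simp add: poly_in_closed mono_in_def)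
  next
    case (insert m A)
    then have "mono_in d m" using p by (auto simp: poly_in_def in_keys_iff)
    then show ?case using insert monom add single_in by (simp add: poly_in_closed)
  qed
  from this[of "keys p"] show ?thesis using free_poly_expand[of p] by simp
qed

context maximal_parabolic
begin

lemma verma_induced_rep:
  assumes "lie_rep (sl d) \<sigma>"
  shows "induced_rep (sl n) (parabolic n) (parabolic_module n \<sigma> r)"
  using sl_lie_algebra[of n] parabolic_lie_algebra parabolic_module_rep[OF assms, of r] parabolic_sub
  by (simp add: induced_rep_def induced_rep_axioms_def lie_algebra_rep_def lie_representation_def)

lemma parabolic_intertwiner:
  assumes \<sigma>: "lie_rep (sl d) \<sigma>" and f: "intertwiner (sl d) \<sigma> \<tau> f"
  shows "intertwiner (parabolic n) (parabolic_module n \<sigma> r) (parabolic_module n \<tau> r) f"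
proof -
  interpret \<sigma>: lie_representation "sl d" \<sigma> using \<sigma> by unfold_locales
  note D = intertwinerD[OF f]
  show ?thesis
    by (rule intertwinerI) (use levi_sl parabolic_sub in \<open>auto simp: parabolic_act D subset_iff\<close>)
qed

lemma N_minus_sl: "j < d \<Longrightarrow> N_minus n j \<in> sl n"
  unfolding N_minus_def by (rule E_unit_sl) auto

lemma pol_N_minus: "i < d \<Longrightarrow> pol_op.mat_op s n (N_minus n i) p = Xop i p"
  unfolding N_minus_def by (subst pol_op.mat_op_unit) (simp_all add: raise_op_def lower_op_def)

text \<open>
  A matrix is brought into the parabolic subalgebra by removing the entries of its first column below the
  diagonal one at a time.
\<close>

lemma sl_parabolic_induct [consumes 1, case_names par low add]:
  assumes A: "A \<in> sl n"
    and par: "\<And>Z. Z \<in> parabolic n \<Longrightarrow> P Z"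
    and low: "\<And>c i. i < d \<Longrightarrow> P (c \<cdot>\<^sub>m N_minus n i)"
    and add: "\<And>A B. A \<in> sl n \<Longrightarrow> B \<in> sl n \<Longrightarrow> P A \<Longrightarrow> P B \<Longrightarrow> P (A + B)"
  shows "P A"
proof -
  interpret G: matrix_lie_algebra "sl n" by (rule sl_lie_algebra)
  \<comment> \<open>at most the first \<open>k\<close> entries below the diagonal of the first column are nonzero\<close>
  have "P A" if "A \<in> sl n" "k \<le> d" "\<And>i. k \<le> i \<Longrightarrow> i < d \<Longrightarrow> A $$ (Suc i, 0) = 0" for A k
    using that
  proof (induction k arbitrary: A)
    case 0
    then show ?case by (intro par) (simp add: parabolic_iff lower_free_def)
  next
    case (Suc k)
    let ?c = "A $$ (Suc k, 0)"
    let ?B = "A + (- ?c) \<cdot>\<^sub>m N_minus n k"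
    have k: "k < d" using Suc.prems by simp
    note [simp] = carrier_matD[OF sl_carrier[OF Suc.prems(1)]]
    have B: "?B \<in> sl n" by (intro G.mat_add_closed G.mat_smult_closed N_minus_sl Suc.prems k)
    have PB: "P ?B"
    proof (rule Suc.IH[OF B])
      fix i assume i: "k \<le> i" "i < d"
      then show "?B $$ (Suc i, 0) = 0"
        using Suc.prems(3)[of i] by (cases "i = k") (simp_all add: N_minus_index)
    qed (use k in simp)
    have "P (?B + ?c \<cdot>\<^sub>m N_minus n k)"
      by (rule add[OF B _ PB low[OF k]]) (intro G.mat_smult_closed N_minus_sl k)
    also have "?B + ?c \<cdot>\<^sub>m N_minus n k = A" by (rule eq_matI) auto
    finally show ?case .
  qed
  from this[of A d] show ?thesis using A by simp
qed

lemma cst_homog: "cst c \<in> homog d 0"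
  by (auto simp: homog_def lookup_single when_def mono_in_def mdeg_def)

lemma cst_ops: "Dop j (cst c) = 0" "sym_op.mat_op d X (cst c) = 0"
  by (simp_all add: sym_op.mat_op_def Dop_single op_linear)

lemma cst_intertwines: "intertwiner (parabolic n) (parabolic_module n triv s) (pol s) cst"
proof (rule intertwinerI)
  fix Z v assume Z: "Z \<in> parabolic n"
  show "cst (act (parabolic_module n triv s) Z v) = act (pol s) Z (cst v)"
    using pol_parabolic[OF Z cst_homog, of s v] Z
    by (simp add: parabolic_act cst_ops op_linear mult_single)
qed (auto simp: homog_poly_in[OF cst_homog] single_add mult_single)

end

locale scalar_verma = maximal_parabolic +
  fixes s :: complex

sublocale scalar_verma \<subseteq> I: induced_rep "sl n" "parabolic n" "parabolic_module n triv s"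
  by (rule verma_induced_rep[OF triv_rep])

context scalar_verma
begin

abbreviation hw where "hw \<equiv> I.T \<one>\<^bsub>I.U\<^esub> 1"

definition word :: "(nat \<Rightarrow>\<^sub>0 nat) \<Rightarrow> complex mat list" where
  "word m = concat (map (\<lambda>j. replicate (lookup m j) (N_minus n j)) [0..<d])"

definition vec :: "(nat \<Rightarrow>\<^sub>0 nat) \<Rightarrow> complex pair_sum set" where
  "vec m = foldr (act I.M) (word m) hw"

text \<open>
  For \<open>s = k - 1\<close> this is \<open>phi_sym n k\<close>; the definition for every \<open>s\<close> serves to identify the module with
  the space of all polynomials.
\<close>

definition psi :: "cpoly \<Rightarrow> complex pair_sum set" where
  "psi = I.M.linear_ext vec"

lemma hw_closed [simp]: "hw \<in> carrier I.M"
  by simp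

lemma T_scalar: "I.T \<one>\<^bsub>I.U\<^esub> c = c \<odot>\<^bsub>I.M\<^esub> hw"
  using intertwiner_scalar[OF I.T_one_intertwines, of 1 c] by simp

lemma word_sl: "set (word m) \<subseteq> sl n"
  using N_minus_sl by (auto simp: word_def)

lemma vec_closed [simp]: "vec m \<in> carrier I.M"
  unfolding vec_def by (rule I.M.word_act_closed[OF word_sl hw_closed])

lemma tensor_monomial: "Verma_tensor n triv s (N_minus_monomial n m) 1 = vec m"
proof -
  have f: "Poly_Mapping.single (Word (word m)) 1 \<in> carrier (free_alg (sl n))"
    using word_sl by (simp add: free_alg_single)
  have "Verma_tensor n triv s (N_minus_monomial n m) 1 = I.T (uea_class (sl n) (Poly_Mapping.single (Word (word m)) 1)) 1"
    by (simp add: Verma_tensor_def N_minus_monomial_def word_def)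
  also have "\<dots> = uea_act I.M (uea_class (sl n) (Poly_Mapping.single (Word (word m)) 1)) hw"
    by (rule I.T_uea_act) (simp_all add: I.L.uea_class_closed[OF f])
  also have "\<dots> = vec m"
    using word_sl by (simp add: I.M.uea_act_class[OF f] I.M.free_act_single vec_def)
  finally show ?thesis .
qed

text \<open>
  The products of the matrices \<open>N_minus n i\<close> with each other vanish, hence so do their brackets.
\<close>

lemma N_minus_commute:
  assumes "i < d" "j < d" "x \<in> carrier I.M"
  shows "act I.M (N_minus n i) (act I.M (N_minus n j) x) = act I.M (N_minus n j) (act I.M (N_minus n i) x)"
proof -
  have mult: "N_minus n i * N_minus n j = 0\<^sub>m n n" for i j
    by (rule eq_matI)
       (auto simp: scalar_prod_def N_minus_index intro!: sum.neutral)
  have "N_minus n i * N_minus n j - N_minus n j * N_minus n i = 0 \<cdot>\<^sub>m N_minus n i"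
    unfolding mult by (rule eq_matI) auto
  then have "act I.M (N_minus n i) (act I.M (N_minus n j) x) \<ominus>\<^bsub>I.M\<^esub> act I.M (N_minus n j) (act I.M (N_minus n i) x) = \<zero>\<^bsub>I.M\<^esub>"
    using assms I.M.act_bracket[of "N_minus n i" "N_minus n j" x]
    by (simp add: N_minus_sl I.M.act_smult)
  then show ?thesis using assms by (simp add: N_minus_sl)
qed

lemma N_minus_word_commute:
  assumes "i < d" "set ws \<subseteq> N_minus n ` {..<d}" "x \<in> carrier I.M"
  shows "act I.M (N_minus n i) (foldr (act I.M) ws x) = foldr (act I.M) ws (act I.M (N_minus n i) x)"
  using assms(2)
proof (induction ws)
  case (Cons A ws)
  then obtain j where "j < d" "A = N_minus n j" by auto
  moreover have "set ws \<subseteq> sl n" using Cons.prems N_minus_sl by auto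
  ultimately show ?case
    using Cons assms N_minus_commute[of i j "foldr (act I.M) ws x"] by simp
qed simp

text \<open>
  The word of \<open>m + var i\<close> has one more letter \<open>N_minus n i\<close> in the \<open>i\<close>-th block, which can be moved to the
  front across the preceding blocks.
\<close>

lemma vec_add_var:
  assumes i: "i < d"
  shows "vec (m + var i) = act I.M (N_minus n i) (vec m)"
proof -
  let ?f = "\<lambda>m j. replicate (lookup m j) (N_minus n j)"
  have split: "[0..<d] = [0..<i] @ i # [Suc i..<d]"
    using i using upt_add_eq_append[of 0 i "d - i"] upt_conv_Cons[of i d] by simp
  have eq: "map (?f (m + var i)) [0..<i] = map (?f m) [0..<i]"
    "map (?f (m + var i)) [Suc i..<d] = map (?f m) [Suc i..<d]"
    by (auto simp: lookup_add)
  let ?w1 = "concat (map (?f m) [0..<i])" and ?w2 = "concat (map (?f m) [Suc i..<d])"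
  have w: "word m = ?w1 @ ?f m i @ ?w2"
    by (simp add: word_def split)
  have "word (m + var i) = ?w1 @ ?f (m + var i) i @ ?w2"
    unfolding word_def split map_append list.map concat_append concat.simps eq ..
  then have w': "word (m + var i) = ?w1 @ N_minus n i # ?f m i @ ?w2"
    by (simp add: lookup_add)
  have "set ?w1 \<subseteq> N_minus n ` {..<d}" using i by auto
  moreover have "set (?f m i @ ?w2) \<subseteq> sl n" using word_sl[of m] w by auto
  then have "foldr (act I.M) (?f m i @ ?w2) hw \<in> carrier I.M"
    by (rule I.M.word_act_closed[OF _ hw_closed])
  ultimately have "act I.M (N_minus n i) (foldr (act I.M) ?w1 (foldr (act I.M) (?f m i @ ?w2) hw)) =
      foldr (act I.M) ?w1 (act I.M (N_minus n i) (foldr (act I.M) (?f m i @ ?w2) hw))"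
    by (rule N_minus_word_commute[OF i])
  then show ?thesis
    unfolding vec_def w w' by (simp only: foldr_append foldr_Cons comp_def)
qed

lemma psi_closed [simp]: "psi p \<in> carrier I.M"
  unfolding psi_def by (rule I.M.linear_ext_closed) simp

lemma psi_add: "psi (p + q) = psi p \<oplus>\<^bsub>I.M\<^esub> psi q"
  unfolding psi_def by (rule I.M.linear_ext_add) simp

lemma psi_single: "psi (Poly_Mapping.single m c) = c \<odot>\<^bsub>I.M\<^esub> vec m"
  unfolding psi_def by (rule I.M.linear_ext_single[of vec, OF vec_closed])

lemma psi_cst: "psi (cst c) = c \<odot>\<^bsub>I.M\<^esub> hw"
proof -
  have "word 0 = []" by (simp add: word_def concat_eq_Nil_conv)
  then show ?thesis by (simp add: psi_single vec_def)
qed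

lemma psi_scalar: "psi (cst c * p) = c \<odot>\<^bsub>I.M\<^esub> psi p"
proof (induction p rule: poly_mapping_single_induct)
  case (single m a)
  then show ?case by (simp add: mult_single psi_single I.M.scalar_mult)
next
  case (add p q)
  then show ?case by (simp add: distrib_left psi_add I.M.scalar_add_right)
qed

lemma psi_Xop: "i < d \<Longrightarrow> psi (Xop i p) = act I.M (N_minus n i) (psi p)"
proof (induction p rule: poly_mapping_single_induct)
  case (single m a)
  then show ?case by (simp add: Xop_single psi_single vec_add_var I.M.act_scalar N_minus_sl)
next
  case (add p q)
  then show ?case by (simp add: op_linear psi_add I.M.act_plus N_minus_sl)
qed

text \<open>
  On the generator, a matrix of the parabolic subalgebra acts by a scalar on both sides, and an
  \<open>N_minus\<close> acts through \<open>psi_Xop\<close>.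
\<close>

lemma psi_act_one:
  assumes "A \<in> sl n"
  shows "psi (pol_op.mat_op s n A 1) = act I.M A hw"
  using assms
proof (induction rule: sl_parabolic_induct)
  case (par Z)
  have "psi (pol_op.mat_op s n Z (cst 1)) = psi (cst (Z $$ (0, 0) * s))"
    using intertwiner_act[OF cst_intertwines par, of 1 s] by (simp add: parabolic_act par)
  also have "\<dots> = I.T \<one>\<^bsub>I.U\<^esub> (act (parabolic_module n triv s) Z 1)"
    using par by (simp add: psi_cst T_scalar[of "Z $$ (0, 0) * s"] parabolic_act)
  also have "\<dots> = act I.M Z hw"
    using intertwiner_act[OF I.T_one_intertwines par, of 1] by simp
  finally show ?case by simp
next
  case (low c i)
  have "psi (pol_op.mat_op s n (c \<cdot>\<^sub>m N_minus n i) 1) = c \<odot>\<^bsub>I.M\<^esub> psi (Xop i 1)"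
    using low by (simp add: pol_op.mat_op_smult sl_carrier N_minus_sl psi_scalar pol_N_minus)
  also have "\<dots> = act I.M (c \<cdot>\<^sub>m N_minus n i) hw"
    using low psi_cst[of 1] by (simp add: psi_Xop I.M.act_smult N_minus_sl)
  finally show ?case .
next
  case (add A B)
  then show ?case
    by (simp add: pol_op.mat_op_add sl_carrier psi_add I.M.act_add)
qed

text \<open>
  The action on a product \<open>x\<^sub>i p\<close> reduces to the action on \<open>p\<close> by \<open>A N = [A, N] + N A\<close> with
  \<open>N = N_minus n i\<close>, an identity that holds in both modules; so the action on monomials never has to be
  computed in the induced module.
\<close>

lemma psi_act:
  assumes "p \<in> poly_in d" "A \<in> sl n"
  shows "psi (pol_op.mat_op s n A p) = act I.M A (psi p)"
  using assms
proof (induction arbitrary: A rule: poly_in_induct)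
  case one
  then show ?case using psi_act_one psi_cst[of 1] by simp
next
  case (var i p)
  let ?N = "N_minus n i"
  have N: "?N \<in> sl n" using var N_minus_sl by simp
  have br: "A * ?N - ?N * A \<in> sl n" using var.prems N by (rule I.L.mat_bracket_closed)
  have "pol_op.mat_op s n A (Xop i p) =
      pol_op.mat_op s n (A * ?N - ?N * A) p + Xop i (pol_op.mat_op s n A p)"
    using pol_op.mat_op_bracket[OF sl_carrier[OF var.prems] sl_carrier[OF N], of s p] var.hyps
    by (simp add: pol_N_minus)
  then have "psi (pol_op.mat_op s n A (Xop i p)) =
      act I.M (A * ?N - ?N * A) (psi p) \<oplus>\<^bsub>I.M\<^esub> act I.M ?N (act I.M A (psi p))"
    using var br by (simp add: psi_add psi_Xop)
  also have "\<dots> = act I.M A (act I.M ?N (psi p))"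
    using var.prems N by (simp add: I.M.act_bracket I.M.minus_eq I.M.a_assoc I.M.l_neg)
  finally show ?case using var.hyps by (simp add: psi_Xop)
next
  case (cst c p)
  then show ?case by (simp add: pol_op.mat_op_cst psi_scalar I.M.act_scalar)
next
  case (add p q)
  then show ?case by (simp add: pol_op.mat_op_plus psi_add I.M.act_plus)
qed

lemma psi_intertwines: "intertwiner (sl n) (pol s) I.M psi"
  by (rule intertwinerI) (simp_all add: psi_add psi_scalar psi_act)

definition pi_map :: "complex pair_sum set \<Rightarrow> cpoly" where
  "pi_map = induced_map (sl n) (parabolic n) (parabolic_module n triv s) (pol s) cst"

lemma pi_intertwines: "intertwiner (sl n) I.M (pol s) pi_map"
  unfolding pi_map_def by (rule I.induced_map(1)[OF pol_rep cst_intertwines])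

lemma pi_tensor: "pi_map (I.T \<one>\<^bsub>I.U\<^esub> c) = cst c"
  unfolding pi_map_def by (rule I.induced_map_one[OF pol_rep cst_intertwines]) simp

text \<open>
  Both sides are endomorphisms of the induced module that agree on the generator.
\<close>

lemma psi_pi: "x \<in> carrier I.M \<Longrightarrow> psi (pi_map x) = x"
proof (rule I.hom_eqI[OF I.M_lie_rep, of "\<lambda>x. psi (pi_map x)" "\<lambda>x. x"])
  show "intertwiner (sl n) I.M I.M (\<lambda>x. psi (pi_map x))"
    by (rule intertwiner_comp[OF pi_intertwines psi_intertwines])
  show "intertwiner (sl n) I.M I.M (\<lambda>x. x)" by (rule intertwinerI) simp_all
  show "psi (pi_map (I.T \<one>\<^bsub>I.U\<^esub> v)) = I.T \<one>\<^bsub>I.U\<^esub> v" for v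
    by (simp add: pi_tensor psi_cst flip: T_scalar)
qed

end

section \<open>Homomorphisms into the scalar module\<close>

context scalar_verma
begin

lemma N_plus_parabolic: "j < d \<Longrightarrow> N_plus n j \<in> parabolic n"
  unfolding parabolic_iff lower_free_def
  by (auto simp: N_plus_index) (auto simp: N_plus_def intro!: E_unit_sl)

lemma levi_N_plus: "levi (N_plus n j) = 0 \<cdot>\<^sub>m 0\<^sub>m d d"
  by (rule eq_matI) (auto simp: levi_index N_plus_index)

lemma zero_sl: "0\<^sub>m d d \<in> sl d"
  by (simp add: sl_def)

lemma H0_parabolic: "H0 n \<in> parabolic n"
  unfolding parabolic_iff lower_free_def
  using d_pos by (auto simp: H0_index sl_def sum_less_n intro!: carrier_matI)

lemma levi_H0: "levi (H0 n) = 0 \<cdot>\<^sub>m 0\<^sub>m d d"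
  by (rule eq_matI) (auto simp: levi_index H0_index)

lemma m_embed_parabolic:
  assumes X: "X \<in> sl d"
  shows "m_embed n X \<in> parabolic n" "levi (m_embed n X) = X" "j < n \<Longrightarrow> m_embed n X $$ (0, j) = 0"
proof -
  have c: "X \<in> carrier_mat d d" using X by (rule sl_carrier)
  have "top_row (0\<^sub>m n n)" by (simp add: top_row_def)
  moreover have "m_embed n X = m_embed n X + 0 \<cdot>\<^sub>m H0 n + 0\<^sub>m n n"
    by (rule eq_matI) (use m_embed_dim[OF c] in auto)
  ultimately have "m_embed n X \<in> sl n" "lower_free (m_embed n X)" "levi (m_embed n X) = X"
    using parabolic_decomp(1,2)[OF X] parabolic_decomp(4)[OF X, symmetric] by blast+
  then show "m_embed n X \<in> parabolic n" "levi (m_embed n X) = X" by (auto simp: parabolic_iff)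
  show "j < n \<Longrightarrow> m_embed n X $$ (0, j) = 0" by (simp add: m_embed_index[OF c])
qed

text \<open>
  The degree of a monomial in \<open>h w\<close> is governed by two matrices: \<open>H0 n\<close> acts on \<open>h w\<close> by \<open>r\<close> and on
  degree \<open>k\<close> by \<open>s - k - k / d\<close>, while \<open>N_plus n j\<close> acts by \<open>(s - Eu) \<partial>\<^sub>j\<close> and kills \<open>h w\<close>.
\<close>

lemma singular_vector_degree:
  assumes \<sigma>: "lie_rep (sl d) \<sigma>"
    and h: "intertwiner (parabolic n) (parabolic_module n \<sigma> r) (pol s) h"
    and w: "w \<in> carrier \<sigma>" and m: "lookup (h w) m \<noteq> 0"
  shows "r = s - of_nat (mdeg m) - of_nat (mdeg m) / of_nat d"
    and "mdeg m = 0 \<or> s = of_nat (mdeg m) - 1"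
proof -
  interpret \<sigma>: lie_representation "sl d" \<sigma> using \<sigma> by unfold_locales
  note D = intertwinerD[OF h, simplified]
  have zero: "act \<sigma> (0 \<cdot>\<^sub>m 0\<^sub>m d d) w = \<zero>\<^bsub>\<sigma>\<^esub>"
    using w by (simp add: \<sigma>.act_smult zero_sl del: smult_zero_mat)
  have h0: "h \<zero>\<^bsub>\<sigma>\<^esub> = 0" using D(3)[of "\<zero>\<^bsub>\<sigma>\<^esub>" 0] by simp
  have "h w \<in> poly_in d" using D(1) w by simp
  then have md: "mono_in d m" using m by (auto simp: poly_in_def)
  have "h (act (parabolic_module n \<sigma> r) (H0 n) w) = cst r * h w"
    using w D(3) by (simp add: parabolic_act[OF H0_parabolic] levi_H0 zero H0_index del: smult_zero_mat)
  then have "cst r * h w = pol_op.mat_op s n (H0 n) (h w)"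
    using D(4)[OF H0_parabolic w] by simp
  also have "\<dots> = Hop s (h w) + cst (- 1 / of_nat d) * (\<Sum>i<d. Xop i (Dop i (h w)))"
  proof -
    have "(\<Sum>i<d. \<Sum>j<d. cst (H0 n $$ (Suc i, Suc j)) * Xop i (Dop j (h w))) =
        (\<Sum>i<d. \<Sum>j<d. if i = j then cst (- 1 / of_nat d) * Xop i (Dop j (h w)) else 0)"
      by (intro sum.cong refl) (simp add: H0_index)
    also have "\<dots> = cst (- 1 / of_nat d) * (\<Sum>i<d. Xop i (Dop i (h w)))"
      by (simp add: sum_distrib_left)
    finally show ?thesis unfolding pol_expand by (simp add: H0_index cst_simps(3))
  qed
  finally have "lookup (cst r * h w) m =
      lookup (Hop s (h w) + cst (- 1 / of_nat d) * (\<Sum>i<d. Xop i (Dop i (h w)))) m"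
    by (rule arg_cong)
  then have "r * lookup (h w) m = (s - of_nat (mdeg m) - of_nat (mdeg m) / of_nat d) * lookup (h w) m"
    by (simp only: lookup_add lookup_cst_mult lookup_Hop lookup_Euler[OF md]) (simp add: algebra_simps)
  then show "r = s - of_nat (mdeg m) - of_nat (mdeg m) / of_nat d" using m by simp
  show "mdeg m = 0 \<or> s = of_nat (mdeg m) - 1"
  proof (cases "m = 0")
    case True
    then show ?thesis by (simp add: mdeg_zero_iff)
  next
    case False
    then obtain j where j: "lookup m j > 0"
      by (metis gr0I poly_mapping_eqI lookup_zero)
    then have jd: "j < d" using md by (auto simp: mono_in_def not_less[symmetric])
    have "h (act (parabolic_module n \<sigma> r) (N_plus n j) w) = 0"
      using w h0 by (simp add: parabolic_act[OF N_plus_parabolic[OF jd]] levi_N_plus zero N_plus_index del: smult_zero_mat)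
    then have "pol_op.mat_op s n (N_plus n j) (h w) = 0"
      using D(4)[OF N_plus_parabolic[OF jd] w] by simp
    moreover have "pol_op.mat_op s n (N_plus n j) (h w) = Hop s (Dop j (h w))"
      unfolding N_plus_def by (subst pol_op.mat_op_unit) (use jd in \<open>simp_all add: raise_op_def lower_op_def\<close>)
    ultimately have "lookup (Hop s (Dop j (h w))) (m - var j) = 0" by simp
    then have "s - of_nat (mdeg (m - var j)) = 0"
      using m j by (auto simp: minus_var_cancel simp del: of_nat_Suc)
    then show ?thesis using mdeg_minus_var[OF j] by (auto simp flip: of_nat_Suc simp add: algebra_simps)
  qed
qed

text \<open>
  The relation between \<open>r\<close> and the degree leaves room for a single degree.
\<close>

lemma intertwiner_to_sym:
  assumes \<sigma>: "lie_rep (sl d) \<sigma>"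
    and h: "intertwiner (parabolic n) (parabolic_module n \<sigma> r) (pol s) h"
    and r: "r = s - of_nat k - of_nat k / of_nat d"
  shows "intertwiner (sl d) \<sigma> (sym_power d k) h"
proof -
  interpret \<sigma>: lie_representation "sl d" \<sigma> using \<sigma> by unfold_locales
  note D = intertwinerD[OF h, simplified]
  have homog: "h w \<in> homog d k" if w: "w \<in> carrier \<sigma>" for w
  proof -
    have "mdeg m = k" if m: "lookup (h w) m \<noteq> 0" for m
    proof -
      have "of_nat (mdeg m) + of_nat (mdeg m) / of_nat d = (of_nat k + of_nat k / of_nat d :: complex)"
        using singular_vector_degree(1)[OF \<sigma> h w m] r by (simp add: algebra_simps)
      then have "of_nat (mdeg m * (d + 1)) = (of_nat (k * (d + 1)) :: complex)"
        using d_pos by (simp add: field_simps)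
      then have "mdeg m * (d + 1) = k * (d + 1)" by (simp only: of_nat_eq_iff)
      then show ?thesis unfolding mult_cancel2 by simp
    qed
    then show ?thesis using D(1)[OF w] by (auto simp: homog_def poly_in_def)
  qed
  show ?thesis
  proof (rule intertwinerI)
    fix X w assume X: "X \<in> sl d" and w: "w \<in> carrier \<sigma>"
    note mp = m_embed_parabolic[OF X]
    have "h (act (parabolic_module n \<sigma> r) (m_embed n X) w) = pol_op.mat_op s n (m_embed n X) (h w)"
      using D(4)[OF mp(1) w] by simp
    also have "\<dots> = sym_op.mat_op d X (h w)"
      using pol_parabolic[OF mp(1) homog[OF w], of s] mp by simp
    finally show "h (act \<sigma> X w) = act (sym_power d k) X (h w)"
      using w X mp by (simp add: parabolic_act sym_power_eq)
  qed (simp_all add: D homog sym_power_eq)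
qed

text \<open>
  For \<open>s = k - 1\<close> the operator \<open>s - Eu\<close> vanishes in degree \<open>k - 1\<close>, where the derivatives of a
  polynomial of degree \<open>k\<close> lie; so the nilradical acts by zero in degree \<open>k\<close>.
\<close>

lemma sym_to_pol:
  assumes r: "r = s - of_nat k - of_nat k / of_nat d" and k: "k = 0 \<or> s = of_nat k - 1"
  shows "intertwiner (parabolic n) (parabolic_module n (sym_power d k) r) (pol s) (\<lambda>p. p)"
proof (rule intertwinerI)
  fix Z p assume Z: "Z \<in> parabolic n" and "p \<in> carrier (parabolic_module n (sym_power d k) r)"
  then have p: "p \<in> homog d k" by (simp add: sym_power_eq)
  have "Hop s (Dop j p) = 0" for j
  proof (rule poly_mapping_eqI)
    fix m
    have "lookup p (m + var j) = 0 \<or> k = mdeg m + 1"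
      using p by (auto simp: homog_def mdeg_add)
    then show "lookup (Hop s (Dop j p)) m = lookup 0 m"
      using k by auto
  qed
  then have "(\<Sum>j<d. cst (Z $$ (0, Suc j)) * Hop s (Dop j p)) = 0" by simp
  then show "act (parabolic_module n (sym_power d k) r) Z p = act (pol s) Z p"
    using pol_parabolic[OF Z p, of s] by (simp add: parabolic_act[OF Z] sym_power_eq r)
qed (auto simp: sym_power_eq homog_poly_in)

lemma M_eq: "I.M = Verma n triv s"
  by (simp add: Verma_def)

lemma hom_to_pol:
  assumes \<sigma>: "lie_rep (sl d) \<sigma>" and f: "intertwiner (sl n) (Verma n \<sigma> r) (Verma n triv s) f"
  shows "intertwiner (parabolic n) (parabolic_module n \<sigma> r) (pol s)
    (\<lambda>w. pi_map (f (Verma_tensor n \<sigma> r \<one>\<^bsub>uea (sl n)\<^esub> w)))"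
proof -
  interpret S: induced_rep "sl n" "parabolic n" "parabolic_module n \<sigma> r"
    by (rule verma_induced_rep[OF \<sigma>])
  show ?thesis
    using intertwiner_comp[OF intertwiner_comp[OF S.T_one_intertwines intertwiner_mono[OF f[unfolded Verma_def] parabolic_sub]]
        intertwiner_mono[OF pi_intertwines parabolic_sub]]
    by (simp add: Verma_tensor_def)
qed

lemma Verma_map_props:
  assumes \<sigma>: "lie_rep (sl d) \<sigma>" and \<tau>: "lie_rep (sl d) \<tau>" and \<iota>: "\<iota> \<in> lie_equiv (sl d) \<sigma> \<tau>"
  shows "intertwiner (sl n) (Verma n \<sigma> r) (Verma n \<tau> r) (Verma_map n r \<sigma> \<tau> \<iota>)"
    and "\<And>w. w \<in> carrier \<sigma> \<Longrightarrow> Verma_map n r \<sigma> \<tau> \<iota> (Verma_tensor n \<sigma> r \<one>\<^bsub>uea (sl n)\<^esub> w)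
      = Verma_tensor n \<tau> r \<one>\<^bsub>uea (sl n)\<^esub> (\<iota> w)"
proof -
  interpret S: induced_rep "sl n" "parabolic n" "parabolic_module n \<sigma> r"
    by (rule verma_induced_rep[OF \<sigma>])
  interpret T: induced_rep "sl n" "parabolic n" "parabolic_module n \<tau> r"
    by (rule verma_induced_rep[OF \<tau>])
  have "intertwiner (sl d) \<sigma> \<tau> \<iota>" using \<iota> by (simp add: lie_equiv_def lie_hom_iff)
  then have h: "intertwiner (parabolic n) (parabolic_module n \<sigma> r) T.M (\<lambda>w. T.T \<one>\<^bsub>T.U\<^esub> (\<iota> w))"
    by (rule intertwiner_comp[OF parabolic_intertwiner[OF \<sigma>] T.T_one_intertwines])
  show "intertwiner (sl n) (Verma n \<sigma> r) (Verma n \<tau> r) (Verma_map n r \<sigma> \<tau> \<iota>)"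
    using S.induced_map(1)[OF T.M_lie_rep h] by (simp add: Verma_def Verma_map_def Verma_tensor_def)
  show "Verma_map n r \<sigma> \<tau> \<iota> (Verma_tensor n \<sigma> r \<one>\<^bsub>uea (sl n)\<^esub> w)
      = Verma_tensor n \<tau> r \<one>\<^bsub>uea (sl n)\<^esub> (\<iota> w)" if "w \<in> carrier \<sigma>" for w
    using S.induced_map_one[OF T.M_lie_rep h, of w] that by (simp add: Verma_def Verma_map_def Verma_tensor_def)
qed

text \<open>
  Both cases with a nonzero homomorphism are of this form: \<open>j\<close> embeds the inducing space \<open>\<tau>\<close> in degree \<open>k\<close>,
  and \<open>\<theta>\<close> is the homomorphism that spans the line.  Schur's lemma compares a given homomorphism, read
  in polynomials on the inducing space, with \<open>j \<circ> \<iota>\<close>.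
\<close>

lemma hom_space_line:
  assumes \<sigma>: "fin_dim_irrep (sl d) \<sigma>" and \<tau>: "lie_rep (sl d) \<tau>" and \<iota>: "\<iota> \<in> lie_equiv (sl d) \<sigma> \<tau>"
    and r: "r = s - of_nat k - of_nat k / of_nat d"
    and j: "intertwiner (sl d) \<tau> (sym_power d k) j" "bij_betw j (carrier \<tau>) (carrier (sym_power d k))"
    and \<theta>: "intertwiner (sl n) (Verma n \<tau> r) (Verma n triv s) \<theta>"
      "\<And>w. w \<in> carrier \<tau> \<Longrightarrow> \<theta> (Verma_tensor n \<tau> r \<one>\<^bsub>uea (sl n)\<^esub> w) = psi (j w)"
  shows "lie_hom (sl n) (Verma n \<sigma> r) (Verma n triv s) =
    (\<lambda>f. compose (carrier (Verma n \<sigma> r)) f (Verma_map n r \<sigma> \<tau> \<iota>)) ` line_of (Verma n \<tau> r) (Verma n triv s) \<theta>"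
proof (intro equalityI subsetI)
  note \<sigma>r = irrep_lie_rep[OF \<sigma>]
  interpret S: induced_rep "sl n" "parabolic n" "parabolic_module n \<sigma> r"
    by (rule verma_induced_rep[OF \<sigma>r])
  have SM: "lie_rep (sl n) (Verma n \<sigma> r)" using S.M_lie_rep by (simp add: Verma_def)
  have M: "lie_rep (sl n) (Verma n triv s)" using I.M_lie_rep by (simp add: Verma_def)
  note V = Verma_map_props[OF \<sigma>r \<tau> \<iota>, where r = r]
  let ?V = "Verma_map n r \<sigma> \<tau> \<iota>"
  have \<iota>': "intertwiner (sl d) \<sigma> \<tau> \<iota>" "bij_betw \<iota> (carrier \<sigma>) (carrier \<tau>)"
    using \<iota> by (simp_all add: lie_equiv_def lie_hom_iff)
  have line: "compose (carrier (Verma n \<sigma> r)) (\<lambda>x\<in>carrier (Verma n \<tau> r). c \<odot>\<^bsub>Verma n triv s\<^esub> \<theta> x) ?V =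
      (\<lambda>x\<in>carrier (Verma n \<sigma> r). c \<odot>\<^bsub>Verma n triv s\<^esub> \<theta> (?V x))" for c
    using intertwiner_closed[OF V(1)] by (auto simp: compose_def fun_eq_iff)
  have comp: "intertwiner (sl n) (Verma n \<sigma> r) (Verma n triv s) (\<lambda>x. c \<odot>\<^bsub>Verma n triv s\<^esub> \<theta> (?V x))" for c
    by (rule intertwiner_scaled[OF M intertwiner_comp[OF V(1) \<theta>(1)]])
  {
    fix f assume "f \<in> lie_hom (sl n) (Verma n \<sigma> r) (Verma n triv s)"
    then have f: "intertwiner (sl n) (Verma n \<sigma> r) (Verma n triv s) f" "f \<in> extensional (carrier (Verma n \<sigma> r))"
      by (simp_all add: lie_hom_iff)
    let ?h = "\<lambda>w. pi_map (f (Verma_tensor n \<sigma> r \<one>\<^bsub>uea (sl n)\<^esub> w))"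
    have "intertwiner (sl d) \<sigma> (sym_power d k) ?h"
      by (rule intertwiner_to_sym[OF \<sigma>r hom_to_pol[OF \<sigma>r f(1)] r])
    moreover have "intertwiner (sl d) \<sigma> (sym_power d k) (\<lambda>w. j (\<iota> w))"
      by (rule intertwiner_comp[OF \<iota>'(1) j(1)])
    moreover have "bij_betw (\<lambda>w. j (\<iota> w)) (carrier \<sigma>) (carrier (sym_power d k))"
      using bij_betw_trans[OF \<iota>'(2) j(2)] by (simp add: comp_def)
    ultimately obtain c where c: "\<And>w. w \<in> carrier \<sigma> \<Longrightarrow> ?h w = cst c * j (\<iota> w)"
      using sym_schur[OF d_pos \<sigma>] by blast
    have tens: "Verma_tensor n \<sigma> r \<one>\<^bsub>uea (sl n)\<^esub> w \<in> carrier (Verma n \<sigma> r)" if "w \<in> carrier \<sigma>" for w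
      using that S.T_closed[of "\<one>\<^bsub>S.U\<^esub>" w] by (simp add: Verma_tensor_def Verma_def)
    have "f (Verma_tensor n \<sigma> r \<one>\<^bsub>uea (sl n)\<^esub> w) = c \<odot>\<^bsub>Verma n triv s\<^esub> \<theta> (?V (Verma_tensor n \<sigma> r \<one>\<^bsub>uea (sl n)\<^esub> w))"
      if w: "w \<in> carrier \<sigma>" for w
    proof -
      have "f (Verma_tensor n \<sigma> r \<one>\<^bsub>uea (sl n)\<^esub> w) = psi (?h w)"
        using psi_pi[of "f (Verma_tensor n \<sigma> r \<one>\<^bsub>uea (sl n)\<^esub> w)"] intertwiner_closed[OF f(1) tens[OF w]] by (simp add: M_eq)
      also have "\<dots> = c \<odot>\<^bsub>Verma n triv s\<^esub> psi (j (\<iota> w))"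
        using c[OF w] psi_scalar by (simp add: M_eq)
      finally show ?thesis
        using V(2)[OF w] \<theta>(2) intertwiner_closed[OF \<iota>'(1) w] by simp
    qed
    then have "f x = c \<odot>\<^bsub>Verma n triv s\<^esub> \<theta> (?V x)" if "x \<in> carrier (Verma n \<sigma> r)" for x
      using S.hom_eqI[OF M, of f "\<lambda>x. c \<odot>\<^bsub>Verma n triv s\<^esub> \<theta> (?V x)" x] f(1) comp[of c] that
      by (simp add: Verma_tensor_def Verma_def)
    then have "f = (\<lambda>x\<in>carrier (Verma n \<sigma> r). c \<odot>\<^bsub>Verma n triv s\<^esub> \<theta> (?V x))"
      using f(2) by (intro extensionalityI[where A = "carrier (Verma n \<sigma> r)"]) auto
    then show "f \<in> (\<lambda>f. compose (carrier (Verma n \<sigma> r)) f ?V) ` line_of (Verma n \<tau> r) (Verma n triv s) \<theta>"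
      unfolding line_of_def
      by (intro image_eqI[where x = "\<lambda>x\<in>carrier (Verma n \<tau> r). c \<odot>\<^bsub>Verma n triv s\<^esub> \<theta> x"]) (auto simp: line)
  next
    fix f assume "f \<in> (\<lambda>f. compose (carrier (Verma n \<sigma> r)) f ?V) ` line_of (Verma n \<tau> r) (Verma n triv s) \<theta>"
    then obtain c where "f = (\<lambda>x\<in>carrier (Verma n \<sigma> r). c \<odot>\<^bsub>Verma n triv s\<^esub> \<theta> (?V x))"
      unfolding line_of_def using line by blast
    moreover have "intertwiner (sl n) (Verma n \<sigma> r) (Verma n triv s) (\<lambda>x\<in>carrier (Verma n \<sigma> r). c \<odot>\<^bsub>Verma n triv s\<^esub> \<theta> (?V x))"
      by (rule intertwiner_cong[OF SM comp[of c]]) simp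
    ultimately show "f \<in> lie_hom (sl n) (Verma n \<sigma> r) (Verma n triv s)" by (simp add: lie_hom_iff)
  }
qed

lemma phi_sym_eq: "s = of_nat k - 1 \<Longrightarrow> phi_sym n k = psi"
proof (rule ext)
  fix p assume a: "s = of_nat k - 1"
  show "phi_sym n k p = psi p"
    unfolding phi_sym_def Let_def a[symmetric] tensor_monomial M_eq[symmetric] psi_def I.M.linear_ext_def ..
qed

lemma cst_bij: "bij_betw cst (carrier triv) (carrier (sym_power d 0))"
proof -
  have "p = cst (lookup p 0)" if "p \<in> homog d 0" for p
    by (rule poly_mapping_eqI) (use that in \<open>auto simp: homog_def lookup_single when_def mdeg_zero_iff\<close>)
  then have "homog d 0 \<subseteq> range cst" by blast
  then show ?thesis using cst_homog inj_single[of 0] by (auto simp: bij_betw_def sym_power_eq intro: inj_onI dest: injD)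
qed

lemma cst_sym: "intertwiner (sl d) triv (sym_power d 0) cst"
  by (rule intertwinerI) (auto simp: sym_power_eq cst_homog cst_ops single_add mult_single)

text \<open>
  A nonzero homomorphism is nonzero on some \<open>1 \<otimes> w\<close>, whose image determines a degree \<open>k\<close>.  Degree 0
  leads to the trivial representation and \<open>r = s\<close>, positive degree to \<open>s = k - 1\<close>.
\<close>

lemma hom_space_trivial:
  assumes \<sigma>: "fin_dim_irrep (sl d) \<sigma>"
    and f: "f \<in> lie_hom (sl n) (Verma n \<sigma> r) (Verma n triv s)"
    and nz: "f \<noteq> (\<lambda>x\<in>carrier (Verma n \<sigma> r). \<zero>\<^bsub>Verma n triv s\<^esub>)"
  shows "(lie_equiv (sl d) \<sigma> triv \<noteq> {} \<and> r = s)
    \<or> (\<exists>k. lie_equiv (sl d) \<sigma> (sym_power d k) \<noteq> {} \<and> s = of_nat k - 1 \<and> r = - (1 + of_nat k / of_nat d))"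
proof -
  note \<sigma>r = irrep_lie_rep[OF \<sigma>]
  interpret S: induced_rep "sl n" "parabolic n" "parabolic_module n \<sigma> r"
    by (rule verma_induced_rep[OF \<sigma>r])
  have f': "intertwiner (sl n) (Verma n \<sigma> r) (Verma n triv s) f" "f \<in> extensional (carrier (Verma n \<sigma> r))"
    using f by (simp_all add: lie_hom_iff)
  have M: "lie_rep (sl n) (Verma n triv s)" using I.M_lie_rep by (simp add: Verma_def)
  define h where "h w = pi_map (f (Verma_tensor n \<sigma> r \<one>\<^bsub>uea (sl n)\<^esub> w))" for w
  have h: "intertwiner (parabolic n) (parabolic_module n \<sigma> r) (pol s) h"
    unfolding h_def by (rule hom_to_pol[OF \<sigma>r f'(1)])
  have tens: "Verma_tensor n \<sigma> r \<one>\<^bsub>uea (sl n)\<^esub> w \<in> carrier (Verma n \<sigma> r)" if "w \<in> carrier \<sigma>" for w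
    using that S.T_closed[of "\<one>\<^bsub>S.U\<^esub>" w] by (simp add: Verma_tensor_def Verma_def)
  have psi0: "psi 0 = \<zero>\<^bsub>Verma n triv s\<^esub>"
    using psi_scalar[of 0 0] by (simp add: M_eq[symmetric])
  have "\<exists>w\<in>carrier \<sigma>. h w \<noteq> 0"
  proof (rule ccontr)
    assume "\<not> ?thesis"
    then have "f (Verma_tensor n \<sigma> r \<one>\<^bsub>uea (sl n)\<^esub> w) = \<zero>\<^bsub>Verma n triv s\<^esub>" if "w \<in> carrier \<sigma>" for w
      using psi_pi[of "f (Verma_tensor n \<sigma> r \<one>\<^bsub>uea (sl n)\<^esub> w)"] intertwiner_closed[OF f'(1) tens[OF that]] that psi0
      by (simp add: M_eq h_def)
    moreover have "intertwiner (sl n) (Verma n \<sigma> r) (Verma n triv s) (\<lambda>x. \<zero>\<^bsub>Verma n triv s\<^esub>)"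
      by (rule intertwinerI) (simp_all add: M_eq[symmetric])
    ultimately have "f x = \<zero>\<^bsub>Verma n triv s\<^esub>" if "x \<in> carrier (Verma n \<sigma> r)" for x
      using S.hom_eqI[OF M, of f "\<lambda>x. \<zero>\<^bsub>Verma n triv s\<^esub>" x] f'(1) that
      by (simp add: Verma_tensor_def Verma_def)
    then have "f = (\<lambda>x\<in>carrier (Verma n \<sigma> r). \<zero>\<^bsub>Verma n triv s\<^esub>)"
      using f'(2) by (intro extensionalityI[where A = "carrier (Verma n \<sigma> r)"]) auto
    with nz show False by simp
  qed
  then obtain w where w: "w \<in> carrier \<sigma>" "h w \<noteq> 0" by blast
  then obtain m where m: "lookup (h w) m \<noteq> 0" by (metis poly_mapping_eqI lookup_zero)
  define k where "k = mdeg m"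
  have r: "r = s - of_nat k - of_nat k / of_nat d" and k: "k = 0 \<or> s = of_nat k - 1"
    using singular_vector_degree[OF \<sigma>r h w(1) m] by (simp_all add: k_def)
  have g: "intertwiner (sl d) \<sigma> (sym_power d k) h" by (rule intertwiner_to_sym[OF \<sigma>r h r])
  then have bij: "bij_betw h (carrier \<sigma>) (carrier (sym_power d k))"
    using sym_hom_bij[OF d_pos \<sigma>] w by blast
  have equiv: "restrict f (carrier \<sigma>) \<in> lie_equiv (sl d) \<sigma> \<tau>"
    if "intertwiner (sl d) \<sigma> \<tau> f" "bij_betw f (carrier \<sigma>) (carrier \<tau>)" for f and \<tau> :: "'v lie_module"
  proof -
    have "intertwiner (sl d) \<sigma> \<tau> (restrict f (carrier \<sigma>))"
      by (rule intertwiner_cong[OF \<sigma>r that(1)]) simp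
    moreover have "bij_betw (restrict f (carrier \<sigma>)) (carrier \<sigma>) (carrier \<tau>)"
      using that(2) by (simp cong: bij_betw_cong)
    ultimately show ?thesis by (simp add: lie_equiv_def lie_hom_iff)
  qed
  show ?thesis
  proof (cases "k = 0")
    case True
    let ?i = "\<lambda>w. inv_into UNIV cst (h w)"
    have ci: "intertwiner (sl d) (sym_power d 0) triv (inv_into UNIV cst)"
      using intertwiner_inverse[OF triv_rep cst_sym cst_bij] by simp
    have "intertwiner (sl d) \<sigma> triv ?i"
      using g True by (intro intertwiner_comp[OF _ ci]) simp
    moreover have "bij_betw ?i (carrier \<sigma>) (carrier triv)"
      using bij_betw_trans[OF bij, of "inv_into UNIV cst" "carrier triv"] bij_betw_inv_into[OF cst_bij] True
      by (simp add: comp_def)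
    ultimately have "lie_equiv (sl d) \<sigma> triv \<noteq> {}" using equiv by blast
    then show ?thesis using r True by simp
  next
    case False
    then have "s = of_nat k - 1" "r = - (1 + of_nat k / of_nat d)" using k r by auto
    then show ?thesis using equiv[OF g bij] by blast
  qed
qed

end

theorem theorem5p23:
  fixes n :: nat and \<sigma> :: "'w lie_module" and s r :: complex
  assumes "n \<ge> 2"
    and "fin_dim_irrep (sl (n - 1)) \<sigma>"
  shows "(\<forall>\<iota>. \<iota> \<in> lie_equiv (sl (n - 1)) \<sigma> triv \<and> r = s \<longrightarrow>
            lie_hom (sl n) (Verma n \<sigma> r) (Verma n triv s) =
              (\<lambda>f. compose (carrier (Verma n \<sigma> r)) f (Verma_map n r \<sigma> triv \<iota>)) `
                line_of (Verma n triv s) (Verma n triv s) id)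
       \<and> (\<forall>k \<iota>. \<iota> \<in> lie_equiv (sl (n - 1)) \<sigma> (sym_power (n - 1) k)
              \<and> s = of_nat k - 1 \<and> r = - (1 + of_nat k / of_nat (n - 1)) \<longrightarrow>
            lie_hom (sl n) (Verma n \<sigma> r) (Verma n triv s) =
              (\<lambda>f. compose (carrier (Verma n \<sigma> r)) f
                     (Verma_map n r \<sigma> (sym_power (n - 1) k) \<iota>)) `
                line_of (Verma n (sym_power (n - 1) k) r) (Verma n triv s) (phi n k))
       \<and> ((lie_equiv (sl (n - 1)) \<sigma> triv = {} \<or> r \<noteq> s)
            \<and> \<not> (\<exists>k. lie_equiv (sl (n - 1)) \<sigma> (sym_power (n - 1) k) \<noteq> {}
                  \<and> s = of_nat k - 1 \<and> r = - (1 + of_nat k / of_nat (n - 1))) \<longrightarrow>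
            lie_hom (sl n) (Verma n \<sigma> r) (Verma n triv s) =
              {\<lambda>x\<in>carrier (Verma n \<sigma> r). \<zero>\<^bsub>Verma n triv s\<^esub>})"
proof -
  define d where "d = n - 1"
  interpret scalar_verma n d s
    using assms(1) by unfold_locales (auto simp: d_def)
  have \<sigma>: "fin_dim_irrep (sl d) \<sigma>" unfolding d_def by (rule assms(2))
  have M: "lie_rep (sl n) (Verma n triv s)" using I.M_lie_rep by (simp add: Verma_def)
  show ?thesis
    unfolding d_def[symmetric]
  proof (intro conjI allI impI)
    fix \<iota> assume "\<iota> \<in> lie_equiv (sl d) \<sigma> triv \<and> r = s"
    then have \<iota>: "\<iota> \<in> lie_equiv (sl d) \<sigma> triv" and rs: "r = s" by auto
    have id: "intertwiner (sl n) (Verma n triv s) (Verma n triv s) id"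
      by (rule intertwinerI) (simp_all add: M_eq[symmetric])
    \<comment> \<open>degree 0: the trivial representation is embedded as the constants\<close>
    show "lie_hom (sl n) (Verma n \<sigma> r) (Verma n triv s) =
        (\<lambda>f. compose (carrier (Verma n \<sigma> r)) f (Verma_map n r \<sigma> triv \<iota>)) ` line_of (Verma n triv s) (Verma n triv s) id"
      unfolding rs
      by (rule hom_space_line[OF \<sigma> triv_rep \<iota> _ cst_sym cst_bij id])
         (simp_all add: Verma_tensor_def psi_cst flip: T_scalar)
  next
    fix k \<iota>
    assume a: "\<iota> \<in> lie_equiv (sl d) \<sigma> (sym_power d k) \<and> s = of_nat k - 1 \<and> r = - (1 + of_nat k / of_nat d)"
    then have r: "r = s - of_nat k - of_nat k / of_nat d" and rp: "r_param n k = r"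
      and sk: "s = of_nat k - 1" and \<iota>: "\<iota> \<in> lie_equiv (sl d) \<sigma> (sym_power d k)"
      by (auto simp: r_param_def)
    interpret T: induced_rep "sl n" "parabolic n" "parabolic_module n (sym_power d k) r"
      by (rule verma_induced_rep[OF sym_power_rep])
    have h: "intertwiner (parabolic n) (parabolic_module n (sym_power d k) r) (Verma n triv s) psi"
      using intertwiner_comp[OF sym_to_pol[OF r disjI2[OF sk]] intertwiner_mono[OF psi_intertwines parabolic_sub]]
      by (simp only: M_eq)
    have phi: "phi n k = induced_map (sl n) (parabolic n) (parabolic_module n (sym_power d k) r) (Verma n triv s) psi"
      unfolding phi_def rp sk[symmetric] phi_sym_eq[OF sk] by simp
    have "bij_betw (\<lambda>p. p) (carrier (sym_power d k)) (carrier (sym_power d k))"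
      using bij_betw_id by (simp add: id_def)
    moreover have "intertwiner (sl d) (sym_power d k) (sym_power d k) (\<lambda>p. p)"
      by (rule intertwinerI) simp_all
    ultimately show "lie_hom (sl n) (Verma n \<sigma> r) (Verma n triv s) =
        (\<lambda>f. compose (carrier (Verma n \<sigma> r)) f (Verma_map n r \<sigma> (sym_power d k) \<iota>)) `
          line_of (Verma n (sym_power d k) r) (Verma n triv s) (phi n k)"
      using T.induced_map(1)[OF M h] T.induced_map_one[OF M h]
      by (intro hom_space_line[OF \<sigma> sym_power_rep \<iota> r])
         (simp_all add: phi Verma_tensor_def Verma_def[of n "sym_power d k"])
  next
    assume no: "(lie_equiv (sl d) \<sigma> triv = {} \<or> r \<noteq> s)
      \<and> \<not> (\<exists>k. lie_equiv (sl d) \<sigma> (sym_power d k) \<noteq> {} \<and> s = of_nat k - 1 \<and> r = - (1 + of_nat k / of_nat d))"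
    interpret S: induced_rep "sl n" "parabolic n" "parabolic_module n \<sigma> r"
      by (rule verma_induced_rep[OF irrep_lie_rep[OF \<sigma>]])
    have SM: "lie_rep (sl n) (Verma n \<sigma> r)" using S.M_lie_rep by (simp add: Verma_def)
    have "intertwiner (sl n) (Verma n \<sigma> r) (Verma n triv s) (\<lambda>x. \<zero>\<^bsub>Verma n triv s\<^esub>)"
      by (rule intertwinerI) (simp_all add: M_eq[symmetric])
    then have "intertwiner (sl n) (Verma n \<sigma> r) (Verma n triv s) (\<lambda>x\<in>carrier (Verma n \<sigma> r). \<zero>\<^bsub>Verma n triv s\<^esub>)"
      by (rule intertwiner_cong[OF SM]) simp
    then have "(\<lambda>x\<in>carrier (Verma n \<sigma> r). \<zero>\<^bsub>Verma n triv s\<^esub>) \<in> lie_hom (sl n) (Verma n \<sigma> r) (Verma n triv s)"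
      by (simp add: lie_hom_iff)
    moreover have "f = (\<lambda>x\<in>carrier (Verma n \<sigma> r). \<zero>\<^bsub>Verma n triv s\<^esub>)"
      if "f \<in> lie_hom (sl n) (Verma n \<sigma> r) (Verma n triv s)" for f
    proof (rule ccontr)
      assume "f \<noteq> (\<lambda>x\<in>carrier (Verma n \<sigma> r). \<zero>\<^bsub>Verma n triv s\<^esub>)"
      from hom_space_trivial[OF \<sigma> that this] no show False by blast
    qed
    ultimately show "lie_hom (sl n) (Verma n \<sigma> r) (Verma n triv s) =
        {\<lambda>x\<in>carrier (Verma n \<sigma> r). \<zero>\<^bsub>Verma n triv s\<^esub>}" by blast
  qed
qed

end
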